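(* Let $F$ be a finite field of prime order at least $5$ and let $\mathcal{B}$ be a homogenized quadratic factor of complexity $(d_1,d_2)$ on a finite-dimensional vector space $W$ over $F$ with rank at least $r$. Let $f_0,f_1,f_2,f_3:W\to[0,1]$ be $\mathcal{B}$-measurable functions satisfying \[|\Lambda_{W,W,W,W}(f_0,f_1,f_2,f_3)-\mathbb{E}_W(f_0)\mathbb{E}_W(f_1)\mathbb{E}_W(f_2)\mathbb{E}_W(f_3)|\geq\eta\] and $\max_{0\leq i\leq3}\mathbb{E}_W(f_i)\leq 6\eta^{1/4}$, for some $\eta$ with $1\geq\eta\geq 2^{40}|F|^{6d_1+6d_2-r}$. Then there exists $i\in\{0,1,2,3\}$ such that one of the following holds: (i) there is an affine subspace $W'$ of $W$ with $\dim(W')\geq\dim(W)-d_1$ and $\mathbb{E}_{W'}(f_i)\geq\mathbb{E}_W(f_i)+2^{-13}\eta^2$; (ii) there are a positive integer $K\leq(16/\eta)^3$ and an affine subspace $W'$ of $W$ with $\dim(W')\geq\frac{1}{K+1}\dim(W)-2(16/\eta)^3-d_1$ and $\mathbb{E}_{W'}(f_i)\geq\mathbb{E}_W(f_i)+2^{-10}K^{1/3}\eta^{1/4}$.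
   Context: $\mathbb{E}$ denotes averages; $\Lambda_{W,W,W,W}(f_0,\dots,f_3):=\mathbb{E}_{x,h\in W}f_0(x)f_1(x+h)f_2(x+2h)f_3(x+3h)$. $\mathbb{T}_F:=\{t\in\mathbb{R}/\mathbb{Z}:|F|t=0\}$. Quadratic phase: $\phi:W\to\mathbb{R}/\mathbb{Z}$ with $\sum_{\omega\in\{0,1\}^3}(-1)^{3-|\omega|}\phi(x+\omega_1h_1+\omega_2h_2+\omega_3h_3)=0$ for all $x,h_i$; linear phase: $\phi(x+h_1+h_2)-\phi(x+h_1)-\phi(x+h_2)+\phi(x)=0$. Hessian $\nabla^2\phi h_1\cdot h_2=\phi(x+h_1+h_2)-\phi(x+h_1)-\phi(x+h_2)+\phi(x)$, $\nabla\phi(x)\cdot h=\frac12(\phi(x+h)-\phi(x-h))$; $\mathrm{rank}(\phi)$ = codimension of $\ker\nabla^2\phi$. Homogeneous quadratic phase: $\phi(0)=0,\nabla\phi(0)=0$; homogeneous linear phase: linear with $\phi(0)=0$. A homogenized quadratic factor of complexity $(d_1,d_2)$ is the partition of $W$ into nonempty joint level sets (atoms) of $d_1$ homogeneous linear phases and $d_2$ homogeneous quadratic phases $\phi_1,\dots,\phi_{d_2}$, all $\mathbb{T}_F$-valued and linearly independent over $F$; its rank is the minimum of $\mathrm{rank}(\sum_j\lambda_j\phi_j)$ over $\lambda\in F^{d_2}\setminus\{0\}$ with the combination not identically zero (infinite if $d_2=0$). $\mathcal{B}$-measurable means constant on atoms. An affine subspace is a translate of a linear subspace. *)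

theory Defs
  imports Complex_Main "HOL-Library.Cardinality" "HOL-Library.Extended_Real"
    "HOL-Number_Theory.Residues"
begin

quotient_type circle = real / "\<lambda>x y. x - y \<in> (\<int> :: real set)"
proof (rule equivpI)
  show "reflp (\<lambda>x y::real. x - y \<in> \<int>)"
    by (simp add: reflp_def)
  show "symp (\<lambda>x y::real. x - y \<in> \<int>)"
    by (metis (mono_tags, lifting) Ints_minus minus_diff_eq sympI)
  show "transp (\<lambda>x y::real. x - y \<in> \<int>)"
  proof (rule transpI)
    fix x y z :: real
    assume "x - y \<in> \<int>" "y - z \<in> \<int>"
    then have "(x - y) + (y - z) \<in> \<int>" by (rule Ints_add)
    then show "x - z \<in> \<int>" by simp
  qed
qed

instantiation circle :: ab_group_add
begin

lift_definition zero_circle :: circle is "0 :: real" .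

lift_definition plus_circle :: "circle \<Rightarrow> circle \<Rightarrow> circle" is "(+)"
proof -
  fix a b c d :: real
  assume "a - b \<in> \<int>" "c - d \<in> \<int>"
  then have "(a - b) + (c - d) \<in> \<int>" by (rule Ints_add)
  then show "a + c - (b + d) \<in> \<int>" by (simp add: algebra_simps)
qed

lift_definition uminus_circle :: "circle \<Rightarrow> circle" is "uminus"
  by (metis Ints_minus minus_diff_eq minus_diff_minus)

lift_definition minus_circle :: "circle \<Rightarrow> circle \<Rightarrow> circle" is "(-)"
proof -
  fix a b c d :: real
  assume "a - b \<in> \<int>" "c - d \<in> \<int>"
  then have "(a - b) - (c - d) \<in> \<int>" by (rule Ints_diff)
  then show "a - c - (b - d) \<in> \<int>" by (simp add: algebra_simps)
qed

instance
  by standard (transfer; simp)+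

end

lift_definition circle_mult :: "nat \<Rightarrow> circle \<Rightarrow> circle" is "\<lambda>n x. of_nat n * x"
  by (metis Ints_mult Ints_of_nat right_diff_distrib)

lemma circle_mult_0 [simp]: "circle_mult 0 t = 0"
  by transfer simp

lemma circle_mult_Suc: "circle_mult (Suc n) t = t + circle_mult n t"
  by transfer (simp add: algebra_simps)

definition torsion_circle :: "'f itself \<Rightarrow> circle set" where
  "torsion_circle (F :: 'f itself) = {t. circle_mult CARD('f) t = 0}"

text \<open>
  When \<open>'f\<close> has prime order, every scalar is \<open>of_nat n\<close> for some \<open>n\<close>, unique modulo
  \<open>CARD('f)\<close>. So the next definition is the scalar multiplication making
  \<open>torsion_circle TYPE('f)\<close> a vector space over \<open>'f\<close>. It is meaningful only on that set.
\<close>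

definition torsion_scale :: "'f::field \<Rightarrow> circle \<Rightarrow> circle" where
  "torsion_scale c t = circle_mult (LEAST n. of_nat n = c) t"

lemma torsion_scale_of_nat:
  assumes "prime CARD('f::{field,finite})" and t: "t \<in> torsion_circle TYPE('f)"
  shows "torsion_scale (of_nat n :: 'f) t = circle_mult n t"
proof -
  have p: "CHAR('f) = CARD('f)"
    using CHAR_dvd_CARD[where 'a = 'f] assms(1) CHAR_not_1[where 'a = 'f]
    by (metis One_nat_def prime_nat_iff)
  have add: "circle_mult (a + b) t = circle_mult a t + circle_mult b t" for a b
    by transfer (simp add: algebra_simps)
  have "circle_mult (k * CARD('f)) t = 0" for k
    using t by (induction k) (simp_all add: add torsion_circle_def)
  then have modp: "circle_mult (m mod CARD('f)) t = circle_mult m t" for m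
    by (metis add add_0 div_mult_mod_eq)
  have "of_nat (LEAST m. of_nat m = (of_nat n :: 'f)) = (of_nat n :: 'f)"
    by (rule LeastI[of _ n]) simp
  then have "[(LEAST m. of_nat m = (of_nat n :: 'f)) = n] (mod CARD('f))"
    by (simp add: of_nat_eq_iff_cong_CHAR p)
  then show ?thesis
    unfolding torsion_scale_def cong_def by (metis modp)
qed

lemma of_nat_surj_prime_card:
  assumes "prime CARD('f::{field,finite})"
  shows "\<exists>n. of_nat n = (c :: 'f)"
proof -
  have p: "CHAR('f) = CARD('f)"
    using CHAR_dvd_CARD[where 'a = 'f] assms(1) CHAR_not_1[where 'a = 'f]
    by (metis One_nat_def prime_nat_iff)
  have "inj_on (of_nat :: nat \<Rightarrow> 'f) {..<CARD('f)}"
    by (intro inj_onI) (auto simp: of_nat_eq_iff_cong_CHAR p cong_def)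
  then have "card ((of_nat :: nat \<Rightarrow> 'f) ` {..<CARD('f)}) = CARD('f)"
    by (simp add: card_image)
  then have "(of_nat :: nat \<Rightarrow> 'f) ` {..<CARD('f)} = UNIV"
    by (intro card_subset_eq) auto
  then show ?thesis by (metis UNIV_I image_iff)
qed

definition linear_phase :: "('w::ab_group_add \<Rightarrow> circle) \<Rightarrow> bool" where
  "linear_phase \<phi> \<longleftrightarrow>
     (\<forall>x h1 h2. \<phi> (x + h1 + h2) - \<phi> (x + h1) - \<phi> (x + h2) + \<phi> x = 0)"

definition quadratic_phase :: "('w::ab_group_add \<Rightarrow> circle) \<Rightarrow> bool" where
  "quadratic_phase \<phi> \<longleftrightarrow>
     (\<forall>x h1 h2 h3.
        \<phi> (x + h1 + h2 + h3)
        - \<phi> (x + h1 + h2) - \<phi> (x + h1 + h3) - \<phi> (x + h2 + h3)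
        + \<phi> (x + h1) + \<phi> (x + h2) + \<phi> (x + h3)
        - \<phi> x = 0)"

text \<open>
  The Hessian is evaluated at base point \<open>0\<close>; for quadratic phases the base point is
  immaterial by \<open>hessian_base_point\<close> below.
\<close>

definition hessian :: "('w::ab_group_add \<Rightarrow> circle) \<Rightarrow> 'w \<Rightarrow> 'w \<Rightarrow> circle" where
  "hessian \<phi> h1 h2 = \<phi> (h1 + h2) - \<phi> h1 - \<phi> h2 + \<phi> 0"

lemma hessian_base_point:
  assumes "quadratic_phase \<phi>"
  shows "hessian \<phi> h1 h2 = \<phi> (x + h1 + h2) - \<phi> (x + h1) - \<phi> (x + h2) + \<phi> x"
proof -
  have "\<phi> (0 + h1 + h2 + x) - \<phi> (0 + h1 + h2) - \<phi> (0 + h1 + x) - \<phi> (0 + h2 + x)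
        + \<phi> (0 + h1) + \<phi> (0 + h2) + \<phi> (0 + x) - \<phi> 0 = 0"
    using assms unfolding quadratic_phase_def by blast
  then show ?thesis
    unfolding hessian_def by (simp add: algebra_simps)
qed

text \<open>
  The factor one half acts as a scalar of \<open>'f\<close>: for phases valued in
  \<open>torsion_circle TYPE('f)\<close> with \<open>CARD('f)\<close> odd this is the unique halving there,
  whereas halving is ambiguous on the whole circle.
\<close>

definition phase_gradient ::
    "'f::field itself \<Rightarrow> ('w::ab_group_add \<Rightarrow> circle) \<Rightarrow> 'w \<Rightarrow> 'w \<Rightarrow> circle" where
  "phase_gradient (F :: 'f::field itself) \<phi> x h = torsion_scale (1 / 2 :: 'f) (\<phi> (x + h) - \<phi> (x - h))"

definition hessian_kernel :: "('w::ab_group_add \<Rightarrow> circle) \<Rightarrow> 'w set" where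
  "hessian_kernel \<phi> = {h. \<forall>h'. hessian \<phi> h h' = 0}"

definition phase_rank ::
    "('f::field \<Rightarrow> 'w::ab_group_add \<Rightarrow> 'w) \<Rightarrow> ('w \<Rightarrow> circle) \<Rightarrow> nat" where
  "phase_rank scale \<phi> =
     vector_space.dim scale (UNIV :: 'w set) - vector_space.dim scale (hessian_kernel \<phi>)"

definition hom_linear_phase :: "('w::ab_group_add \<Rightarrow> circle) \<Rightarrow> bool" where
  "hom_linear_phase \<phi> \<longleftrightarrow> linear_phase \<phi> \<and> \<phi> 0 = 0"

definition hom_quadratic_phase ::
    "'f::field itself \<Rightarrow> ('w::ab_group_add \<Rightarrow> circle) \<Rightarrow> bool" where
  "hom_quadratic_phase F \<phi> \<longleftrightarrow>
     quadratic_phase \<phi> \<and> \<phi> 0 = 0 \<and> (\<forall>h. phase_gradient F \<phi> 0 h = 0)"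

definition phase_comb :: "nat \<Rightarrow> (nat \<Rightarrow> 'f::field) \<Rightarrow> (nat \<Rightarrow> 'w \<Rightarrow> circle) \<Rightarrow> 'w \<Rightarrow> circle" where
  "phase_comb d c \<phi> x = (\<Sum>j<d. torsion_scale (c j) (\<phi> j x))"

definition phases_independent ::
    "'f::field itself \<Rightarrow> nat \<Rightarrow> nat \<Rightarrow> (nat \<Rightarrow> 'w \<Rightarrow> circle) \<Rightarrow> (nat \<Rightarrow> 'w \<Rightarrow> circle) \<Rightarrow> bool" where
  "phases_independent (F :: 'f::field itself) d1 d2 \<psi> \<phi> \<longleftrightarrow>
     (\<forall>(b :: nat \<Rightarrow> 'f) (c :: nat \<Rightarrow> 'f).
        (\<forall>x. phase_comb d1 b \<psi> x + phase_comb d2 c \<phi> x = 0) \<longrightarrow>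
        (\<forall>i<d1. b i = 0) \<and> (\<forall>j<d2. c j = 0))"

definition joint_level_sets ::
    "nat \<Rightarrow> nat \<Rightarrow> (nat \<Rightarrow> 'w \<Rightarrow> circle) \<Rightarrow> (nat \<Rightarrow> 'w \<Rightarrow> circle) \<Rightarrow> 'w set set" where
  "joint_level_sets d1 d2 \<psi> \<phi> =
     {A. A \<noteq> {} \<and>
         (\<exists>u v. A = {x. (\<forall>i<d1. \<psi> i x = u i) \<and> (\<forall>j<d2. \<phi> j x = v j)})}"

text \<open>
  The linear phases are \<open>\<psi> i\<close> for \<open>i < d1\<close>, the quadratic ones \<open>\<phi> j\<close> for \<open>j < d2\<close>,
  and \<open>\<B>\<close> is the set of atoms. The phases are kept as parameters since the rank is
  defined through them.
\<close>

definition hom_quadratic_factor ::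
    "'f::field itself \<Rightarrow> nat \<Rightarrow> nat \<Rightarrow> (nat \<Rightarrow> 'w::ab_group_add \<Rightarrow> circle) \<Rightarrow>
     (nat \<Rightarrow> 'w \<Rightarrow> circle) \<Rightarrow> 'w set set \<Rightarrow> bool" where
  "hom_quadratic_factor F d1 d2 \<psi> \<phi> \<B> \<longleftrightarrow>
     (\<forall>i<d1. hom_linear_phase (\<psi> i) \<and> range (\<psi> i) \<subseteq> torsion_circle F) \<and>
     (\<forall>j<d2. hom_quadratic_phase F (\<phi> j) \<and> range (\<phi> j) \<subseteq> torsion_circle F) \<and>
     phases_independent F d1 d2 \<psi> \<phi> \<and>
     \<B> = joint_level_sets d1 d2 \<psi> \<phi>"

text \<open>The infimum of the empty set in \<^typ>\<open>enat\<close> is \<open>\<infinity>\<close>, which covers \<open>d2 = 0\<close>.\<close>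

definition factor_rank ::
    "('f::field \<Rightarrow> 'w::ab_group_add \<Rightarrow> 'w) \<Rightarrow> nat \<Rightarrow> (nat \<Rightarrow> 'w \<Rightarrow> circle) \<Rightarrow> enat" where
  "factor_rank scale d2 \<phi> =
     (INF c \<in> {c :: nat \<Rightarrow> 'f. (\<exists>j<d2. c j \<noteq> 0) \<and> (\<exists>x. phase_comb d2 c \<phi> x \<noteq> 0)}.
        enat (phase_rank scale (phase_comb d2 c \<phi>)))"

definition factor_measurable :: "'w set set \<Rightarrow> ('w \<Rightarrow> 'b) \<Rightarrow> bool" where
  "factor_measurable \<B> f \<longleftrightarrow> (\<forall>A\<in>\<B>. \<forall>x\<in>A. \<forall>y\<in>A. f x = f y)"

definition average :: "'a set \<Rightarrow> ('a \<Rightarrow> real) \<Rightarrow> real" where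
  "average A f = (\<Sum>x\<in>A. f x) / real (card A)"

definition four_ap_average ::
    "('f::field \<Rightarrow> 'w::ab_group_add \<Rightarrow> 'w) \<Rightarrow>
     ('w \<Rightarrow> real) \<Rightarrow> ('w \<Rightarrow> real) \<Rightarrow> ('w \<Rightarrow> real) \<Rightarrow> ('w \<Rightarrow> real) \<Rightarrow> real" where
  "four_ap_average scale f0 f1 f2 f3 =
     average (UNIV \<times> UNIV)
       (\<lambda>(x, h). f0 x * f1 (x + h) * f2 (x + scale 2 h) * f3 (x + scale 3 h))"

definition affine_subspace_of_dim ::
    "('f::field \<Rightarrow> 'w::ab_group_add \<Rightarrow> 'w) \<Rightarrow> 'w set \<Rightarrow> nat \<Rightarrow> bool" where
  "affine_subspace_of_dim scale W' n \<longleftrightarrow>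
     (\<exists>a V. module.subspace scale V \<and> W' = (+) a ` V \<and> vector_space.dim scale V = n)"

end

theory Submission
  imports Defs "HOL-Library.Function_Algebras"
begin

text \<open>
  Identify the phases with maps into \<open>F\<close>. High rank makes all nontrivial character sums of the linear
  and quadratic coordinates tiny, both along points and along progressions \<open>x, x + h, x + 2h\<close> (the fourth
  quadratic value is forced by \<open>q(x) - 3 q(x + h) + 3 q(x + 2h) - q(x + 3h) = 0\<close>). So the progression count is,
  up to a small relative error, a model count on the space of coordinates, where Fourier analysis
  in the quadratic coordinates splits it into a term depending only on the densities on the cosets of the common
  kernel of the linear phases and a term controlled by the \<open>\<ell>\<^sup>4\<close> norms of the nonzero Fourier coefficients on these
  cosets. If alternative (i) fails, the coset densities are nearly constant, so some \<open>f i\<close> has a large \<open>\<ell>\<^sup>4\<close> norm on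
  some coset. By Chevalley-Warning any \<open>K\<close> of the quadratics have a large common isotropic subspace, and the coset
  splits into affine subspaces on which all \<open>K\<close> of them are constant. If alternative (ii) fails too, Bessel's
  inequality bounds the sum of the squares of any \<open>K\<close> coefficients by a multiple of \<open>K\<^sup>1\<^sup>/\<^sup>3 \<eta>\<^sup>1\<^sup>/\<^sup>2\<close>, so the
  \<open>K\<close>-th largest one has fourth power at most a small multiple of \<open>\<eta> K\<^sup>-\<^sup>4\<^sup>/\<^sup>3\<close>. This is summable
  over \<open>K\<close>, contradicting the size of the \<open>\<ell>\<^sup>4\<close> norm.
\<close>

section \<open>Additive characters and Fourier analysis\<close>

text \<open>The unit of size is \<kappa>, the fourth root of \<eta>: all densities are at most 6
  \<kappa>, so the defect \<eta> = \<kappa>^4 is of the order of the largest possible product of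
  four densities. The exponent 1/3 is one admissible choice: a gain of order \<kappa> K^s bounds the
  least of K squared coefficients by a multiple of \<kappa>^2 K^(s-1), hence the K-th largest fourth
  power by a multiple of \<kappa>^4 K^(2s-2), which is summable exactly for s < 1/2. The cutoff K <=
  (16/\<eta>)^3 does no harm: beyond it Parseval alone bounds the fourth power by 1/K^2, which is
  already small enough. Bessel is applied with the zero frequency included, so that the squared mean
  cancels the main term and only the increment is left. The losses in passing to coordinates are
  governed by |F|^(3(d1+d2)) times the character bound |F|^(-r/2); the square of this product is
  |F|^(6d1+6d2-r), and this is where the hypothesis on \<eta> enters.\<close>

lemma CHAR_eq_CARD:
  assumes "prime CARD('f::{field,finite})"
  shows "CHAR('f) = CARD('f)"
  using CHAR_dvd_CARD[where 'a = 'f] assms CHAR_not_1[where 'a = 'f]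
  by (metis One_nat_def prime_nat_iff)

text \<open>The standard character exp(2 pi i c / p) of the prime field, evaluated at the least
  natural number representing c; by \<open>add_char_of_nat\<close> every other representative gives
  the same value.\<close>

definition add_char :: "'f::field \<Rightarrow> complex" where
  "add_char c = cis (2 * pi / real CARD('f)) ^ (LEAST n. of_nat n = c)"

lemma norm_add_char [simp]: "norm (add_char c) = 1"
  by (simp add: add_char_def norm_power)

lemma add_char_of_nat:
  assumes "prime CARD('f::{field,finite})"
  shows "add_char (of_nat n :: 'f) = cis (2 * pi / real CARD('f)) ^ n"
proof -
  let ?z = "cis (2 * pi / real CARD('f))" and ?p = "CARD('f)"
  have p0: "?p > 0" using assms prime_gt_0_nat by blast
  have "?z ^ ?p = cis (2 * pi)" using p0 by (simp add: DeMoivre)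
  then have zp: "?z ^ ?p = 1" by simp
  have modp: "?z ^ m = ?z ^ (m mod ?p)" for m
  proof -
    have "?z ^ m = (?z ^ ?p) ^ (m div ?p) * ?z ^ (m mod ?p)"
      by (simp flip: power_mult power_add)
    then show ?thesis by (simp add: zp)
  qed
  have "of_nat (LEAST m. of_nat m = (of_nat n :: 'f)) = (of_nat n :: 'f)"
    by (rule LeastI[of _ n]) simp
  then have "[(LEAST m. of_nat m = (of_nat n :: 'f)) = n] (mod ?p)"
    by (simp add: of_nat_eq_iff_cong_CHAR CHAR_eq_CARD[OF assms])
  then show ?thesis unfolding add_char_def cong_def by (metis modp)
qed

lemma add_char_add:
  assumes "prime CARD('f::{field,finite})"
  shows "add_char (a + b :: 'f) = add_char a * add_char b"
proof -
  obtain m n where "a = of_nat m" "b = of_nat n"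
    using of_nat_surj_prime_card[OF assms] by metis
  then show ?thesis
    by (metis add_char_of_nat[OF assms] of_nat_add power_add)
qed

lemma add_char_0 [simp]: "add_char (0::'f::field) = 1"
proof -
  have "(LEAST n. of_nat n = (0::'f)) = 0" by (rule Least_eq_0) simp
  then show ?thesis by (simp add: add_char_def)
qed

text \<open>If c is nonzero, then 1 is a multiple of c, so a trivial value at c forces a trivial
  value at 1. There the sine of 2 pi / p is positive, since p >= 5 keeps the angle below pi.\<close>

lemma add_char_eq_1_iff:
  assumes "prime CARD('f::{field,finite})" and "CARD('f) \<ge> 5"
  shows "add_char (c :: 'f) = 1 \<longleftrightarrow> c = 0"
proof
  assume c1: "add_char c = 1"
  show "c = 0"
  proof (rule ccontr)
    assume "c \<noteq> 0"
    obtain k where k: "of_nat k = inverse c" using of_nat_surj_prime_card[OF assms(1)] by metis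
    obtain m where m: "of_nat m = c" using of_nat_surj_prime_card[OF assms(1)] by metis
    have "(1::'f) = of_nat (m * k)" using \<open>c \<noteq> 0\<close> k m by simp
    then have "add_char (1::'f) = (cis (2 * pi / real CARD('f)) ^ m) ^ k"
      by (metis add_char_of_nat[OF assms(1)] power_mult)
    also have "cis (2 * pi / real CARD('f)) ^ m = 1"
      using c1 m add_char_of_nat[OF assms(1)] by metis
    finally have "add_char (1::'f) = 1" by simp
    then have "cis (2 * pi / real CARD('f)) = 1"
      using add_char_of_nat[OF assms(1), of 1] by simp
    then have "sin (2 * pi / real CARD('f)) = 0" by (metis cis.simps(2) one_complex.simps(2))
    moreover have "sin (2 * pi / real CARD('f)) > 0"
    proof (rule sin_gt_zero)
      show "0 < 2 * pi / real CARD('f)" using assms(2) by simp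
      have "2 * pi / real CARD('f) \<le> 2 * pi / 5"
        using assms(2) by (intro divide_left_mono) auto
      then show "2 * pi / real CARD('f) < pi" using pi_gt_zero by linarith
    qed
    ultimately show False by simp
  qed
qed simp

lemma add_char_minus:
  assumes "prime CARD('f::{field,finite})"
  shows "add_char (- a :: 'f) = cnj (add_char a)"
proof -
  have "add_char (- a) * add_char a = 1"
    using add_char_add[OF assms, of "- a" a] by simp
  moreover have "cnj (add_char a) * add_char a = 1"
    using complex_norm_square[of "add_char a"] by (simp add: mult.commute)
  ultimately show ?thesis
    by (metis mult_cancel_right norm_add_char norm_zero zero_neq_one)
qed

text \<open>Reindexing by \<open>T\<close> multiplies the sum by \<open>add_char c\<close>, which is
  not 1. The exact cancellations below all come from a shift that changes the exponent by a nonzero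
  constant.\<close>

lemma sum_add_char_eq_0:
  assumes "prime CARD('f::{field,finite})" and "CARD('f) \<ge> 5"
    and "bij_betw T A A" and "\<And>x. x \<in> A \<Longrightarrow> g (T x) = g x + c" and "c \<noteq> (0::'f)"
  shows "(\<Sum>x\<in>A. add_char (g x)) = 0"
proof -
  have "(\<Sum>x\<in>A. add_char (g x)) = (\<Sum>x\<in>A. add_char (g (T x)))"
    using sum.reindex_bij_betw[OF assms(3), of "\<lambda>x. add_char (g x)"] by simp
  also have "\<dots> = (\<Sum>x\<in>A. add_char (g x)) * add_char c"
    by (simp add: assms(4) add_char_add[OF assms(1)] sum_distrib_right)
  finally show ?thesis
    using add_char_eq_1_iff[OF assms(1,2), of c] assms(5)
    by (metis mult_cancel_left1)
qed

text \<open>F^d, encoded as sequences vanishing from index d on, so that vectors of all lengths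
  share one type with pointwise operations.\<close>

definition fvec :: "nat \<Rightarrow> (nat \<Rightarrow> 'f::zero) set" where
  "fvec d = {v. \<forall>j\<ge>d. v j = 0}"

lemma zero_fvec [simp]: "(0 :: nat \<Rightarrow> 'f::zero) \<in> fvec d"
  by (simp add: fvec_def)

lemma add_fvec [simp]: "u \<in> fvec d \<Longrightarrow> v \<in> fvec d \<Longrightarrow> u + v \<in> fvec d" for u v :: "nat \<Rightarrow> 'f::field"
  by (simp add: fvec_def)

lemma diff_fvec [simp]: "u \<in> fvec d \<Longrightarrow> v \<in> fvec d \<Longrightarrow> u - v \<in> fvec d" for u v :: "nat \<Rightarrow> 'f::field"
  by (simp add: fvec_def)

definition smul :: "'f \<Rightarrow> (nat \<Rightarrow> 'f) \<Rightarrow> nat \<Rightarrow> 'f::field" where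
  "smul c v = (\<lambda>j. c * v j)"

lemma smul_fvec [simp]: "v \<in> fvec d \<Longrightarrow> smul c v \<in> fvec d"
  by (simp add: fvec_def smul_def)

lemma fvec_eqI: "u \<in> fvec d \<Longrightarrow> v \<in> fvec d \<Longrightarrow> (\<And>j. j < d \<Longrightarrow> u j = v j) \<Longrightarrow> u = v"
  by (rule ext) (metis (mono_tags, lifting) fvec_def mem_Collect_eq not_le)

lemma fvec_0: "fvec 0 = {0}"
  by (auto simp: fvec_def)

lemma finite_card_fvec:
  "finite (fvec d :: (nat \<Rightarrow> 'f::{field,finite}) set) \<and>
   card (fvec d :: (nat \<Rightarrow> 'f) set) = CARD('f) ^ d"
proof (induction d)
  case 0
  then show ?case by (simp add: fvec_0)
next
  case (Suc d)
  have "bij_betw (\<lambda>(c, v). v(d := c)) (UNIV \<times> fvec d) (fvec (Suc d) :: (nat \<Rightarrow> 'f) set)"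
  proof (rule bij_betwI[where g = "\<lambda>v. (v d, v(d := 0))"])
    show "(\<lambda>(c, v). v(d := c)) \<in> (UNIV \<times> fvec d) \<rightarrow> (fvec (Suc d) :: (nat \<Rightarrow> 'f) set)"
      by (auto simp: fvec_def)
    show "(\<lambda>v. (v d, v(d := 0))) \<in> (fvec (Suc d) :: (nat \<Rightarrow> 'f) set) \<rightarrow> UNIV \<times> fvec d"
      by (auto simp: fvec_def Suc_le_eq le_neq_implies_less)
  qed (auto simp: fvec_def fun_eq_iff)
  then show ?case
    using Suc bij_betw_same_card bij_betw_finite
    by (metis card_cartesian_product finite_SigmaI finite_class.finite_UNIV power_Suc)
qed

lemmas finite_fvec [simp] = finite_card_fvec[THEN conjunct1]
lemmas card_fvec = finite_card_fvec[THEN conjunct2]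

lemma bij_betw_add_fvec: "s \<in> fvec d \<Longrightarrow> bij_betw (\<lambda>v. v + s) (fvec d) (fvec d)"
  for s :: "nat \<Rightarrow> 'f::field"
  by (rule bij_betwI[where g = "\<lambda>v. v - s"]) auto

lemma bij_betw_smul_fvec: "c \<noteq> 0 \<Longrightarrow> bij_betw (smul c) (fvec d) (fvec d)"
  by (rule bij_betwI[where g = "smul (inverse c)"]) (auto simp: smul_def fun_eq_iff fvec_def)

section \<open>Characters and Fourier coefficients on F^d\<close>

definition dot :: "nat \<Rightarrow> (nat \<Rightarrow> 'f::field) \<Rightarrow> (nat \<Rightarrow> 'f) \<Rightarrow> 'f" where
  "dot d u v = (\<Sum>j<d. u j * v j)"

lemma dot_simps [simp]:
  "dot d (u + u') v = dot d u v + dot d u' v" "dot d u (v + v') = dot d u v + dot d u v'"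
  "dot d (- u) v = - dot d u v" "dot d u (- v) = - dot d u v"
  "dot d (u - u') v = dot d u v - dot d u' v" "dot d u (v - v') = dot d u v - dot d u v'"
  "dot d (smul c u) v = c * dot d u v" "dot d u (smul c v) = c * dot d u v"
  "dot d 0 v = 0" "dot d u 0 = 0"
  by (simp_all add: dot_def smul_def algebra_simps sum.distrib sum_subtractf sum_negf sum_distrib_left)

lemma dot_commute: "dot d u v = dot d v u"
  by (simp add: dot_def mult.commute)

definition hat :: "nat \<Rightarrow> ((nat \<Rightarrow> 'f::field) \<Rightarrow> real) \<Rightarrow> (nat \<Rightarrow> 'f) \<Rightarrow> complex" where
  "hat d f \<xi> = (\<Sum>b\<in>fvec d. of_real (f b) * add_char (- dot d \<xi> b)) / of_nat (CARD('f) ^ d)"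

definition fmean :: "nat \<Rightarrow> ((nat \<Rightarrow> 'f::field) \<Rightarrow> real) \<Rightarrow> real" where
  "fmean d f = (\<Sum>b\<in>fvec d. f b) / real (CARD('f) ^ d)"

definition energy :: "nat \<Rightarrow> ((nat \<Rightarrow> 'f::field) \<Rightarrow> real) \<Rightarrow> real" where
  "energy d f = (\<Sum>\<xi>\<in>fvec d - {0}. norm (hat d f \<xi>) ^ 4)"

context
  assumes prime: "prime CARD('f::{field,finite})" and card5: "CARD('f) \<ge> 5"
begin

lemma sum_add_char_dot:
  assumes "v \<in> fvec d"
  shows "(\<Sum>\<xi>\<in>fvec d. add_char (dot d \<xi> v :: 'f)) = (if v = 0 then of_nat (CARD('f) ^ d) else 0)"
proof (cases "v = 0")
  case True
  then show ?thesis by (simp add: card_fvec)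
next
  case False
  then obtain j where j: "j < d" "v j \<noteq> 0"
    using assms fvec_eqI[OF assms zero_fvec] by auto
  let ?s = "(\<lambda>i. if i = j then 1 else 0) :: nat \<Rightarrow> 'f"
  have s: "?s \<in> fvec d" using j by (auto simp: fvec_def)
  have "dot d ?s v = (\<Sum>i<d. if i = j then v j else 0)"
    unfolding dot_def by (rule sum.cong) auto
  then have "dot d ?s v = v j" using j by simp
  then have "(\<Sum>\<xi>\<in>fvec d. add_char (dot d \<xi> v)) = 0"
    using j by (intro sum_add_char_eq_0[OF prime card5 bij_betw_add_fvec[OF s], where c = "v j"]) auto
  then show ?thesis using False by simp
qed

lemma hat_0:
  fixes f :: "(nat \<Rightarrow> 'f) \<Rightarrow> real"
  shows "hat d f 0 = of_real (fmean d f)"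
  by (simp add: hat_def fmean_def)

lemma hat_inversion:
  fixes f :: "(nat \<Rightarrow> 'f) \<Rightarrow> real"
  assumes "b \<in> fvec d"
  shows "(\<Sum>\<xi>\<in>fvec d. hat d f \<xi> * add_char (dot d \<xi> b)) = of_real (f b)"
proof -
  let ?N = "of_nat (CARD('f) ^ d) :: complex"
  have "(\<Sum>\<xi>\<in>fvec d. hat d f \<xi> * add_char (dot d \<xi> b)) * ?N
      = (\<Sum>\<xi>\<in>fvec d. \<Sum>c\<in>fvec d. of_real (f c) * add_char (dot d \<xi> (b - c)))"
    unfolding sum_distrib_right
    by (intro sum.cong refl)
      (simp add: hat_def sum_distrib_right sum_divide_distrib mult.assoc add_char_add[OF prime, symmetric])
  also have "\<dots> = (\<Sum>c\<in>fvec d. of_real (f c) * (\<Sum>\<xi>\<in>fvec d. add_char (dot d \<xi> (b - c))))"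
    by (subst sum.swap) (simp add: sum_distrib_left)
  also have "\<dots> = (\<Sum>c\<in>fvec d. of_real (f c) * (if c = b then ?N else 0))"
    using assms by (intro sum.cong refl arg_cong2[where f = "(*)"], subst sum_add_char_dot) auto
  also have "\<dots> = (\<Sum>c\<in>fvec d. if c = b then of_real (f b) * ?N else 0)"
    by (intro sum.cong) auto
  also have "\<dots> = of_real (f b) * ?N"
    using assms by simp
  finally show ?thesis by simp
qed

lemma hat_parseval:
  fixes f :: "(nat \<Rightarrow> 'f) \<Rightarrow> real"
  shows "(\<Sum>\<xi>\<in>fvec d. (norm (hat d f \<xi>))\<^sup>2) = fmean d (\<lambda>b. (f b)\<^sup>2)"
proof -
  let ?N = "of_nat (CARD('f) ^ d) :: complex"
  have "complex_of_real (\<Sum>\<xi>\<in>fvec d. (norm (hat d f \<xi>))\<^sup>2)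
      = (\<Sum>\<xi>\<in>fvec d. hat d f \<xi> * cnj (hat d f \<xi>))"
    by (simp only: of_real_sum complex_norm_square)
  also have "\<dots> = (\<Sum>\<xi>\<in>fvec d. \<Sum>b\<in>fvec d. of_real (f b) * (hat d f \<xi> * add_char (dot d \<xi> b)) / ?N)"
    by (simp add: hat_def[of d f, THEN arg_cong[where f = cnj]] sum_distrib_left sum_divide_distrib
        add_char_minus[OF prime] algebra_simps)
  also have "\<dots> = (\<Sum>b\<in>fvec d. of_real (f b) * (\<Sum>\<xi>\<in>fvec d. hat d f \<xi> * add_char (dot d \<xi> b)) / ?N)"
    by (subst sum.swap) (simp add: sum_distrib_left sum_divide_distrib)
  also have "\<dots> = (\<Sum>b\<in>fvec d. of_real (f b) * of_real (f b) / ?N)"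
    by (intro sum.cong refl) (simp add: hat_inversion)
  also have "\<dots> = of_real (fmean d (\<lambda>b. (f b)\<^sup>2))"
    by (simp add: fmean_def sum_divide_distrib power2_eq_square)
  finally show ?thesis by (simp only: of_real_eq_iff)
qed

lemma norm_hat_le:
  fixes f :: "(nat \<Rightarrow> 'f) \<Rightarrow> real"
  assumes "\<And>b. f b \<ge> 0"
  shows "norm (hat d f \<xi>) \<le> fmean d f"
proof -
  have "norm (\<Sum>b\<in>fvec d. of_real (f b) * add_char (- dot d \<xi> b)) \<le> (\<Sum>b\<in>fvec d. f b)"
    by (rule order_trans[OF norm_sum]) (simp add: norm_mult assms)
  then show ?thesis
    by (simp add: hat_def fmean_def norm_divide norm_power divide_right_mono)
qed

lemma energy_smul:
  fixes f :: "(nat \<Rightarrow> 'f) \<Rightarrow> real"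
  assumes "c \<noteq> 0"
  shows "(\<Sum>\<xi>\<in>fvec d - {0}. norm (hat d f (smul c \<xi>)) ^ 4) = energy d f"
proof -
  have "bij_betw (smul c) (fvec d - {0}) (fvec d - {0})"
  proof (rule bij_betw_subset[OF bij_betw_smul_fvec[OF assms]])
    have "smul c ` (fvec d - {0}) = smul c ` fvec d - smul c ` {0}"
      using bij_betw_smul_fvec[OF assms, of d] by (intro inj_on_image_set_diff[of _ "fvec d"]) (auto simp: bij_betw_def)
    then show "smul c ` (fvec d - {0}) = fvec d - {0}"
      using bij_betw_smul_fvec[OF assms, of d] by (auto simp: bij_betw_def smul_def fun_eq_iff)
  qed auto
  from sum.reindex_bij_betw[OF this, of "\<lambda>\<xi>. norm (hat d f \<xi>) ^ 4"] show ?thesis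
    by (simp add: energy_def)
qed

lemma amgm4:
  fixes a b c d :: real
  shows "a * b * c * d \<le> (a ^ 4 + b ^ 4 + c ^ 4 + d ^ 4) / 4"
proof -
  have "0 \<le> (a\<^sup>2 - b\<^sup>2)\<^sup>2 + (c\<^sup>2 - d\<^sup>2)\<^sup>2 + 2 * (a * b - c * d)\<^sup>2" by simp
  then show ?thesis by (simp add: power2_eq_square power4_eq_xxxx algebra_simps)
qed

text \<open>Fourier inversion expands the fourth factor at b0 - 3 b1 + 3 b2; the three free sums
  then separate and become transforms of the other factors at -\<xi>, 3 \<xi> and -3 \<xi>.\<close>

lemma cubic_relation_expansion:
  fixes f0 f1 f2 f3 :: "(nat \<Rightarrow> 'f) \<Rightarrow> real"
  shows "(\<Sum>b0\<in>fvec d. \<Sum>b1\<in>fvec d. \<Sum>b2\<in>fvec d.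
      complex_of_real (f0 b0 * f1 b1 * f2 b2 * f3 (b0 - smul 3 b1 + smul 3 b2)))
   = of_nat (CARD('f) ^ d) ^ 3 *
     (\<Sum>\<xi>\<in>fvec d. hat d f0 (smul (-1) \<xi>) * hat d f1 (smul 3 \<xi>) * hat d f2 (smul (-3) \<xi>) * hat d f3 \<xi>)"
  (is "?L = ?N ^ 3 * ?R")
proof -
  define H :: "((nat \<Rightarrow> 'f) \<Rightarrow> real) \<Rightarrow> (nat \<Rightarrow> 'f) \<Rightarrow> complex"
    where "H f \<xi> = (\<Sum>b\<in>fvec d. of_real (f b) * add_char (- dot d \<xi> b))" for f \<xi>
  have H: "H f \<xi> = ?N * hat d f \<xi>" for f \<xi> by (simp add: H_def hat_def)
  have "?L = (\<Sum>b0\<in>fvec d. \<Sum>b1\<in>fvec d. \<Sum>b2\<in>fvec d. \<Sum>\<xi>\<in>fvec d. hat d f3 \<xi> *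
       (of_real (f0 b0) * add_char (- dot d (smul (-1) \<xi>) b0)) *
       (of_real (f1 b1) * add_char (- dot d (smul 3 \<xi>) b1)) *
       (of_real (f2 b2) * add_char (- dot d (smul (-3) \<xi>) b2)))"
  proof (intro sum.cong refl)
    fix b0 b1 b2 :: "nat \<Rightarrow> 'f" assume b: "b0 \<in> fvec d" "b1 \<in> fvec d" "b2 \<in> fvec d"
    have "of_real (f3 (b0 - smul 3 b1 + smul 3 b2)) =
        (\<Sum>\<xi>\<in>fvec d. hat d f3 \<xi> * add_char (dot d \<xi> (b0 - smul 3 b1 + smul 3 b2)))"
      using b by (simp only: hat_inversion add_fvec diff_fvec smul_fvec)
    also have "\<dots> = (\<Sum>\<xi>\<in>fvec d. hat d f3 \<xi> * (add_char (- dot d (smul (-1) \<xi>) b0) *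
        add_char (- dot d (smul 3 \<xi>) b1) * add_char (- dot d (smul (-3) \<xi>) b2)))"
      by (simp add: add_char_add[OF prime, symmetric] algebra_simps)
    finally show "complex_of_real (f0 b0 * f1 b1 * f2 b2 * f3 (b0 - smul 3 b1 + smul 3 b2)) =
       (\<Sum>\<xi>\<in>fvec d. hat d f3 \<xi> *
       (of_real (f0 b0) * add_char (- dot d (smul (-1) \<xi>) b0)) *
       (of_real (f1 b1) * add_char (- dot d (smul 3 \<xi>) b1)) *
       (of_real (f2 b2) * add_char (- dot d (smul (-3) \<xi>) b2)))"
      by (simp add: sum_distrib_left mult_ac)
  qed
  also have "\<dots> = (\<Sum>b0\<in>fvec d. \<Sum>b1\<in>fvec d. \<Sum>\<xi>\<in>fvec d. hat d f3 \<xi> *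
       (of_real (f0 b0) * add_char (- dot d (smul (-1) \<xi>) b0)) *
       (of_real (f1 b1) * add_char (- dot d (smul 3 \<xi>) b1)) * H f2 (smul (-3) \<xi>))"
    by (subst sum.swap) (simp only: H_def sum_distrib_left)
  also have "\<dots> = (\<Sum>b0\<in>fvec d. \<Sum>\<xi>\<in>fvec d. hat d f3 \<xi> *
       (of_real (f0 b0) * add_char (- dot d (smul (-1) \<xi>) b0)) *
       H f1 (smul 3 \<xi>) * H f2 (smul (-3) \<xi>))"
    by (subst sum.swap) (simp only: H_def[of f1] sum_distrib_left sum_distrib_right)
  also have "\<dots> = (\<Sum>\<xi>\<in>fvec d. hat d f3 \<xi> * H f0 (smul (-1) \<xi>) *
       H f1 (smul 3 \<xi>) * H f2 (smul (-3) \<xi>))"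
    by (subst sum.swap) (simp only: H_def[of f0] sum_distrib_left sum_distrib_right)
  also have "\<dots> = ?N ^ 3 * ?R"
    unfolding H sum_distrib_left by (intro sum.cong refl) (simp add: power3_eq_cube mult_ac)
  finally show ?thesis .
qed

text \<open>Frequency 0 contributes the product of the means. At the others \<open>amgm4\<close>
  decouples the four coefficients, and the dilations by -1, 3, -3 permute the nonzero frequencies
  because 3 is nonzero in F, so each function contributes its own energy.\<close>

lemma cubic_relation_estimate:
  fixes f0 f1 f2 f3 :: "(nat \<Rightarrow> 'f) \<Rightarrow> real"
  shows "\<bar>(\<Sum>b0\<in>fvec d. \<Sum>b1\<in>fvec d. \<Sum>b2\<in>fvec d. f0 b0 * f1 b1 * f2 b2 * f3 (b0 - smul 3 b1 + smul 3 b2))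
     / real (CARD('f) ^ d) ^ 3 - fmean d f0 * fmean d f1 * fmean d f2 * fmean d f3\<bar>
   \<le> (energy d f0 + energy d f1 + energy d f2 + energy d f3) / 4"
  (is "\<bar>?S / ?N ^ 3 - ?M\<bar> \<le> _")
proof -
  let ?h = "\<lambda>\<xi>. hat d f0 (smul (-1) \<xi>) * hat d f1 (smul 3 \<xi>) * hat d f2 (smul (-3) \<xi>) * hat d f3 \<xi>"
  have N0: "?N > 0" by simp
  have three: "(3::'f) \<noteq> 0"
  proof
    assume "(3::'f) = 0"
    then have "of_nat 3 = (0::'f)" by simp
    then have "CARD('f) dvd 3" by (simp only: of_nat_eq_0_iff_char_dvd CHAR_eq_CARD[OF prime])
    then show False using card5 by (auto dest: dvd_imp_le)
  qed
  have sm0: "smul c 0 = (0 :: nat \<Rightarrow> 'f)" for c by (simp add: smul_def fun_eq_iff)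
  have "complex_of_real (?S / ?N ^ 3) = (\<Sum>\<xi>\<in>fvec d. ?h \<xi>)"
    using cubic_relation_expansion[of f0 f1 f2 f3 d] N0 by (simp add: field_simps)
  also have "\<dots> = ?h 0 + (\<Sum>\<xi>\<in>fvec d - {0}. ?h \<xi>)"
    by (simp add: sum.remove[of _ 0])
  also have "?h 0 = of_real ?M" by (simp add: sm0 hat_0)
  finally have "complex_of_real (?S / ?N ^ 3 - ?M) = (\<Sum>\<xi>\<in>fvec d - {0}. ?h \<xi>)"
    unfolding of_real_diff by (simp only: add_diff_cancel_left')
  then have "\<bar>?S / ?N ^ 3 - ?M\<bar> = norm (\<Sum>\<xi>\<in>fvec d - {0}. ?h \<xi>)"
    by (simp only: flip: norm_of_real[where 'a = complex])
  also have "\<dots> \<le> (\<Sum>\<xi>\<in>fvec d - {0}. (norm (hat d f0 (smul (-1) \<xi>)) ^ 4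
      + norm (hat d f1 (smul 3 \<xi>)) ^ 4 + norm (hat d f2 (smul (-3) \<xi>)) ^ 4 + norm (hat d f3 \<xi>) ^ 4) / 4)"
    by (rule sum_norm_le) (simp only: norm_mult amgm4)
  also have "\<dots> = (energy d f0 + energy d f1 + energy d f2 + energy d f3) / 4"
    using three by (simp add: sum.distrib energy_smul sum_divide_distrib[symmetric] energy_def[of d f3])
  finally show ?thesis .
qed

end

section \<open>Polynomial maps via differences and the Chevalley-Warning theorem\<close>

text \<open>Polynomial maps of degree less than d, described without coordinates through vanishing
  d-fold differences. In this index convention quadratics are \<open>pdeg 3\<close>, nonzero
  constants are \<open>pdeg 1\<close>, and \<open>pdeg 0\<close> leaves only the zero map.\<close>

primrec pdeg :: "nat \<Rightarrow> ('w::ab_group_add \<Rightarrow> 'f::comm_ring_1) \<Rightarrow> bool" where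
  "pdeg 0 g \<longleftrightarrow> (\<forall>x. g x = 0)"
| "pdeg (Suc d) g \<longleftrightarrow> (\<forall>h. pdeg d (\<lambda>x. g (x + h) - g x))"

lemma pdeg_zero: "pdeg d (\<lambda>x. 0)"
  by (induction d) auto

lemma pdeg_const: "pdeg (Suc d) (\<lambda>x. c)"
  by (simp add: pdeg_zero)

lemma pdeg_add: "pdeg d f \<Longrightarrow> pdeg d g \<Longrightarrow> pdeg d (\<lambda>x. f x + g x)"
proof (induction d arbitrary: f g)
  case (Suc d)
  have "pdeg d (\<lambda>x. (f (x + h) - f x) + (g (x + h) - g x))" for h
    using Suc.prems by (intro Suc.IH) auto
  then show ?case by (simp add: algebra_simps)
qed simp

lemma pdeg_cmult: "pdeg d f \<Longrightarrow> pdeg d (\<lambda>x. c * f x)"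
proof (induction d arbitrary: f)
  case (Suc d)
  have "pdeg d (\<lambda>x. c * (f (x + h) - f x))" for h
    using Suc.prems by (intro Suc.IH) auto
  then show ?case by (simp add: algebra_simps)
qed simp

lemma pdeg_shift: "pdeg d f \<Longrightarrow> pdeg d (\<lambda>x. f (x + a))"
proof (induction d arbitrary: f)
  case (Suc d)
  have "pdeg d (\<lambda>x. f (x + a + h) - f (x + a))" for h
    using Suc.IH[of "\<lambda>x. f (x + h) - f x"] Suc.prems by simp
  then show ?case by (simp add: add_ac)
qed simp

text \<open>Product rule for differences. The cases a = 0 and b = 0 are split off because a constant
  factor has zero difference, and there is no smaller degree to induct on.\<close>

lemma pdeg_mult: "pdeg (Suc a) f \<Longrightarrow> pdeg (Suc b) g \<Longrightarrow> pdeg (Suc (a + b)) (\<lambda>x. f x * g x)"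
proof (induction "a + b" arbitrary: a b f g rule: less_induct)
  case less
  have "pdeg (a + b) (\<lambda>x. f (x + h) * g (x + h) - f x * g x)" for h
  proof -
    have 1: "pdeg (a + b) (\<lambda>x. f (x + h) * (g (x + h) - g x))"
    proof (cases b)
      case 0
      then show ?thesis using less.prems by (simp add: pdeg_zero)
    next
      case (Suc b')
      have "pdeg (Suc (a + b')) (\<lambda>x. f (x + h) * (g (x + h) - g x))"
        using less.hyps[of a b' "\<lambda>x. f (x + h)" "\<lambda>x. g (x + h) - g x"] Suc less.prems
          pdeg_shift[OF less.prems(1), of h] by simp
      then show ?thesis using Suc by simp
    qed
    have 2: "pdeg (a + b) (\<lambda>x. (f (x + h) - f x) * g x)"
    proof (cases a)
      case 0
      then show ?thesis using less.prems by (simp add: pdeg_zero)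
    next
      case (Suc a')
      have "pdeg (Suc (a' + b)) (\<lambda>x. (f (x + h) - f x) * g x)"
        using less.hyps[of a' b "\<lambda>x. f (x + h) - f x" g] Suc less.prems by simp
      then show ?thesis using Suc by simp
    qed
    show ?thesis using pdeg_add[OF 1 2] by (simp add: algebra_simps)
  qed
  then show ?case by simp
qed

lemma pdeg_power: "pdeg (Suc a) f \<Longrightarrow> pdeg (Suc (n * a)) (\<lambda>x. f x ^ n)"
proof (induction n)
  case (Suc n)
  then show ?case using pdeg_mult[of a f "n * a" "\<lambda>x. f x ^ n"] by simp
qed (simp add: pdeg_const)

lemma pdeg_prod:
  "finite S \<Longrightarrow> (\<And>s. s \<in> S \<Longrightarrow> pdeg (Suc a) (f s)) \<Longrightarrow> pdeg (Suc (card S * a)) (\<lambda>x. \<Prod>s\<in>S. f s x)"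
proof (induction S rule: finite_induct)
  case (insert s S)
  then show ?case using pdeg_mult[of a "f s" "card S * a" "\<lambda>x. \<Prod>s\<in>S. f s x"] by simp
qed (simp add: pdeg_zero)

primrec iter_diff :: "nat \<Rightarrow> 'w \<Rightarrow> ('w::ab_group_add \<Rightarrow> 'f::comm_ring_1) \<Rightarrow> 'w \<Rightarrow> 'f" where
  "iter_diff 0 e g = g"
| "iter_diff (Suc j) e g = (\<lambda>x. iter_diff j e g (x + e) - iter_diff j e g x)"

text \<open>Truncated subtraction is intended: after d or more differences the map is zero, which is
  \<open>pdeg 0\<close>.\<close>

lemma pdeg_iter_diff: "pdeg d g \<Longrightarrow> pdeg (d - j) (iter_diff j e g)"
proof (induction j)
  case (Suc j)
  then have IH: "pdeg (d - j) (iter_diff j e g)" by blast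
  show ?case
  proof (cases "d - j")
    case 0
    then show ?thesis using IH by simp
  next
    case (Suc k)
    then have "d - Suc j = k" by simp
    then show ?thesis using IH Suc by simp
  qed
qed simp

text \<open>The Hessian at base point 0 for field-valued maps. For \<open>pdeg 3\<close> maps the
  base point is immaterial and the form is bilinear.\<close>

definition polar :: "('w::ab_group_add \<Rightarrow> 'f::comm_ring_1) \<Rightarrow> 'w \<Rightarrow> 'w \<Rightarrow> 'f" where
  "polar g u v = g (u + v) - g u - g v + g 0"

lemma pdeg_3_iff:
  "pdeg 3 g \<longleftrightarrow> (\<forall>x h1 h2 h3. g (x + h1 + h2 + h3) - g (x + h1 + h2) - g (x + h1 + h3) - g (x + h2 + h3)
        + g (x + h1) + g (x + h2) + g (x + h3) - g x = 0)"
proof -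
  have "pdeg 3 g \<longleftrightarrow> (\<forall>h3 h2 h1 x. g (x + h1 + h2 + h3) - g (x + h1 + h2) - (g (x + h1 + h3) - g (x + h1)) -
       (g (x + h2 + h3) - g (x + h2) - (g (x + h3) - g x)) = 0)"
    by (simp add: numeral_3_eq_3)
  moreover have "g (x + h1 + h2 + h3) - g (x + h1 + h2) - (g (x + h1 + h3) - g (x + h1)) -
       (g (x + h2 + h3) - g (x + h2) - (g (x + h3) - g x))
     = g (x + h1 + h2 + h3) - g (x + h1 + h2) - g (x + h1 + h3) - g (x + h2 + h3)
        + g (x + h1) + g (x + h2) + g (x + h3) - g x" for x h1 h2 h3
    by (simp add: algebra_simps)
  ultimately show ?thesis by metis
qed

lemma polar_base_point:
  assumes "pdeg 3 g"
  shows "g (x + u + v) - g (x + u) - g (x + v) + g x = polar g u v"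
proof -
  have "g (0 + x + u + v) - g (0 + x + u) - g (0 + x + v) - g (0 + u + v)
        + g (0 + x) + g (0 + u) + g (0 + v) - g 0 = 0"
    using assms unfolding pdeg_3_iff by blast
  then show ?thesis by (simp add: polar_def algebra_simps)
qed

lemma polar_commute: "polar g u v = polar g v u"
  by (simp add: polar_def add.commute)

lemma polar_zero [simp]: "polar g 0 v = 0" "polar g v 0 = 0"
  by (simp_all add: polar_def)

lemma polar_add:
  assumes "pdeg 3 g"
  shows "polar g (u + u') v = polar g u v + polar g u' v"
    and "polar g v (u + u') = polar g v u + polar g v u'"
proof -
  have "polar g u' v = g (u + u' + v) - g (u + u') - g (u + v) + g u"
    using polar_base_point[OF assms, of u u' v] by simp
  then show "polar g (u + u') v = polar g u v + polar g u' v" by (simp add: polar_def algebra_simps)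
  then show "polar g v (u + u') = polar g v u + polar g v u'" by (simp only: polar_commute[of g v])
qed

lemma pdeg_comp:
  assumes "\<And>x y. T (x + y) = T x + T y"
  shows "pdeg d g \<Longrightarrow> pdeg d (\<lambda>x. g (T x))"
proof (induction d arbitrary: g)
  case (Suc d)
  then show ?case using Suc.IH[of "\<lambda>x. g (x + h) - g x" for h] by (simp add: assms)
qed simp

text \<open>The diagonal is g(2x) - 2 g(x) + g(0), hence again quadratic. Its zeros are the
  isotropic vectors, so Chevalley-Warning can find them.\<close>

lemma pdeg_polar_diag:
  assumes "pdeg 3 g"
  shows "pdeg 3 (\<lambda>x. polar g x x)"
proof -
  have 1: "pdeg 3 (\<lambda>x. g (x + x))"
    by (rule pdeg_comp[OF _ assms]) (simp add: add_ac)
  have 2: "pdeg 3 (\<lambda>x::'a. g 0)"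
    by (simp add: numeral_3_eq_3)
  have "pdeg 3 (\<lambda>x. g (x + x) + ((-2) * g x + g 0))"
    by (intro pdeg_add pdeg_cmult assms 1 2)
  then show ?thesis by (simp add: polar_def algebra_simps)
qed

locale prime_field_space = finite_dimensional_vector_space scale Basis
  for scale :: "'f::{field,finite} \<Rightarrow> 'w::ab_group_add \<Rightarrow> 'w" and Basis +
  assumes prime: "prime CARD('f)" and card5: "CARD('f) \<ge> 5"
begin

text \<open>Newton's forward difference formula summed over t = 0, ..., n - 1; the induction on n is
  Pascal's rule.\<close>

lemma sum_shift_eq_iter_diff:
  fixes g :: "'w \<Rightarrow> 'f"
  shows "(\<Sum>t<n. g (x + scale (of_nat t) e)) = (\<Sum>j<n. of_nat (n choose Suc j) * iter_diff j e g x)"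
proof (induction n arbitrary: x)
  case (Suc n)
  have "(\<Sum>t<Suc n. g (x + scale (of_nat t) e)) = g x + (\<Sum>t<n. g (x + e + scale (of_nat t) e))"
    by (simp add: sum.lessThan_Suc_shift scale_left_distrib add_ac del: sum.lessThan_Suc)
  also have "\<dots> = g x + (\<Sum>j<n. of_nat (n choose Suc j) * (iter_diff (Suc j) e g x + iter_diff j e g x))"
    by (simp add: Suc.IH)
  also have "\<dots> = (g x + (\<Sum>j<n. of_nat (n choose Suc j) * iter_diff (Suc j) e g x))
      + (\<Sum>j<n. of_nat (n choose Suc j) * iter_diff j e g x)"
    by (simp only: distrib_left sum.distrib add_ac)
  also have "g x + (\<Sum>j<n. of_nat (n choose Suc j) * iter_diff (Suc j) e g x)
      = (\<Sum>j<Suc n. of_nat (n choose j) * iter_diff j e g x)"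
    by (simp add: sum.lessThan_Suc_shift del: sum.lessThan_Suc)
  also have "(\<Sum>j<n. of_nat (n choose Suc j) * iter_diff j e g x)
      = (\<Sum>j<Suc n. of_nat (n choose Suc j) * iter_diff j e g x)"
    by (simp add: binomial_eq_0)
  also have "(\<Sum>j<Suc n. of_nat (n choose j) * iter_diff j e g x)
      + (\<Sum>j<Suc n. of_nat (n choose Suc j) * iter_diff j e g x)
      = (\<Sum>j<Suc n. of_nat (Suc n choose Suc j) * iter_diff j e g x)"
    by (simp only: binomial_Suc_Suc of_nat_add distrib_right sum.distrib)
  finally show ?case .
qed simp

lemma of_nat_CARD_eq_0: "(of_nat m :: 'f) = 0 \<longleftrightarrow> CARD('f) dvd m"
  by (simp add: of_nat_eq_0_iff_char_dvd CHAR_eq_CARD[OF prime])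

lemma bij_of_nat: "bij_betw (of_nat :: nat \<Rightarrow> 'f) {..<CARD('f)} UNIV"
proof -
  have "inj_on (of_nat :: nat \<Rightarrow> 'f) {..<CARD('f)}"
    by (intro inj_onI) (auto simp: of_nat_eq_iff_cong_CHAR CHAR_eq_CARD[OF prime] cong_def)
  moreover from this have "of_nat ` {..<CARD('f)} = (UNIV :: 'f set)"
    by (intro card_subset_eq) (auto simp: card_image)
  ultimately show ?thesis by (simp add: bij_betw_def)
qed

text \<open>For n = p the binomials (p choose Suc j) with Suc j < p vanish in F. Summing over a line
  is therefore a (p - 1)-fold difference and lowers the degree by p - 1.\<close>

lemma pdeg_sum_line:
  fixes g :: "'w \<Rightarrow> 'f"
  assumes "pdeg d g"
  shows "pdeg (d - (CARD('f) - 1)) (\<lambda>x. \<Sum>t\<in>UNIV. g (x + scale t e))"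
proof -
  let ?p = "CARD('f)"
  have p: "?p = Suc (?p - 1)" using card5 by simp
  have "(\<Sum>t\<in>UNIV. g (x + scale t e)) = iter_diff (?p - 1) e g x" for x
  proof -
    have "(\<Sum>t\<in>UNIV. g (x + scale t e)) = (\<Sum>t<?p. g (x + scale (of_nat t) e))"
      using sum.reindex_bij_betw[OF bij_of_nat, of "\<lambda>t. g (x + scale t e)"] by simp
    also have "\<dots> = (\<Sum>j<?p. of_nat (?p choose Suc j) * iter_diff j e g x)"
      by (rule sum_shift_eq_iter_diff)
    also have "\<dots> = (\<Sum>j<?p. if j = ?p - 1 then iter_diff (?p - 1) e g x else 0)"
    proof (rule sum.cong)
      fix j assume "j \<in> {..<?p}"
      show "of_nat (?p choose Suc j) * iter_diff j e g x =
          (if j = ?p - 1 then iter_diff (?p - 1) e g x else 0)"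
      proof (cases "j = ?p - 1")
        case True
        then show ?thesis using p by (metis binomial_n_n mult_1 of_nat_1)
      next
        case False
        then have "?p dvd (?p choose Suc j)"
          using \<open>j \<in> {..<?p}\<close> prime by (intro dvd_choose_prime) auto
        then have "(of_nat (?p choose Suc j) :: 'f) = 0" by (simp only: of_nat_CARD_eq_0)
        then show ?thesis using False by simp
      qed
    qed simp
    also have "\<dots> = iter_diff (?p - 1) e g x" using card5 by simp
    finally show ?thesis .
  qed
  then show ?thesis using pdeg_iter_diff[OF assms, of "?p - 1" e] by (simp only:)
qed

section \<open>Cardinalities of subspaces and additive maps over a prime field\<close>

lemma bij_betw_span_insert:
  assumes "b \<notin> span B"
  shows "bij_betw (\<lambda>(c, x). scale c b + x) (UNIV \<times> span B) (span (insert b B))"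
  unfolding bij_betw_def
proof
  show "inj_on (\<lambda>(c, x). scale c b + x) (UNIV \<times> span B)"
  proof (rule inj_onI, clarsimp)
    fix c x c' x' assume x: "x \<in> span B" "x' \<in> span B" and eq: "scale c b + x = scale c' b + x'"
    have "scale (c - c') b = x' - x" using eq by (simp add: scale_left_diff_distrib algebra_simps)
    then have sp: "scale (c - c') b \<in> span B" using x by (simp add: span_diff)
    have "c = c'"
    proof (rule ccontr)
      assume "c \<noteq> c'"
      then have "scale (inverse (c - c')) (scale (c - c') b) = b" by simp
      then show False using span_scale[OF sp, of "inverse (c - c')"] assms by simp
    qed
    then show "c = c' \<and> x = x'" using eq by simp
  qed
  show "(\<lambda>(c, x). scale c b + x) ` (UNIV \<times> span B) = span (insert b B)"
  proof (intro equalityI subsetI)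
    fix y assume "y \<in> span (insert b B)"
    then obtain k where "y - scale k b \<in> span B" by (auto simp: span_insert)
    then show "y \<in> (\<lambda>(c, x). scale c b + x) ` (UNIV \<times> span B)"
      by (intro image_eqI[of _ _ "(k, y - scale k b)"]) auto
  next
    fix y assume "y \<in> (\<lambda>(c, x). scale c b + x) ` (UNIV \<times> span B)"
    then obtain c x where "y = scale c b + x" "x \<in> span B" by auto
    then have "y - scale c b \<in> span B" by simp
    then show "y \<in> span (insert b B)" by (auto simp: span_insert)
  qed
qed

lemma finite_card_span:
  assumes "finite B" "independent B"
  shows "finite (span B) \<and> card (span B) = CARD('f) ^ card B"
  using assms
proof (induction B rule: finite_induct)
  case empty
  then show ?case by simp
next
  case (insert b B)
  then have b: "b \<notin> span B" and B: "independent B"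
    by (auto simp: independent_insert)
  note bij = bij_betw_span_insert[OF b]
  have "finite (span (insert b B))"
    using bij_betw_finite[OF bij] insert.IH[OF B] by (simp add: finite_cartesian_product)
  moreover have "card (span (insert b B)) = CARD('f) * card (span B)"
    using bij_betw_same_card[OF bij] by (simp add: card_cartesian_product)
  ultimately show ?case using insert by (simp add: B)
qed

lemma finite_UNIV_w: "finite (UNIV :: 'w set)"
  using finite_card_span[OF finite_Basis independent_Basis] by (simp add: span_Basis)

lemma finite_w [simp]: "finite (A :: 'w set)"
  by (rule finite_subset[OF subset_UNIV finite_UNIV_w])

lemma card_subspace:
  assumes "subspace S"
  shows "card S = CARD('f) ^ dim S"
proof -
  obtain B where "B \<subseteq> S" "independent B" "S \<subseteq> span B" "card B = dim S"
    using basis_exists[of S] by blast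
  moreover from this have "span B = S" using assms span_minimal by blast
  ultimately show ?thesis using finite_card_span[of B] by (metis finiteI_independent)
qed

lemma scale_of_nat_closed:
  assumes "0 \<in> S" "\<And>x y. x \<in> S \<Longrightarrow> y \<in> S \<Longrightarrow> x + y \<in> S" "x \<in> S"
  shows "scale (of_nat n) x \<in> S"
  using assms by (induction n) (auto simp: scale_left_distrib)

text \<open>Over a prime field every scalar is a repeated sum of 1, so additive closure suffices;
  \<open>additive_scale\<close> rests on the same fact.\<close>

lemma subspaceI_add:
  assumes "0 \<in> S" "\<And>x y. x \<in> S \<Longrightarrow> y \<in> S \<Longrightarrow> x + y \<in> S"
  shows "subspace S"
proof (rule subspaceI)
  fix c :: 'f and x assume "x \<in> S"
  obtain n where "of_nat n = c" using of_nat_surj_prime_card[OF prime] by metis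
  then show "scale c x \<in> S" using scale_of_nat_closed[OF assms \<open>x \<in> S\<close>] by metis
qed (use assms in auto)

lemma additive_scale:
  fixes l :: "'w \<Rightarrow> 'f"
  assumes "subspace U" "\<And>x y. x \<in> U \<Longrightarrow> y \<in> U \<Longrightarrow> l (x + y) = l x + l y" "x \<in> U"
  shows "l (scale c x) = c * l x"
proof -
  have "l (0 + 0) = l 0 + l 0" using subspace_0[OF assms(1)] by (intro assms(2))
  then have l0: "l 0 = 0" by (metis add.right_neutral add_left_cancel)
  have "l (scale (of_nat n) x) = of_nat n * l x" for n
  proof (induction n)
    case (Suc n)
    have "l (x + scale (of_nat n) x) = l x + l (scale (of_nat n) x)"
      using assms by (intro assms(2)) (auto simp: subspace_scale)
    then show ?case using Suc by (simp add: scale_left_distrib algebra_simps)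
  qed (simp add: l0)
  then show ?thesis using of_nat_surj_prime_card[OF prime, of c] by metis
qed

lemma pdeg_sum_span:
  fixes g :: "'w \<Rightarrow> 'f"
  assumes "finite B" "independent B" "pdeg d g"
  shows "pdeg (d - card B * (CARD('f) - 1)) (\<lambda>x. \<Sum>y\<in>span B. g (x + y))"
  using assms(1,2)
proof (induction B rule: finite_induct)
  case empty
  then show ?case using assms(3) by simp
next
  case (insert b B)
  then have b: "b \<notin> span B" and B: "independent B"
    by (auto simp: independent_insert)
  have "(\<Sum>y\<in>span (insert b B). g (x + y)) = (\<Sum>t\<in>UNIV. \<Sum>y\<in>span B. g (x + scale t b + y))" for x
    using sum.reindex_bij_betw[OF bij_betw_span_insert[OF b], of "\<lambda>y. g (x + y)"]
    by (simp add: sum.cartesian_product case_prod_unfold add_ac)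
  then show ?case
    using pdeg_sum_line[OF insert.IH[OF B], of b] insert.hyps by (simp add: diff_diff_left add.commute)
qed

lemma power_CARD_minus_1:
  assumes "x \<noteq> (0::'f)"
  shows "x ^ (CARD('f) - 1) = 1"
proof -
  obtain n where n: "of_nat n = x" using of_nat_surj_prime_card[OF prime] by metis
  then have "\<not> CARD('f) dvd n" using assms of_nat_CARD_eq_0 by metis
  then have "[n ^ (CARD('f) - 1) = 1] (mod CARD('f))" by (rule fermat_theorem[OF prime])
  then have "(of_nat (n ^ (CARD('f) - 1)) :: 'f) = of_nat 1"
    by (simp only: of_nat_eq_iff_cong_CHAR CHAR_eq_CARD[OF prime])
  then show ?thesis by (simp add: n)
qed

text \<open>The product of the factors 1 - Q^(p-1) is 1 at common zeros and 0 elsewhere, and has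
  degree at most 2 |S| (p - 1). Each of the dim U summations over a direction of U lowers the degree
  by p - 1, so the sum over U vanishes; if 0 were the only common zero, the sum would be 1.\<close>

lemma chevalley_warning:
  fixes Q :: "'s \<Rightarrow> 'w \<Rightarrow> 'f"
  assumes "subspace U" "finite S" "dim U > 2 * card S"
    and "\<And>s. s \<in> S \<Longrightarrow> pdeg 3 (Q s)" and Q0: "\<And>s. s \<in> S \<Longrightarrow> Q s 0 = 0"
  shows "\<exists>v\<in>U. v \<noteq> 0 \<and> (\<forall>s\<in>S. Q s v = 0)"
proof (rule ccontr)
  assume no: "\<not> ?thesis"
  let ?n = "CARD('f) - 1"
  obtain B where B: "B \<subseteq> U" "independent B" "U \<subseteq> span B" "card B = dim U"
    using basis_exists[of U] by blast
  then have spB: "span B = U" using assms(1) span_minimal by blast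
  have fB: "finite B" using B by (simp add: finiteI_independent)
  define g where "g x = (\<Prod>s\<in>S. 1 + (-1) * Q s x ^ ?n)" for x
  have "pdeg (Suc (2 * ?n)) (\<lambda>x. 1 + (-1) * Q s x ^ ?n)" if "s \<in> S" for s
    using pdeg_power[of 2 "Q s" ?n] assms(4)[OF that]
    by (intro pdeg_add pdeg_cmult pdeg_const) (simp_all add: numeral_3_eq_3 mult.commute del: pdeg.simps)
  then have "pdeg (Suc (card S * (2 * ?n))) g"
    unfolding g_def using assms(2) by (intro pdeg_prod) auto
  from pdeg_sum_span[OF fB B(2) this]
  have *: "pdeg (Suc (card S * (2 * ?n)) - card B * ?n) (\<lambda>x. \<Sum>y\<in>U. g (x + y))"
    by (simp add: spB)
  have "Suc (2 * card S) * ?n \<le> card B * ?n" using assms(3) B(4) by (intro mult_right_mono) auto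
  \<comment> \<open>The strict dimension inequality leaves a surplus of \<open>?n\<close> >= 1,
    which absorbs the \<open>Suc\<close> of the degree index.\<close>
  then have "Suc (card S * (2 * ?n)) - card B * ?n = 0" using card5 by (simp add: algebra_simps)
  with * have "(\<Sum>y\<in>U. g (0 + y)) = 0" by (metis pdeg.simps(1))
  moreover have "(\<Sum>y\<in>U. g (0 + y)) = (\<Sum>y\<in>U. if y = 0 then 1 else 0)"
  proof (rule sum.cong)
    fix y assume y: "y \<in> U"
    show "g (0 + y) = (if y = 0 then 1 else 0)"
    proof (cases "y = 0")
      case True
      have "(0::'f) ^ ?n = 0" using card5 by (simp add: power_0_left)
      then have "1 + (-1) * Q s 0 ^ ?n = 1" if "s \<in> S" for s using Q0[OF that] by simp
      then have "g 0 = 1" unfolding g_def by (intro prod.neutral) blast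
      then show ?thesis using True by simp
    next
      case False
      then obtain s where "s \<in> S" "Q s y \<noteq> 0" using no y by blast
      then have "1 + (-1) * Q s y ^ ?n = 0" by (simp add: power_CARD_minus_1 del: One_nat_def)
      then show ?thesis using False \<open>s \<in> S\<close> assms(2) by (auto simp: g_def)
    qed
  qed simp
  moreover have "\<dots> = 1" using subspace_0[OF assms(1)] by simp
  ultimately show False by simp
qed

text \<open>Additivity is asked for only on U, because increments such as v |-> Q(x + v) - Q(x) are
  additive only on an isotropic subspace. The proof counts: translation embeds each fibre of a form
  into its kernel, so each form costs at most a factor |F|.\<close>

lemma dim_common_kernel:
  fixes l :: "'s \<Rightarrow> 'w \<Rightarrow> 'f"
  assumes "finite T" "subspace U" 
    and "\<And>s x y. s \<in> T \<Longrightarrow> x \<in> U \<Longrightarrow> y \<in> U \<Longrightarrow> l s (x + y) = l s x + l s y"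
  shows "subspace {x\<in>U. \<forall>s\<in>T. l s x = 0} \<and> dim U \<le> dim {x\<in>U. \<forall>s\<in>T. l s x = 0} + card T"
  using assms(1,3)
proof (induction T rule: finite_induct)
  case empty
  then show ?case using assms(2) by simp
next
  case (insert t T)
  let ?K = "{x\<in>U. \<forall>s\<in>T. l s x = 0}" and ?K' = "{x\<in>U. \<forall>s\<in>insert t T. l s x = 0}"
  have IH: "subspace ?K" "dim U \<le> dim ?K + card T" using insert by auto
  have add: "l t (x + y) = l t x + l t y" if "x \<in> ?K" "y \<in> ?K" for x y
    using insert.prems that by auto
  have neg: "l t (- x) = - l t x" if "x \<in> ?K" for x
    using additive_scale[OF IH(1) add that, of "-1"] by simp
  have l0: "l s 0 = 0" if "s \<in> insert t T" for s
    using additive_scale[OF assms(2) insert.prems[OF that] subspace_0[OF assms(2)], of 0] by simp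
  have sub: "subspace ?K'"
    using subspace_0[OF assms(2)] l0 assms(2)
    by (intro subspaceI_add) (auto simp: subspace_add insert.prems)
  have fib: "card {x\<in>?K. l t x = c} \<le> card ?K'" for c
  proof (cases "{x\<in>?K. l t x = c} = {}")
    case False
    then obtain x0 where x0: "x0 \<in> ?K" "l t x0 = c" by blast
    have "(\<lambda>x. x - x0) ` {x\<in>?K. l t x = c} \<subseteq> ?K'"
    proof clarify
      fix x assume x: "x \<in> U" "\<forall>s\<in>T. l s x = 0" "c = l t x"
      have mem: "x - x0 \<in> ?K" using subspace_diff[OF IH(1), of x x0] x x0 by blast
      have "l t (x + - x0) = l t x + l t (- x0)"
        using x x0(1) subspace_neg[OF IH(1) x0(1)] by (intro add) blast+
      then have "l t (x - x0) = 0" using neg[OF x0(1)] x x0 by simp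
      then show "x - x0 \<in> U \<and> (\<forall>s\<in>insert t T. l s (x - x0) = 0)" using mem by blast
    qed
    moreover have "inj_on (\<lambda>x. x - x0) {x\<in>?K. l t x = c}" by (simp add: inj_on_def)
    ultimately show ?thesis by (intro card_inj_on_le) auto
  qed (simp only: card.empty le0)
  have "card ?K = card (\<Union>c\<in>UNIV. {x\<in>?K. l t x = c})" by (intro arg_cong[where f = card]) auto
  also have "\<dots> \<le> (\<Sum>c\<in>(UNIV :: 'f set). card {x\<in>?K. l t x = c})" by (intro card_UN_le) auto
  also have "\<dots> \<le> (\<Sum>c\<in>(UNIV :: 'f set). card ?K')" by (intro sum_mono fib)
  also have "\<dots> = CARD('f) * card ?K'" by simp
  finally have "CARD('f) ^ dim ?K \<le> CARD('f) ^ Suc (dim ?K')"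
    using card_subspace[OF IH(1)] card_subspace[OF sub] by simp
  then have "dim ?K \<le> Suc (dim ?K')" using card5 by (subst (asm) power_increasing_iff) auto
  then show ?case using sub IH(2) insert.hyps by simp
qed


section \<open>Common isotropic subspaces and pieces on which several quadratics are
  constant\<close>

lemma polar_scale:
  fixes g :: "'w \<Rightarrow> 'f"
  assumes "pdeg 3 g"
  shows "polar g (scale c u) v = c * polar g u v" "polar g v (scale c u) = c * polar g v u"
proof -
  show "polar g (scale c u) v = c * polar g u v"
    using additive_scale[OF subspace_UNIV, of "\<lambda>u. polar g u v"] polar_add[OF assms] by simp
  then show "polar g v (scale c u) = c * polar g v u"
    by (simp only: polar_commute[of g v])
qed

text \<open>Take V isotropic of maximal dimension. The vectors of U orthogonal to V contain V and
  form a space of dimension at least dim U - |S| dim V. If a complement of V in that space had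
  dimension above 2 |S|, Chevalley-Warning would give a common isotropic vector in it, and adjoining
  this vector to V contradicts maximality.\<close>

lemma isotropic_subspace_exists:
  fixes Q :: "'s \<Rightarrow> 'w \<Rightarrow> 'f"
  assumes U: "subspace U" and S: "finite S" and Q: "\<And>s. s \<in> S \<Longrightarrow> pdeg 3 (Q s)"
  obtains V where "subspace V" "V \<subseteq> U" "\<And>s u v. s \<in> S \<Longrightarrow> u \<in> V \<Longrightarrow> v \<in> V \<Longrightarrow> polar (Q s) u v = 0"
    "dim U \<le> (card S + 1) * dim V + 2 * card S"
proof -
  define iso where "iso V \<longleftrightarrow> subspace V \<and> V \<subseteq> U \<and> (\<forall>s\<in>S. \<forall>u\<in>V. \<forall>v\<in>V. polar (Q s) u v = 0)" for V
  have "iso {0}" using subspace_0[OF U] by (simp add: iso_def)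
  moreover have "\<forall>V. iso V \<longrightarrow> dim V < Suc dimension" using dim_subset_UNIV by (simp add: less_Suc_eq_le)
  ultimately obtain V where V: "iso V" and max: "\<And>V'. iso V' \<Longrightarrow> dim V' \<le> dim V"
    using ex_has_greatest_nat[of iso "{0}" dim "Suc dimension"] by blast
  have sV: "subspace V" and VU: "V \<subseteq> U"
    and V0: "\<And>s u v. s \<in> S \<Longrightarrow> u \<in> V \<Longrightarrow> v \<in> V \<Longrightarrow> polar (Q s) u v = 0"
    using V by (auto simp: iso_def)
  have "dim U \<le> (card S + 1) * dim V + 2 * card S"
  proof (rule ccontr)
    assume big: "\<not> ?thesis"
    obtain C where C: "C \<subseteq> V" "independent C" "V \<subseteq> span C" "card C = dim V"
      using basis_exists[of V] by blast
    then have spC: "span C = V" using sV span_minimal by blast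
    have fC: "finite C" by simp
    define V' where "V' = {x\<in>U. \<forall>t\<in>S\<times>C. polar (Q (fst t)) x (snd t) = 0}"
    have V': "subspace V'" "dim U \<le> dim V' + card S * dim V"
      using dim_common_kernel[of "S \<times> C" U "\<lambda>t x. polar (Q (fst t)) x (snd t)"] S fC U
      by (auto simp: V'_def card_cartesian_product C(4) polar_add Q)
    have perp: "polar (Q s) x v = 0" if "x \<in> V'" "v \<in> V" "s \<in> S" for x v s
    proof -
      have "subspace {v. polar (Q s) x v = 0}"
        by (intro subspaceI) (auto simp: polar_add polar_scale Q that)
      moreover have "C \<subseteq> {v. polar (Q s) x v = 0}" using that by (auto simp: V'_def)
      ultimately have "span C \<subseteq> {v. polar (Q s) x v = 0}" by (simp add: span_minimal)
      then show ?thesis using that spC by blast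
    qed
    have "C \<subseteq> V'" using C(1) VU V0[OF _ subsetD[OF C(1)] subsetD[OF C(1)]] by (auto simp: V'_def)
    then obtain C' where C': "C \<subseteq> C'" "C' \<subseteq> V'" "independent C'" "V' \<subseteq> span C'"
      using maximal_independent_subset_extend[OF _ C(2), of V'] by blast
    have cC': "card C' = dim V'" using basis_card_eq_dim[OF C'(2,4,3)] .
    \<comment> \<open>The span of \<open>?D\<close> is a complement of V in \<open>V'\<close>; a
      nonzero vector found there is automatically outside V.\<close>
    let ?D = "C' - C"
    have iD: "independent ?D" using C'(3) by (rule independent_mono) auto
    have "dim (span ?D) = card C' - card C"
      using dim_span_eq_card_independent[OF iD] C'(1) by (simp add: card_Diff_subset)
    then have "dim (span ?D) > 2 * card S"
      using big V'(2) cC' C(4) by (simp add: algebra_simps)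
    then obtain v where v: "v \<in> span ?D" "v \<noteq> 0" "\<And>s. s \<in> S \<Longrightarrow> polar (Q s) v v = 0"
      using chevalley_warning[of "span ?D" S "\<lambda>s x. polar (Q s) x x"] S pdeg_polar_diag[OF Q] by auto
    have vV': "v \<in> V'"
      using v(1) span_minimal[of ?D V'] C'(2) V'(1) by auto
    have "v \<notin> V"
    proof
      assume "v \<in> V"
      then have vC: "v \<in> span C" by (simp add: spC)
      have "representation C' v = representation C v" "representation C' v = representation ?D v"
        using representation_extend[OF C'(3) vC C'(1)] representation_extend[OF C'(3) v(1)] by auto
      then have "representation C v b = 0" for b
        by (metis DiffD2 representation_ne_zero)
      then have "v = 0" using sum_nonzero_representation_eq[OF C(2) vC] by simp
      then show False using v(2) by simp
    qed
    define V2 where "V2 = span (insert v V)"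
    have V2: "\<exists>c x. y = scale c v + x \<and> x \<in> V" if y: "y \<in> V2" for y
    proof -
      obtain k where "y - scale k v \<in> span V" using y unfolding V2_def span_insert by blast
      then have "y - scale k v \<in> V" using span_eq_iff sV by blast
      then show ?thesis by (intro exI[of _ k] exI[of _ "y - scale k v"]) simp
    qed
    have "iso V2"
      unfolding iso_def
    proof (intro conjI ballI)
      show "subspace V2" by (simp add: V2_def)
      have "v \<in> U" using vV' by (simp add: V'_def)
      then show "V2 \<subseteq> U" unfolding V2_def using VU U by (intro span_minimal) auto
      fix s a b assume s: "s \<in> S" and a: "a \<in> V2" and b: "b \<in> V2"
      obtain c x c' y where "a = scale c v + x" "x \<in> V" "b = scale c' v + y" "y \<in> V"
        using V2[OF a] V2[OF b] by blast
      then show "polar (Q s) a b = 0"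
        using v(3)[OF s] perp[OF vV' _ s] polar_commute[of "Q s" x v] V0[OF s]
        by (simp add: polar_add[OF Q[OF s]] polar_scale[OF Q[OF s]])
    qed
    moreover have "dim V2 = dim V + 1"
      unfolding V2_def dim_span using \<open>v \<notin> V\<close> by (simp add: dim_insert span_eq_iff[THEN iffD2, OF sV])
    ultimately show False using max[of V2] by simp
  qed
  then show thesis using that sV VU V0 by blast
qed

text \<open>On an isotropic V the increment Q(x + v) - Q(x) is additive in v, so the common kernel
  \<open>P x\<close> of the increments has codimension at most |S| in V. Moving x within V does not
  change the increments; hence the sets x + \<open>P x\<close> partition the space, although
  \<open>P x\<close> may vary with x.\<close>

lemma quadratic_pieces:
  fixes Q :: "'s \<Rightarrow> 'w \<Rightarrow> 'f"
  assumes U: "subspace U" and S: "finite S" and Q: "\<And>s. s \<in> S \<Longrightarrow> pdeg 3 (Q s)"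
  obtains P where "\<And>x. subspace (P x)" "\<And>x. P x \<subseteq> U"
    "\<And>x. dim U \<le> (card S + 1) * (dim (P x) + card S) + 2 * card S"
    "\<And>x y. y \<in> P x \<Longrightarrow> P (x + y) = P x"
    "\<And>s x y. s \<in> S \<Longrightarrow> y \<in> P x \<Longrightarrow> Q s (x + y) = Q s x"
proof -
  obtain V where V: "subspace V" "V \<subseteq> U" 
    "\<And>s u v. s \<in> S \<Longrightarrow> u \<in> V \<Longrightarrow> v \<in> V \<Longrightarrow> polar (Q s) u v = 0"
    "dim U \<le> (card S + 1) * dim V + 2 * card S"
    using isotropic_subspace_exists[of U S Q] assms by blast
  have cross: "Q s (x + u + v) - Q s (x + u) = Q s (x + v) - Q s x" if "s \<in> S" "u \<in> V" "v \<in> V" for s x u v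
    using polar_base_point[OF Q[OF that(1)], of x u v] V(3)[OF that] by (simp add: algebra_simps)
  define P where "P x = {v\<in>V. \<forall>s\<in>S. Q s (x + v) - Q s x = 0}" for x
  have P: "subspace (P x) \<and> dim V \<le> dim (P x) + card S" for x
    unfolding P_def
  proof (rule dim_common_kernel[OF S V(1)])
    fix s u v assume "s \<in> S" "u \<in> V" "v \<in> V"
    then show "Q s (x + (u + v)) - Q s x = Q s (x + u) - Q s x + (Q s (x + v) - Q s x)"
      using cross[of s u v x] by (simp add: algebra_simps)
  qed
  show thesis
  proof (rule that[of P])
    fix x
    show "subspace (P x)" using P by blast
    show "P x \<subseteq> U" using V(2) by (auto simp: P_def)
    have "(card S + 1) * dim V \<le> (card S + 1) * (dim (P x) + card S)"
      using P[of x] by (intro mult_le_mono2) blast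
    then show "dim U \<le> (card S + 1) * (dim (P x) + card S) + 2 * card S" using V(4) by linarith
    fix y assume y: "y \<in> P x"
    then have "Q s (x + y + v) - Q s (x + y) = Q s (x + v) - Q s x" if "s \<in> S" "v \<in> V" for s v
      using cross[of s y v x] that by (simp add: P_def)
    then show "P (x + y) = P x" unfolding P_def by (simp cong: conj_cong)
    show "Q s (x + y) = Q s x" if "s \<in> S" for s using y that by (simp add: P_def)
  qed
qed

text \<open>Since \<open>T\<close> is constant on pieces, f may be replaced by its piece averages g,
  which are at most M on A. Completing the square gives 2 g Re T - |T|^2 <= g^2 <= M g
  pointwise.\<close>

lemma piece_bessel:
  fixes f :: "'w \<Rightarrow> real" and T :: "'w \<Rightarrow> complex"
  assumes P: "\<And>x. subspace (P x)" "\<And>x y. y \<in> P x \<Longrightarrow> P (x + y) = P x"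
    and A: "\<And>x y. x \<in> A \<Longrightarrow> y \<in> P x \<Longrightarrow> x + y \<in> A"
    and T: "\<And>x y. y \<in> P x \<Longrightarrow> T (x + y) = T x"
    and f: "\<And>x. f x \<ge> 0"
    and M: "\<And>x. x \<in> A \<Longrightarrow> (\<Sum>y\<in>P x. f (x + y)) \<le> M * real (card (P x))"
  shows "(\<Sum>x\<in>A. 2 * f x * Re (T x) - (norm (T x))\<^sup>2) \<le> M * (\<Sum>x\<in>A. f x)"
proof -
  define g where "g x = (\<Sum>y\<in>P x. f (x + y)) / real (card (P x))" for x
  have cP: "card (P x) > 0" for x
    using subspace_0[OF P(1)] by (auto simp: card_gt_0_iff)
  have key: "(\<Sum>x\<in>A. \<phi> x * g x) = (\<Sum>x\<in>A. \<phi> x * f x)"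
    if \<phi>: "\<And>x y. y \<in> P x \<Longrightarrow> \<phi> (x + y) = \<phi> x" for \<phi> :: "'w \<Rightarrow> real"
  proof -
    let ?h = "\<lambda>(x, y). \<phi> x * f (x + y) / real (card (P x))"
    \<comment> \<open>This involution swaps the two points x and x + y of a piece, which moves the
      averaging from f to the weight, where it has no effect.\<close>
    have bij: "bij_betw (\<lambda>(x, y). (x + y, - y)) (Sigma A P) (Sigma A P)"
      by (rule bij_betwI[where g = "\<lambda>(x, y). (x + y, - y)"])
        (auto simp: A P(2) subspace_neg[OF P(1)])
    have "(\<Sum>x\<in>A. \<phi> x * g x) = (\<Sum>x\<in>A. \<Sum>y\<in>P x. ?h (x, y))"
      by (simp add: g_def sum_distrib_left sum_divide_distrib)
    also have "\<dots> = sum ?h (Sigma A P)" by (simp add: sum.Sigma)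
    also have "\<dots> = sum (\<lambda>z. ?h (case z of (x, y) \<Rightarrow> (x + y, - y))) (Sigma A P)"
      by (rule sum.reindex_bij_betw[OF bij, symmetric])
    also have "\<dots> = sum (\<lambda>(x, y). \<phi> x * f x / real (card (P x))) (Sigma A P)"
      by (rule sum.cong) (auto simp: P(2) \<phi>)
    also have "\<dots> = (\<Sum>x\<in>A. \<Sum>y\<in>P x. \<phi> x * f x / real (card (P x)))"
      by (rule sum.Sigma[symmetric]) auto
    also have "\<dots> = (\<Sum>x\<in>A. \<phi> x * f x)" using cP by (intro sum.cong) (auto simp: card_gt_0_iff)
    finally show ?thesis .
  qed
  have g0: "g x \<ge> 0" for x using f by (auto simp: g_def intro!: divide_nonneg_nonneg sum_nonneg)
  have gM: "g x \<le> M" if "x \<in> A" for x using M[OF that] cP[of x] by (simp add: g_def divide_le_eq)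
  have "(\<Sum>x\<in>A. 2 * f x * Re (T x) - (norm (T x))\<^sup>2)
      = 2 * (\<Sum>x\<in>A. Re (T x) * f x) - (\<Sum>x\<in>A. (norm (T x))\<^sup>2)"
    by (simp add: sum_subtractf sum_distrib_left mult_ac)
  also have "\<dots> = 2 * (\<Sum>x\<in>A. Re (T x) * g x) - (\<Sum>x\<in>A. (norm (T x))\<^sup>2)"
    by (subst key) (auto simp: T)
  also have "\<dots> = (\<Sum>x\<in>A. 2 * (Re (T x) * g x) - (norm (T x))\<^sup>2)"
    by (simp add: sum_subtractf sum_distrib_left)
  also have "\<dots> \<le> (\<Sum>x\<in>A. M * g x)"
  proof (rule sum_mono)
    fix x assume "x \<in> A"
    have "0 \<le> (g x - Re (T x))\<^sup>2 + (Im (T x))\<^sup>2" by simp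
    then have "2 * (Re (T x) * g x) - (norm (T x))\<^sup>2 \<le> g x * g x"
      unfolding cmod_power2 by (simp add: power2_eq_square algebra_simps)
    also have "\<dots> \<le> M * g x" using gM[OF \<open>x \<in> A\<close>] g0 by (intro mult_right_mono)
    finally show "2 * (Re (T x) * g x) - (norm (T x))\<^sup>2 \<le> M * g x" .
  qed
  also have "\<dots> = M * (\<Sum>x\<in>A. f x)"
    using key[of "\<lambda>_. 1"] by (simp add: sum_distrib_left[symmetric])
  finally show ?thesis .
qed

end

section \<open>Equidistribution of high-rank factors\<close>

text \<open>An abstract finite dual group: D indexes characters on G, z is the trivial one, and of
  the structure only orthogonality is kept. Without group operations, several coordinates combine
  directly through \<open>dual_pair_prod\<close>.\<close>

definition dual_pair :: "'k set \<Rightarrow> 'k \<Rightarrow> 'g set \<Rightarrow> ('k \<Rightarrow> 'g \<Rightarrow> complex) \<Rightarrow> bool" where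
  "dual_pair D z G e \<longleftrightarrow> finite D \<and> finite G \<and> z \<in> D \<and> (\<forall>g\<in>G. e z g = 1) \<and> (\<forall>k g. norm (e k g) \<le> 1) \<and>
     (\<forall>g\<in>G. \<forall>g'\<in>G. (\<Sum>k\<in>D. e k g * cnj (e k g')) = (if g = g' then of_nat (card D) else 0))"

text \<open>The event \<Theta> x = g is detected by orthogonality: the trivial character yields |X|,
  and every other one contributes at most \<epsilon> |X|.\<close>

lemma equidistribution_count:
  assumes dp: "dual_pair D z G e" and X: "finite X" and \<Theta>: "\<And>x. x \<in> X \<Longrightarrow> \<Theta> x \<in> G" and \<epsilon>: "\<epsilon> \<ge> 0"
    and small: "\<And>k. k \<in> D \<Longrightarrow> k \<noteq> z \<Longrightarrow> norm (\<Sum>x\<in>X. e k (\<Theta> x)) \<le> \<epsilon> * real (card X)"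
    and g: "g \<in> G"
  shows "\<bar>real (card D) * real (card {x\<in>X. \<Theta> x = g}) - real (card X)\<bar> \<le> real (card D) * \<epsilon> * real (card X)"
proof -
  have D: "finite D" "z \<in> D" and e1: "\<And>g. g \<in> G \<Longrightarrow> e z g = 1" and en: "\<And>k g. norm (e k g) \<le> 1"
    and orth: "\<And>g g'. g \<in> G \<Longrightarrow> g' \<in> G \<Longrightarrow>
      (\<Sum>k\<in>D. e k g * cnj (e k g')) = (if g = g' then of_nat (card D) else 0)"
    using dp by (auto simp: dual_pair_def)
  let ?s = "\<lambda>k. cnj (e k g) * (\<Sum>x\<in>X. e k (\<Theta> x))"
  have "(\<Sum>k\<in>D. ?s k) = (\<Sum>x\<in>X. \<Sum>k\<in>D. e k (\<Theta> x) * cnj (e k g))"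
    by (subst sum.swap) (simp add: sum_distrib_left mult.commute)
  also have "\<dots> = (\<Sum>x\<in>X. if \<Theta> x = g then of_nat (card D) else 0)"
    using \<Theta> g by (intro sum.cong refl orth) auto
  also have "\<dots> = of_nat (card D) * of_nat (card {x\<in>X. \<Theta> x = g})"
    using X by (simp add: sum.If_cases Int_def mult.commute)
  finally have 1: "(\<Sum>k\<in>D. ?s k) = of_nat (card D) * of_nat (card {x\<in>X. \<Theta> x = g})" .
  have "?s z = of_nat (card X)" using e1 g \<Theta> by simp
  then have "(\<Sum>k\<in>D. ?s k) = of_nat (card X) + (\<Sum>k\<in>D-{z}. ?s k)"
    using D by (simp add: sum.remove[of D z])
  from trans[OF 1[symmetric] this]
  have "complex_of_real (real (card D) * real (card {x\<in>X. \<Theta> x = g}) - real (card X)) = (\<Sum>k\<in>D-{z}. ?s k)"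
    by simp
  then have "\<bar>real (card D) * real (card {x\<in>X. \<Theta> x = g}) - real (card X)\<bar> = norm (\<Sum>k\<in>D-{z}. ?s k)"
    by (simp only: flip: norm_of_real[where 'a = complex])
  also have "\<dots> \<le> (\<Sum>k\<in>D-{z}. \<epsilon> * real (card X))"
  proof (rule sum_norm_le)
    fix k assume k: "k \<in> D - {z}"
    have "norm (?s k) \<le> 1 * (\<epsilon> * real (card X))"
      unfolding norm_mult using k en small by (intro mult_mono) auto
    then show "norm (?s k) \<le> \<epsilon> * real (card X)" by simp
  qed
  also have "\<dots> \<le> (\<Sum>k\<in>D. \<epsilon> * real (card X))"
    using D \<epsilon> by (intro sum_mono2) auto
  finally show ?thesis by (simp add: mult_ac)
qed

lemma equidistribution_sum:
  assumes dp: "dual_pair D z G e" and X: "finite X" and \<Theta>: "\<And>x. x \<in> X \<Longrightarrow> \<Theta> x \<in> G" and \<epsilon>: "\<epsilon> \<ge> 0"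
    and small: "\<And>k. k \<in> D \<Longrightarrow> k \<noteq> z \<Longrightarrow> norm (\<Sum>x\<in>X. e k (\<Theta> x)) \<le> \<epsilon> * real (card X)"
  shows "\<bar>real (card D) * (\<Sum>x\<in>X. H (\<Theta> x)) - real (card X) * (\<Sum>g\<in>G. H g)\<bar>
      \<le> real (card D) * \<epsilon> * real (card X) * (\<Sum>g\<in>G. \<bar>H g\<bar>)"
proof -
  have G: "finite G" using dp by (auto simp: dual_pair_def)
  have "(\<Sum>x\<in>X. H (\<Theta> x)) = (\<Sum>g\<in>G. \<Sum>x\<in>{x\<in>X. \<Theta> x = g}. H (\<Theta> x))"
    by (rule sum.group[OF X G, symmetric]) (use \<Theta> in auto)
  also have "\<dots> = (\<Sum>g\<in>G. real (card {x\<in>X. \<Theta> x = g}) * H g)"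
    by (intro sum.cong) auto
  finally have "real (card D) * (\<Sum>x\<in>X. H (\<Theta> x)) - real (card X) * (\<Sum>g\<in>G. H g)
     = (\<Sum>g\<in>G. (real (card D) * real (card {x\<in>X. \<Theta> x = g}) - real (card X)) * H g)"
    by (simp add: sum_distrib_left sum_distrib_right left_diff_distrib right_diff_distrib sum_subtractf mult_ac)
  also have "\<bar>\<dots>\<bar> \<le> (\<Sum>g\<in>G. real (card D) * \<epsilon> * real (card X) * \<bar>H g\<bar>)"
    by (rule order_trans[OF sum_abs], rule sum_mono, unfold abs_mult, rule mult_right_mono,
        rule equidistribution_count[OF dp X \<Theta> \<epsilon> small]) auto
  finally show ?thesis by (simp add: sum_distrib_left)
qed

lemma dual_pair_prod:
  assumes "dual_pair D z G e" "dual_pair D' z' G' e'"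
  shows "dual_pair (D \<times> D') (z, z') (G \<times> G') (\<lambda>(k, k') (g, g'). e k g * e' k' g')"
proof -
  have "(\<Sum>k\<in>D \<times> D'. (case k of (k, k') \<Rightarrow> \<lambda>(g, g'). e k g * e' k' g') (a, a')
       * cnj ((case k of (k, k') \<Rightarrow> \<lambda>(g, g'). e k g * e' k' g') (b, b')))
     = (\<Sum>k\<in>D. e k a * cnj (e k b)) * (\<Sum>k\<in>D'. e' k a' * cnj (e' k b'))" for a a' b b'
    by (simp add: sum_product sum.cartesian_product case_prod_unfold mult_ac)
  then show ?thesis
    using assms unfolding dual_pair_def
    by (auto simp: norm_mult mult_le_one card_cartesian_product)
qed

lemma pdeg_dot:
  assumes "\<And>j. pdeg d (\<lambda>x. g x j)"
  shows "pdeg d (\<lambda>x. dot n \<xi> (g x))"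
proof -
  have "pdeg d (\<lambda>x. \<Sum>j<n. \<xi> j * g x j)"
  proof (induction n)
    case 0
    then show ?case by (simp add: pdeg_zero)
  next
    case (Suc n)
    then show ?case by (simp only: sum.lessThan_Suc) (intro pdeg_add pdeg_cmult assms)
  qed
  then show ?thesis by (simp add: dot_def)
qed

lemma polar_fun_add: "polar (\<lambda>x. f x + g x) u v = polar f u v + polar g u v"
  by (simp add: polar_def)

context prime_field_space
begin

lemma dual_pair_fvec:
  "dual_pair (fvec d) 0 (fvec d) (\<lambda>\<xi> v. add_char (dot d \<xi> v :: 'f))"
proof -
  have "(\<Sum>k\<in>fvec d. add_char (dot d k g) * cnj (add_char (dot d k g')))
      = (if g = g' then of_nat (card (fvec d :: (nat \<Rightarrow> 'f) set)) else 0)"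
    if "g \<in> fvec d" "g' \<in> fvec d" for g g' :: "nat \<Rightarrow> 'f"
    using sum_add_char_dot[OF prime card5, of "g - g'" d] that
    by (simp add: add_char_add[OF prime, symmetric] add_char_minus[OF prime, symmetric] card_fvec)
  then show ?thesis by (simp add: dual_pair_def)
qed

text \<open>Weyl differencing: the squared modulus is a sum over h of the character sums of g(x + h)
  - g(x). For h outside the radical of the polar form, shifting x by a suitable h' changes the
  exponent by the nonzero constant \<open>polar g h h'\<close>, so only the radical
  contributes.\<close>

lemma gauss_sum_bound:
  fixes g :: "'w \<Rightarrow> 'f"
  assumes g: "pdeg 3 g"
  shows "(norm (\<Sum>x\<in>UNIV. add_char (g x)))\<^sup>2
     \<le> real (card (UNIV :: 'w set)) * real (card {h. \<forall>h'. polar g h h' = 0})"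
proof -
  let ?S = "\<Sum>x\<in>UNIV. add_char (g x)" and ?K = "{h. \<forall>h'. polar g h h' = 0}"
  have bij: "bij (\<lambda>x. x + h)" for h :: 'w
    by (rule bij_betwI[where g = "\<lambda>x. x - h"]) auto
  have "complex_of_real ((norm ?S)\<^sup>2) = ?S * cnj ?S" by (rule complex_norm_square)
  also have "\<dots> = (\<Sum>x\<in>UNIV. \<Sum>y\<in>UNIV. add_char (g y - g x))"
    by (subst mult.commute)
      (simp add: sum_product add_char_minus[OF prime, symmetric] add_char_add[OF prime, symmetric])
  also have "\<dots> = (\<Sum>x\<in>UNIV. \<Sum>h\<in>UNIV. add_char (g (x + h) - g x))"
  proof (rule sum.cong[OF refl])
    fix x
    show "(\<Sum>y\<in>UNIV. add_char (g y - g x)) = (\<Sum>h\<in>UNIV. add_char (g (x + h) - g x))"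
      using sum.reindex_bij_betw[OF bij[of x], of "\<lambda>y. add_char (g y - g x)"] by (simp add: add.commute)
  qed
  also have "\<dots> = (\<Sum>h\<in>UNIV. \<Sum>x\<in>UNIV. add_char (g (x + h) - g x))"
    by (rule sum.swap)
  also have "\<dots> = (\<Sum>h\<in>?K. \<Sum>x\<in>UNIV. add_char (g (x + h) - g x))"
  proof (rule sum.mono_neutral_right)
    show "\<forall>h\<in>UNIV - ?K. (\<Sum>x\<in>UNIV. add_char (g (x + h) - g x)) = 0"
    proof
      fix h assume "h \<in> UNIV - ?K"
      then obtain h' where h': "polar g h h' \<noteq> 0" by blast
      show "(\<Sum>x\<in>UNIV. add_char (g (x + h) - g x)) = 0"
      proof (rule sum_add_char_eq_0[OF prime card5 bij[of h'] _ h'])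
        fix x
        show "g (x + h' + h) - g (x + h') = g (x + h) - g x + polar g h h'"
          using polar_base_point[OF g, of x h h'] by (simp add: algebra_simps)
      qed
    qed
  qed auto
  finally have "(norm ?S)\<^sup>2 = norm (\<Sum>h\<in>?K. \<Sum>x\<in>UNIV. add_char (g (x + h) - g x))"
    by (metis abs_of_nonneg norm_of_real zero_le_power2)
  also have "\<dots> \<le> (\<Sum>h\<in>?K. \<Sum>x\<in>(UNIV :: 'w set). 1)"
    by (intro sum_norm_le) (simp del: sum_constant)
  finally show ?thesis by (simp add: mult.commute)
qed

end

text \<open>The factor in field-valued coordinates: L collects the linear phases and q the quadratic
  ones. High rank is recorded as a bound \<epsilon>^2 on the density of the radical of every nonzero
  combination, because \<epsilon> is then the bound for normalized character sums.\<close>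

locale prime_field_factor = prime_field_space scale Basis
  for scale :: "'f::{field,finite} \<Rightarrow> 'w::ab_group_add \<Rightarrow> 'w" and Basis +
  fixes d1 d2 :: nat and L q :: "'w \<Rightarrow> nat \<Rightarrow> 'f" and \<epsilon> :: real
  assumes L_fvec [simp]: "L x \<in> fvec d1" and L_add: "L (x + y) = L x + L y"
    and L_indep: "\<beta> \<in> fvec d1 \<Longrightarrow> (\<And>x. dot d1 \<beta> (L x) = 0) \<Longrightarrow> \<beta> = 0"
    and q_fvec [simp]: "q x \<in> fvec d2" and q_pdeg: "pdeg 3 (\<lambda>x. q x j)"
    and \<epsilon>_nonneg: "\<epsilon> \<ge> 0"
    and q_rank: "\<xi> \<in> fvec d2 \<Longrightarrow> \<xi> \<noteq> 0 \<Longrightarrow>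
       real (card {h. \<forall>h'. polar (\<lambda>x. dot d2 \<xi> (q x)) h h' = 0}) \<le> \<epsilon>\<^sup>2 * real (card (UNIV :: 'w set))"
begin

abbreviation "W \<equiv> (UNIV :: 'w set)"

lemma L_scale: "L (scale c x) = smul c (L x)"
proof
  fix j
  have "L (scale c x) j = c * L x j"
    by (rule additive_scale[OF subspace_UNIV, of "\<lambda>x. L x j"]) (simp_all add: L_add)
  then show "L (scale c x) j = smul c (L x) j" by (simp add: smul_def)
qed

lemma dot_q_pdeg: "pdeg 3 (\<lambda>x. dot d2 \<xi> (q x))"
  by (rule pdeg_dot[OF q_pdeg])

text \<open>Only the polar form of g matters, so lower-order terms in the exponent are
  harmless.\<close>

lemma quadratic_sum_bound:
  assumes "\<xi> \<in> fvec d2" "\<xi> \<noteq> 0" and "pdeg 3 g" and "\<And>u v. polar g u v = polar (\<lambda>x. dot d2 \<xi> (q x)) u v"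
  shows "norm (\<Sum>x\<in>W. add_char (g x)) \<le> \<epsilon> * real (card W)"
proof -
  have "(norm (\<Sum>x\<in>W. add_char (g x)))\<^sup>2 \<le> real (card W) * (\<epsilon>\<^sup>2 * real (card W))"
    using gauss_sum_bound[OF assms(3)] q_rank[OF assms(1,2)] assms(4)
    by (smt (verit, best) Collect_cong mult_left_mono of_nat_0_le_iff)
  then have "(norm (\<Sum>x\<in>W. add_char (g x)))\<^sup>2 \<le> (\<epsilon> * real (card W))\<^sup>2"
    by (simp add: power2_eq_square mult_ac)
  then show ?thesis by (rule power2_le_imp_le) (simp add: \<epsilon>_nonneg)
qed

lemma additive_pdeg_polar:
  fixes l :: "'w \<Rightarrow> 'f"
  assumes "\<And>x y. l (x + y) = l x + l y"
  shows "pdeg 3 l" "polar l u v = 0"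
proof -
  have "l (0 + 0) = l 0 + l 0" by (rule assms)
  then have "l 0 = 0" by (metis add.right_neutral add_left_cancel)
  then show "polar l u v = 0" by (simp add: polar_def assms)
  show "pdeg 3 l" by (simp add: pdeg_3_iff assms)
qed

lemma linear_nonzero:
  assumes "\<beta> \<in> fvec d1" "\<beta> \<noteq> 0"
  obtains h where "dot d1 \<beta> (L h) \<noteq> 0"
  using L_indep[OF assms(1)] assms(2) by blast

lemma bij_add_w: "bij (\<lambda>x. x + h)" for h :: 'w
  by (rule bij_betwI[where g = "\<lambda>x. x - h"]) auto

text \<open>A purely linear character sums to exactly 0 by independence; otherwise the linear part
  is a lower-order term of a quadratic.\<close>

lemma single_character_sum:
  assumes "\<beta> \<in> fvec d1" "\<xi> \<in> fvec d2" "(\<beta>, \<xi>) \<noteq> (0, 0)"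
  shows "norm (\<Sum>x\<in>W. add_char (dot d1 \<beta> (L x)) * add_char (dot d2 \<xi> (q x))) \<le> \<epsilon> * real (card W)"
proof (cases "\<xi> = 0")
  case True
  then obtain h where h: "dot d1 \<beta> (L h) \<noteq> 0" using linear_nonzero assms by auto
  have "(\<Sum>x\<in>W. add_char (dot d1 \<beta> (L x))) = 0"
    by (rule sum_add_char_eq_0[OF prime card5 bij_add_w[of h] _ h]) (simp add: L_add)
  then show ?thesis using True by (simp add: \<epsilon>_nonneg)
next
  case False
  note a = additive_pdeg_polar[of "\<lambda>x. dot d1 \<beta> (L x)"]
  have "norm (\<Sum>x\<in>W. add_char (dot d1 \<beta> (L x) + dot d2 \<xi> (q x))) \<le> \<epsilon> * real (card W)"
    by (rule quadratic_sum_bound[OF assms(2) False])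
      (intro pdeg_add dot_q_pdeg a | simp add: polar_fun_add L_add a)+
  then show ?thesis by (simp add: add_char_add[OF prime])
qed

lemma pdeg_dilate:
  fixes g :: "'w \<Rightarrow> 'f"
  assumes "pdeg 3 g"
  shows "pdeg 3 (\<lambda>h. g (y + scale m h))" "polar (\<lambda>h. g (y + scale m h)) u v = m\<^sup>2 * polar g u v"
proof -
  have "pdeg 3 (\<lambda>h. g (scale m h + y))"
    by (rule pdeg_comp[of "scale m", OF _ pdeg_shift[OF assms]]) (simp add: scale_right_distrib)
  then show "pdeg 3 (\<lambda>h. g (y + scale m h))" by (simp add: add.commute)
  have "polar (\<lambda>h. g (y + scale m h)) u v = polar g (scale m u) (scale m v)"
    using polar_base_point[OF assms, of y "scale m u" "scale m v"]
    by (simp add: polar_def scale_right_distrib add_ac)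
  then show "polar (\<lambda>h. g (y + scale m h)) u v = m\<^sup>2 * polar g u v"
    by (simp add: polar_scale[OF assms] power2_eq_square)
qed

lemma two_nonzero: "(2::'f) \<noteq> 0"
proof
  assume "(2::'f) = 0"
  then have "of_nat 2 = (0::'f)" by simp
  then have "CARD('f) dvd 2" by (simp only: of_nat_CARD_eq_0)
  then show False using card5 by (auto dest: dvd_imp_le)
qed

text \<open>
  Fixing the point \<open>x + i h\<close> of the progression and summing over \<open>h\<close> leaves a quadratic whose leading
  coefficient is \<open>\<Sum>k. (k - i)\<^sup>2 \<xi>\<^sub>k\<close>; these three combinations vanish simultaneously only at zero.
\<close>

lemma pair_character_sum:
  assumes "\<beta> \<in> fvec d1" "\<gamma> \<in> fvec d1" "\<xi>0 \<in> fvec d2" "\<xi>1 \<in> fvec d2" "\<xi>2 \<in> fvec d2"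
    and "(\<beta>, \<gamma>, \<xi>0, \<xi>1, \<xi>2) \<noteq> (0, 0, 0, 0, 0)"
  shows "norm (\<Sum>(x, h)\<in>W \<times> W. add_char (dot d1 \<beta> (L x) + dot d1 \<gamma> (L h) + dot d2 \<xi>0 (q x)
     + dot d2 \<xi>1 (q (x + h)) + dot d2 \<xi>2 (q (x + scale 2 h)))) \<le> \<epsilon> * real (card (W \<times> W))"
    (is "norm (\<Sum>(x, h)\<in>W \<times> W. add_char (?g x h)) \<le> _")
proof (cases "\<xi>0 = 0 \<and> \<xi>1 = 0 \<and> \<xi>2 = 0")
  case True
  have "\<exists>h0 h1. dot d1 \<beta> (L h0) + dot d1 \<gamma> (L h1) \<noteq> 0"
  proof (cases "\<beta> = 0")
    case True
    then obtain h where "dot d1 \<gamma> (L h) \<noteq> 0"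
      using linear_nonzero assms \<open>\<xi>0 = 0 \<and> _\<close> by auto
    then show ?thesis using True by auto
  next
    case False
    then obtain h where "dot d1 \<beta> (L h) \<noteq> 0" using linear_nonzero assms by auto
    moreover have "L 0 = 0" using L_scale[of 0 0] by (simp add: smul_def fun_eq_iff)
    ultimately show ?thesis by (intro exI[of _ h] exI[of _ 0]) simp
  qed
  then obtain h0 h1 where h: "dot d1 \<beta> (L h0) + dot d1 \<gamma> (L h1) \<noteq> 0" by blast
  have bij: "bij_betw (\<lambda>(x, y). (x + h0, y + h1)) (W \<times> W) (W \<times> W)"
    by (rule bij_betwI[where g = "\<lambda>(x, y). (x - h0, y - h1)"]) auto
  have "(\<Sum>z\<in>W \<times> W. add_char (?g (fst z) (snd z))) = 0"
    by (rule sum_add_char_eq_0[OF prime card5 bij _ h]) (use True in \<open>auto simp: L_add\<close>)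
  then show ?thesis by (simp add: case_prod_unfold \<epsilon>_nonneg)
next
  case False
  define c where "c i = smul (i\<^sup>2) \<xi>0 + smul ((1 - i)\<^sup>2) \<xi>1 + smul ((2 - i)\<^sup>2) \<xi>2" for i :: 'f
  have "\<exists>i. c i \<noteq> 0"
  proof (rule ccontr)
    assume "\<not> ?thesis"
    then have c0: "c i j = 0" for i j by (simp add: fun_eq_iff)
    have "\<xi>0 j = 0 \<and> \<xi>1 j = 0 \<and> \<xi>2 j = 0" for j
    proof -
      have e: "\<xi>1 j + 4 * \<xi>2 j = 0" "\<xi>0 j + \<xi>2 j = 0" "4 * \<xi>0 j + \<xi>1 j = 0"
        using c0[of 0 j] c0[of 1 j] c0[of 2 j] by (simp_all add: c_def smul_def)
      \<comment> \<open>Elimination leaves 8 times \<open>\<xi>2 j\<close>, written with three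
        factors 2 because \<open>two_nonzero\<close> is at hand.\<close>
      have "2 * (2 * (2 * \<xi>2 j)) = (\<xi>1 j + 4 * \<xi>2 j) + 4 * (\<xi>0 j + \<xi>2 j) - (4 * \<xi>0 j + \<xi>1 j)"
        by (simp add: algebra_simps)
      then have "2 * (2 * (2 * \<xi>2 j)) = 0" unfolding e by simp
      then have "\<xi>2 j = 0" using two_nonzero by (simp only: mult_eq_0_iff) simp
      then show ?thesis using e by simp
    qed
    then show False using False by (auto simp: fun_eq_iff)
  qed
  then obtain i where i: "c i \<noteq> 0" by blast
  have ci: "c i \<in> fvec d2" using assms by (simp add: c_def)
  have "bij_betw (\<lambda>(y, h). (y + scale (- i) h, h)) (W \<times> W) (W \<times> W)"
    by (rule bij_betwI[where g = "\<lambda>(x, h). (x + scale i h, h)"]) (auto simp: add.assoc)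
  from sum.reindex_bij_betw[OF this, of "\<lambda>(x, h). add_char (?g x h)"]
  have "(\<Sum>(x, h)\<in>W \<times> W. add_char (?g x h)) = (\<Sum>(y, h)\<in>W \<times> W. add_char (?g (y + scale (- i) h) h))"
    by (simp add: case_prod_unfold)
  also have "\<dots> = (\<Sum>y\<in>W. \<Sum>h\<in>W. add_char (?g (y + scale (- i) h) h))"
    by (simp add: sum.cartesian_product)
  also have "norm \<dots> \<le> (\<Sum>y\<in>W. \<epsilon> * real (card W))"
  proof (rule sum_norm_le)
    fix y
    let ?l = "\<lambda>h. dot d1 \<beta> (L (scale (- i) h)) + dot d1 \<gamma> (L h)"
    let ?g' = "\<lambda>h. dot d1 \<beta> (L y) + ?l h + dot d2 \<xi>0 (q (y + scale (- i) h))
        + dot d2 \<xi>1 (q (y + scale (1 - i) h)) + dot d2 \<xi>2 (q (y + scale (2 - i) h))"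
    have eq: "?g (y + scale (- i) h) h = ?g' h" for h
    proof -
      have "scale (- i) h + h = scale (1 - i) h"
        using scale_left_distrib[of "- i" 1 h] by simp
      moreover have "scale (- i) h + scale 2 h = scale (2 - i) h"
        using scale_left_distrib[of "- i" 2 h] by simp
      ultimately show ?thesis by (simp only: L_add dot_simps add.assoc)
    qed
    note l = additive_pdeg_polar[of ?l]
    have l': "?l (x + z) = ?l x + ?l z" for x z
      by (simp only: scale_right_distrib L_add dot_simps add_ac)
    have const: "pdeg 3 (\<lambda>h::'w. k)" "polar (\<lambda>h::'w. k) u v = 0" for k :: 'f and u v
      by (simp_all add: numeral_3_eq_3 polar_def)
    have "norm (\<Sum>h\<in>W. add_char (?g' h)) \<le> \<epsilon> * real (card W)"
    proof (rule quadratic_sum_bound[OF ci i])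
      show "pdeg 3 ?g'"
        by (intro pdeg_add const(1) additive_pdeg_polar(1)[of ?l, OF l'] pdeg_dilate(1)[OF dot_q_pdeg] additive_pdeg_polar(1))
          (simp_all only: scale_right_distrib L_add dot_simps)
      fix u v
      have "polar ?g' u v = i\<^sup>2 * polar (\<lambda>x. dot d2 \<xi>0 (q x)) u v
          + (1 - i)\<^sup>2 * polar (\<lambda>x. dot d2 \<xi>1 (q x)) u v + (2 - i)\<^sup>2 * polar (\<lambda>x. dot d2 \<xi>2 (q x)) u v"
        unfolding polar_fun_add[of "\<lambda>h. dot d1 \<beta> (L y) + ?l h + dot d2 \<xi>0 (q (y + scale (- i) h))
            + dot d2 \<xi>1 (q (y + scale (1 - i) h))"]
          polar_fun_add[of "\<lambda>h. dot d1 \<beta> (L y) + ?l h + dot d2 \<xi>0 (q (y + scale (- i) h))"]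
          polar_fun_add[of "\<lambda>h. dot d1 \<beta> (L y) + ?l h"] polar_fun_add[of "\<lambda>h. dot d1 \<beta> (L y)"]
          pdeg_dilate(2)[OF dot_q_pdeg] const(2) l(2)[OF l']
        by simp
      also have "\<dots> = polar (\<lambda>x. dot d2 (c i) (q x)) u v"
        by (simp add: c_def polar_def algebra_simps)
      finally show "polar ?g' u v = polar (\<lambda>x. dot d2 (c i) (q x)) u v" .
    qed
    then show "norm (\<Sum>h\<in>W. add_char (?g (y + scale (- i) h) h)) \<le> \<epsilon> * real (card W)"
      by (simp only: eq)
  qed
  also have "\<dots> = \<epsilon> * real (card (W \<times> W))" by (simp add: card_cartesian_product)
  finally show ?thesis .
qed

end

section \<open>Averages over cosets and progressions\<close>

text \<open>Comparison with the integral of t^(-4/3), which is 3 over [1, \<infinity>). With x and z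
  the cube roots of n and n + 1, the step follows from 1 = z^3 - x^3 <= 3 z^2 (z - x).\<close>

lemma sum_inverse_four_thirds_le:
  "n \<ge> 1 \<Longrightarrow> (\<Sum>k=1..n. 1 / (real k powr (1/3)) ^ 4) \<le> 4 - 3 / real n powr (1/3)"
proof (induction n rule: dec_induct)
  case base
  then show ?case by simp
next
  case (step n)
  define x where "x = real n powr (1/3)"
  define z where "z = real (Suc n) powr (1/3)"
  have x0: "x > 0" and xz: "x \<le> z" using step by (auto simp: x_def z_def intro!: powr_mono2)
  have cube: "x ^ 3 = real n" "z ^ 3 = real n + 1"
    using step by (simp_all add: x_def z_def powr_powr flip: powr_numeral)
  have "1 = (z - x) * (z\<^sup>2 + z * x + x\<^sup>2)" using cube by (simp add: power2_eq_square power3_eq_cube algebra_simps)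
  also have "\<dots> \<le> (z - x) * (3 * z\<^sup>2)"
  proof (rule mult_left_mono)
    have "z * x \<le> z * z" "x * x \<le> z * z" using x0 xz by (intro mult_mono; simp)+
    then show "z\<^sup>2 + z * x + x\<^sup>2 \<le> 3 * z\<^sup>2" by (simp add: power2_eq_square)
  qed (use xz in simp)
  finally have "1 * (z * 1) \<le> ((z - x) * (3 * z\<^sup>2)) * (z * 1)" using x0 xz by (intro mult_right_mono) auto
  then have "x \<le> 3 * (z - x) * z ^ 3" using xz by (simp add: power2_eq_square power3_eq_cube mult_ac)
  then have "1 / z ^ 4 \<le> 3 / x - 3 / z"
    using x0 xz by (simp add: field_simps power3_eq_cube power4_eq_xxxx)
  then show ?case using step.IH step.hyps by (simp add: x_def z_def)
qed

text \<open>Removing the smallest term at each step bounds the \<open>k\<close>-th largest term by \<open>B k\<^sup>-\<^sup>4\<^sup>/\<^sup>3\<close>.\<close>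

lemma sum_fourth_powers_le:
  fixes c :: "'k \<Rightarrow> real"
  assumes "finite S" "B \<ge> 0"
    and small: "\<And>S'. S' \<subseteq> S \<Longrightarrow> S' \<noteq> {} \<Longrightarrow> \<exists>s\<in>S'. c s ^ 4 \<le> B / (real (card S') powr (1/3)) ^ 4"
  shows "(\<Sum>s\<in>S. c s ^ 4) \<le> 4 * B"
proof -
  have "S' \<subseteq> S \<Longrightarrow> card S' = n \<Longrightarrow> (\<Sum>s\<in>S'. c s ^ 4) \<le> B * (\<Sum>k=1..n. 1 / (real k powr (1/3)) ^ 4)" for S' n
  proof (induction n arbitrary: S')
    case 0
    then have "S' = {}" using assms(1) finite_subset by fastforce
    then show ?case by simp
  next
    case (Suc n)
    have fin: "finite S'" using Suc.prems assms(1) finite_subset by blast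
    obtain s where s: "s \<in> S'" "c s ^ 4 \<le> B / (real (card S') powr (1/3)) ^ 4"
      using small[OF Suc.prems(1)] Suc.prems(2) by force
    have "(\<Sum>s\<in>S' - {s}. c s ^ 4) \<le> B * (\<Sum>k=1..n. 1 / (real k powr (1/3)) ^ 4)"
      using Suc.prems s fin by (intro Suc.IH) auto
    then show ?case
      using s fin Suc.prems(2) by (simp add: sum.remove[of S' s] distrib_left)
  qed
  from this[of S "card S"] have "(\<Sum>s\<in>S. c s ^ 4) \<le> B * (\<Sum>k=1..card S. 1 / (real k powr (1/3)) ^ 4)" by simp
  also have "\<dots> \<le> B * 4"
  proof (intro mult_left_mono assms(2))
    show "(\<Sum>k=1..card S. 1 / (real k powr (1/3)) ^ 4) \<le> 4"
    proof (cases "card S \<ge> 1")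
      case True
      have "0 \<le> 3 / real (card S) powr (1/3)" by simp
      then show ?thesis using sum_inverse_four_thirds_le[OF True] by linarith
    qed (simp add: not_le)
  qed
  finally show ?thesis by simp
qed

section \<open>Normalized means over F^d\<close>

lemma fmean_add: "fmean d (\<lambda>b. f b + g b) = fmean d f + fmean d g"
  by (simp add: fmean_def sum.distrib add_divide_distrib)

lemma fmean_diff: "fmean d (\<lambda>b. f b - g b) = fmean d f - fmean d g"
  by (simp add: fmean_def sum_subtractf diff_divide_distrib)

lemma fmean_cmult: "fmean d (\<lambda>b. c * f b) = c * fmean d f"
  by (simp add: fmean_def sum_distrib_left)

lemma fmean_const: "fmean d (\<lambda>b :: nat \<Rightarrow> 'f::{field,finite}. c) = c"
  by (simp add: fmean_def card_fvec)

lemma fmean_mono: "(\<And>b. b \<in> fvec d \<Longrightarrow> f b \<le> g b) \<Longrightarrow> fmean d f \<le> fmean d g"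
  by (simp add: fmean_def divide_right_mono sum_mono)

lemma fmean_cong: "(\<And>b. b \<in> fvec d \<Longrightarrow> f b = g b) \<Longrightarrow> fmean d f = fmean d g"
  by (simp add: fmean_def)

lemma fmean_abs: "\<bar>fmean d f\<bar> \<le> fmean d (\<lambda>b. \<bar>f b\<bar>)"
  by (simp add: fmean_def abs_divide divide_right_mono)

lemma fmean_nonneg: "(\<And>b. b \<in> fvec d \<Longrightarrow> f b \<ge> 0) \<Longrightarrow> fmean d f \<ge> 0"
  by (simp add: fmean_def sum_nonneg)

lemma fmean_swap: "fmean d (\<lambda>a. fmean d' (\<lambda>b. f a b)) = fmean d' (\<lambda>b. fmean d (\<lambda>a. f a b))"
  unfolding fmean_def
  by (simp add: sum_divide_distrib[symmetric]) (subst sum.swap, simp add: mult.commute)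

lemma fmean_shift: "s \<in> fvec d \<Longrightarrow> fmean d (\<lambda>a. g (a + s)) = fmean d g"
  for s :: "nat \<Rightarrow> 'f::{field,finite}"
  using sum.reindex_bij_betw[OF bij_betw_add_fvec, of s d g] by (simp add: fmean_def)

text \<open>For fixed s the map a |-> a + k s is a translation, so every point of a random
  progression is uniformly distributed.\<close>

lemma fmean_progression:
  fixes g :: "(nat \<Rightarrow> 'f::{field,finite}) \<Rightarrow> real"
  shows "fmean d (\<lambda>a. fmean d (\<lambda>s. g (a + smul k s))) = fmean d g"
proof -
  have "fmean d (\<lambda>a. fmean d (\<lambda>s. g (a + smul k s))) = fmean d (\<lambda>s. fmean d (\<lambda>a. g (a + smul k s)))"
    by (rule fmean_swap)
  also have "\<dots> = fmean d (\<lambda>s :: nat \<Rightarrow> 'f. fmean d g)"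
  proof (rule fmean_cong)
    fix s :: "nat \<Rightarrow> 'f" assume "s \<in> fvec d"
    then show "fmean d (\<lambda>a. g (a + smul k s)) = fmean d g" by (intro fmean_shift smul_fvec)
  qed
  finally show ?thesis by (simp add: fmean_const)
qed

lemma fmean_ge_imp_ex:
  fixes f :: "(nat \<Rightarrow> 'f::{field,finite}) \<Rightarrow> real"
  assumes "fmean d f \<ge> c"
  shows "\<exists>b\<in>fvec d. f b \<ge> c"
proof (rule ccontr)
  assume "\<not> ?thesis"
  then have "(\<Sum>b\<in>fvec d. f b) < (\<Sum>b\<in>(fvec d :: (nat \<Rightarrow> 'f) set). c)"
    by (intro sum_strict_mono) (auto intro!: exI[of _ 0] zero_fvec simp: not_le)
  then have "fmean d f < c" by (simp add: fmean_def card_fvec divide_less_eq mult.commute)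
  then show False using assms by simp
qed

context prime_field_factor
begin

section \<open>Equidistribution on cosets of the common kernel of the linear phases and along
  progressions\<close>

lemma card_W_pos: "card W > 0"
  by (simp add: card_gt_0_iff)

text \<open>Equidistribution with \<epsilon> = 0: nontrivial linear characters sum to exactly 0
  because the linear phases are independent.\<close>

lemma card_coset:
  assumes "a \<in> fvec d1"
  shows "real (CARD('f) ^ d1) * real (card {x. L x = a}) = real (card W)"
proof -
  have "\<bar>real (card (fvec d1 :: (nat \<Rightarrow> 'f) set)) * real (card {x\<in>W. L x = a}) - real (card W)\<bar>
      \<le> real (card (fvec d1 :: (nat \<Rightarrow> 'f) set)) * 0 * real (card W)"
  proof (rule equidistribution_count[OF dual_pair_fvec _ _ _ _ assms])
    fix k :: "nat \<Rightarrow> 'f" assume k: "k \<in> fvec d1" "k \<noteq> 0"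
    then obtain h where h: "dot d1 k (L h) \<noteq> 0" using linear_nonzero by blast
    have "(\<Sum>x\<in>W. add_char (dot d1 k (L x))) = 0"
      by (rule sum_add_char_eq_0[OF prime card5 bij_add_w[of h] _ h]) (simp add: L_add)
    then show "norm (\<Sum>x\<in>W. add_char (dot d1 k (L x))) \<le> 0 * real (card W)" by simp
  qed auto
  then show ?thesis by (simp add: card_fvec)
qed

lemma card_coset_pos: "a \<in> fvec d1 \<Longrightarrow> card {x. L x = a} > 0"
  using card_coset[of a] card_W_pos by (intro Nat.gr0I) auto

definition coset_avg :: "('w \<Rightarrow> real) \<Rightarrow> (nat \<Rightarrow> 'f) \<Rightarrow> real" where
  "coset_avg g a = (\<Sum>x\<in>{x. L x = a}. g x) / real (card {x. L x = a})"

lemma fmean_coset_avg: "fmean d1 (coset_avg g) = average W g"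
proof -
  have "(\<Sum>a\<in>fvec d1. coset_avg g a) = (\<Sum>a\<in>fvec d1. (\<Sum>x\<in>{x\<in>W. L x = a}. g x) * (real (CARD('f) ^ d1) / real (card W)))"
  proof (rule sum.cong[OF refl])
    fix a :: "nat \<Rightarrow> 'f" assume a: "a \<in> fvec d1"
    have "real (CARD('f) ^ d1) / real (card W) = 1 / real (card {x. L x = a})"
      unfolding card_coset[OF a, symmetric] by simp
    then show "coset_avg g a = (\<Sum>x\<in>{x\<in>W. L x = a}. g x) * (real (CARD('f) ^ d1) / real (card W))"
      by (simp add: coset_avg_def)
  qed
  also have "\<dots> = (\<Sum>x\<in>W. g x) * (real (CARD('f) ^ d1) / real (card W))"
    unfolding sum_distrib_right[symmetric]
    by (subst sum.group) auto
  finally show ?thesis by (simp add: fmean_def average_def)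
qed

text \<open>Joint equidistribution of L and q, applied to a function supported on L = a. The factor
  |F|^(d1+d2) is the number of joint characters; it multiplies the mean of |H|, so the error is
  relative when H \<ge> 0.\<close>

lemma coset_equidistribution:
  assumes a: "a \<in> fvec d1"
  shows "\<bar>coset_avg (\<lambda>x. H (q x)) a - fmean d2 H\<bar> \<le> real (CARD('f) ^ (d1 + d2)) * \<epsilon> * fmean d2 (\<lambda>b. \<bar>H b\<bar>)"
proof -
  let ?A = "{x. L x = a}"
  let ?H = "\<lambda>(a', b). if a' = a then H b else 0"
  let ?D = "fvec d1 \<times> fvec d2 :: ((nat \<Rightarrow> 'f) \<times> (nat \<Rightarrow> 'f)) set"
  have cD: "real (card ?D) = real (CARD('f) ^ d1) * real (CARD('f) ^ d2)" by (simp add: card_cartesian_product card_fvec)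
  have E: "\<bar>real (card ?D) * (\<Sum>x\<in>W. ?H (L x, q x)) - real (card W) * (\<Sum>g\<in>?D. ?H g)\<bar>
      \<le> real (card ?D) * \<epsilon> * real (card W) * (\<Sum>g\<in>?D. \<bar>?H g\<bar>)"
  proof (rule equidistribution_sum[OF dual_pair_prod[OF dual_pair_fvec dual_pair_fvec]])
    fix k :: "(nat \<Rightarrow> 'f) \<times> (nat \<Rightarrow> 'f)" assume "k \<in> ?D" "k \<noteq> (0, 0)"
    then show "norm (\<Sum>x\<in>W. (case k of (k, k') \<Rightarrow> \<lambda>(g, g'). add_char (dot d1 k g) * add_char (dot d2 k' g')) (L x, q x))
      \<le> \<epsilon> * real (card W)"
      using single_character_sum by (cases k) auto
  qed (auto simp: \<epsilon>_nonneg)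
  have F1: "(\<Sum>x\<in>W. ?H (L x, q x)) = (\<Sum>x\<in>?A. H (q x))"
    by (simp add: sum.If_cases)
  have eq: "(\<Sum>(a', b)\<in>?D. if a' = a then H b else 0) = (\<Sum>b\<in>fvec d2. H b)" for H
    using a by (simp add: sum.cartesian_product[symmetric] sum.swap[of _ "fvec d2" "fvec d1"])
  have F2: "(\<Sum>g\<in>?D. \<bar>?H g\<bar>) = (\<Sum>b\<in>fvec d2. \<bar>H b\<bar>)"
    unfolding eq[of "\<lambda>b. \<bar>H b\<bar>", symmetric] by (intro sum.cong) auto
  have "\<bar>real (CARD('f) ^ d1) * (real (CARD('f) ^ d2) * (\<Sum>x\<in>?A. H (q x)) - real (card ?A) * (\<Sum>b\<in>fvec d2. H b))\<bar>
      \<le> real (CARD('f) ^ d1) * (real (CARD('f) ^ d1) * real (CARD('f) ^ d2) * \<epsilon> * real (card ?A) * (\<Sum>b\<in>fvec d2. \<bar>H b\<bar>))"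
    using E[unfolded F1 F2 eq cD card_coset[OF a, symmetric]] by (simp add: algebra_simps)
  then have 1: "\<bar>real (CARD('f) ^ d2) * (\<Sum>x\<in>?A. H (q x)) - real (card ?A) * (\<Sum>b\<in>fvec d2. H b)\<bar>
      \<le> real (CARD('f) ^ d1) * real (CARD('f) ^ d2) * \<epsilon> * real (card ?A) * (\<Sum>b\<in>fvec d2. \<bar>H b\<bar>)"
    unfolding abs_mult by simp
  have c: "real (card ?A) > 0" "real (CARD('f) ^ d2) > 0" using card_coset_pos[OF a] by auto
  have "coset_avg (\<lambda>x. H (q x)) a - fmean d2 H
      = (real (CARD('f) ^ d2) * (\<Sum>x\<in>?A. H (q x)) - real (card ?A) * (\<Sum>b\<in>fvec d2. H b)) / (real (card ?A) * real (CARD('f) ^ d2))"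
    using c by (auto simp: coset_avg_def fmean_def diff_divide_distrib card_gt_0_iff)
  also have "\<bar>\<dots>\<bar> \<le> (real (CARD('f) ^ d1) * real (CARD('f) ^ d2) * \<epsilon> * real (card ?A) * (\<Sum>b\<in>fvec d2. \<bar>H b\<bar>)) / (real (card ?A) * real (CARD('f) ^ d2))"
    using divide_right_mono[OF 1, of "real (card ?A) * real (CARD('f) ^ d2)"]
    by (simp only: abs_divide abs_mult abs_of_nat of_nat_0_le_iff mult_nonneg_nonneg simp_thms)
  also have "\<dots> = real (CARD('f) ^ (d1 + d2)) * \<epsilon> * fmean d2 (\<lambda>b. \<bar>H b\<bar>)"
    using c by (auto simp: fmean_def power_add field_simps card_gt_0_iff)
  finally show ?thesis .
qed

text \<open>The vanishing third difference of q with all three increments equal to h.\<close>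

lemma q_cubic: "q (x + scale 3 h) = q x - smul 3 (q (x + h)) + smul 3 (q (x + scale 2 h))"
proof
  fix j
  have "scale 2 h = h + h" "scale 3 h = h + h + h"
    using scale_left_distrib[of 1 1 h] scale_left_distrib[of 2 1 h] by simp_all
  moreover have "q (x + h + h + h) j - q (x + h + h) j - q (x + h + h) j - q (x + h + h) j
        + q (x + h) j + q (x + h) j + q (x + h) j - q x j = 0"
    using q_pdeg[of j] unfolding pdeg_3_iff by blast
  ultimately show "q (x + scale 3 h) j = (q x - smul 3 (q (x + h)) + smul 3 (q (x + scale 2 h))) j"
    by (simp add: smul_def algebra_simps)
qed

text \<open>H has five arguments because L at every point is determined by \<open>L x\<close> and
  \<open>L h\<close>, and the fourth value of q by \<open>q_cubic\<close>. The exponent 2 d1 + 3 d2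
  counts the characters, and H \<ge> 0 makes the error relative to the model count m.\<close>

lemma progression_equidistribution:
  fixes H :: "(nat \<Rightarrow> 'f) \<Rightarrow> (nat \<Rightarrow> 'f) \<Rightarrow> (nat \<Rightarrow> 'f) \<Rightarrow> (nat \<Rightarrow> 'f) \<Rightarrow> (nat \<Rightarrow> 'f) \<Rightarrow> real"
  assumes H: "\<And>a s b0 b1 b2. H a s b0 b1 b2 \<ge> 0"
  defines "m \<equiv> fmean d1 (\<lambda>a. fmean d1 (\<lambda>s.
      (\<Sum>b0\<in>fvec d2. \<Sum>b1\<in>fvec d2. \<Sum>b2\<in>fvec d2. H a s b0 b1 b2) / real (CARD('f) ^ d2) ^ 3))"
  shows "\<bar>average (W \<times> W) (\<lambda>(x, h). H (L x) (L h) (q x) (q (x + h)) (q (x + scale 2 h))) - m\<bar>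
     \<le> real (CARD('f) ^ (2 * d1 + 3 * d2)) * \<epsilon> * m"
proof -
  let ?D = "fvec d1 \<times> fvec d1 \<times> fvec d2 \<times> fvec d2 \<times> fvec d2 ::
     ((nat \<Rightarrow> 'f) \<times> (nat \<Rightarrow> 'f) \<times> (nat \<Rightarrow> 'f) \<times> (nat \<Rightarrow> 'f) \<times> (nat \<Rightarrow> 'f)) set"
  let ?H = "\<lambda>(a, s, b0, b1, b2). H a s b0 b1 b2"
  let ?\<Theta> = "\<lambda>(x, h). (L x, L h, q x, q (x + h), q (x + scale 2 h))"
  let ?S = "\<Sum>z\<in>W \<times> W. ?H (?\<Theta> z)" and ?G = "\<Sum>g\<in>?D. ?H g"
  have cD: "real (card ?D) = real (CARD('f) ^ (2 * d1 + 3 * d2))"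
    by (simp add: card_cartesian_product card_fvec power_add power2_eq_square power3_eq_cube power_mult mult.commute)
  have 1: "\<bar>real (card ?D) * ?S - real (card (W \<times> W)) * ?G\<bar>
      \<le> real (card ?D) * \<epsilon> * real (card (W \<times> W)) * (\<Sum>g\<in>?D. \<bar>?H g\<bar>)"
  proof (rule equidistribution_sum[OF dual_pair_prod[OF dual_pair_fvec dual_pair_prod[OF dual_pair_fvec
          dual_pair_prod[OF dual_pair_fvec dual_pair_prod[OF dual_pair_fvec dual_pair_fvec]]]]])
    fix k assume k: "k \<in> ?D" "k \<noteq> (0, 0, 0, 0, 0)"
    obtain \<beta> \<gamma> x0 x1 x2 where kk: "k = (\<beta>, \<gamma>, x0, x1, x2)" by (cases k) auto
    show "norm (\<Sum>x\<in>W \<times> W. (case k of (k, k') \<Rightarrow> \<lambda>(g, g'). add_char (dot d1 k g) *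
        (case k' of (k, k') \<Rightarrow> \<lambda>(g, g'). add_char (dot d1 k g) *
        (case k' of (k, k') \<Rightarrow> \<lambda>(g, g'). add_char (dot d2 k g) *
        (case k' of (k, k') \<Rightarrow> \<lambda>(g, g'). add_char (dot d2 k g) * add_char (dot d2 k' g')) g') g') g') (?\<Theta> x))
      \<le> \<epsilon> * real (card (W \<times> W))"
      using pair_character_sum[of \<beta> \<gamma> x0 x1 x2] k unfolding kk
      by (simp add: case_prod_unfold add_char_add[OF prime] mult.assoc)
  qed (auto simp: \<epsilon>_nonneg finite_prod)
  have G: "(\<Sum>g\<in>?D. \<bar>?H g\<bar>) = ?G"
    using H by (intro sum.cong) auto
  have m: "m = ?G / real (card ?D)"
    unfolding cD m_def fmean_def
    by (simp add: sum.cartesian_product case_prod_unfold sum_divide_distrib[symmetric] power_add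
        power2_eq_square power3_eq_cube power_mult mult.commute)
  have c: "real (card ?D) > 0" "real (card (W \<times> W)) > 0"
    unfolding cD using card_W_pos by (auto simp: card_cartesian_product)
  have "average (W \<times> W) (\<lambda>(x, h). H (L x) (L h) (q x) (q (x + h)) (q (x + scale 2 h)))
      = ?S / real (card (W \<times> W))"
    by (simp add: average_def case_prod_unfold)
  moreover have "\<bar>S / n - G / k\<bar> \<le> k * \<epsilon> * (G / k)"
    if "\<bar>k * S - n * G\<bar> \<le> k * \<epsilon> * n * G" "k > 0" "n > 0" for S G k n :: real
  proof -
    have "S / n - G / k = (k * S - n * G) / (k * n)" using that by (simp add: field_simps)
    also have "\<bar>\<dots>\<bar> = \<bar>k * S - n * G\<bar> / (k * n)" using that by (simp add: abs_mult)
    also have "\<dots> \<le> (k * \<epsilon> * n * G) / (k * n)"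
      by (rule divide_right_mono[OF that(1)]) (use that in simp)
    also have "\<dots> = k * \<epsilon> * (G / k)" using that by simp
    finally show ?thesis .
  qed
  note this[OF 1[unfolded G] c]
  ultimately show ?thesis
    unfolding cD[symmetric] m by (simp only:)
qed

section \<open>Fourier coefficients on a single coset and the energy bound\<close>

lemma fmean_hat:
  fixes G :: "(nat \<Rightarrow> 'f) \<Rightarrow> real"
  shows "(\<Sum>b\<in>fvec d. of_real (G b) * add_char (dot d \<xi> b)) = of_nat (CARD('f) ^ d) * cnj (hat d G \<xi>)"
  by (simp add: hat_def add_char_minus[OF prime])

lemma sum_norm_trig_poly:
  fixes h :: "(nat \<Rightarrow> 'f) \<Rightarrow> complex"
  assumes S: "S \<subseteq> fvec d"
  shows "(\<Sum>b\<in>fvec d. (norm (\<Sum>\<xi>\<in>S. h \<xi> * add_char (dot d \<xi> b)))\<^sup>2)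
     = real (CARD('f) ^ d) * (\<Sum>\<xi>\<in>S. (norm (h \<xi>))\<^sup>2)"
proof -
  let ?N = "of_nat (CARD('f) ^ d) :: complex"
  have fS: "finite S" using S finite_subset finite_fvec by blast
  have comm: "dot d b (\<xi> - \<zeta>) = dot d \<xi> b - dot d \<zeta> b" for b \<xi> \<zeta> :: "nat \<Rightarrow> 'f"
    by (simp add: dot_commute[of d b])
  have "complex_of_real (\<Sum>b\<in>fvec d. (norm (\<Sum>\<xi>\<in>S. h \<xi> * add_char (dot d \<xi> b)))\<^sup>2)
      = (\<Sum>b\<in>fvec d. \<Sum>\<xi>\<in>S. \<Sum>\<zeta>\<in>S. h \<xi> * cnj (h \<zeta>) * add_char (dot d b (\<xi> - \<zeta>)))"
    unfolding of_real_sum complex_norm_square cnj_sum sum_product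
    by (intro sum.cong refl)
      (simp add: add_char_minus[OF prime, symmetric] add_char_add[OF prime, symmetric] comm mult_ac del: dot_simps)
  also have "\<dots> = (\<Sum>\<xi>\<in>S. \<Sum>\<zeta>\<in>S. h \<xi> * cnj (h \<zeta>) * (\<Sum>b\<in>fvec d. add_char (dot d b (\<xi> - \<zeta>))))"
    by (subst sum.swap, rule sum.cong[OF refl], subst sum.swap) (simp add: sum_distrib_left)
  also have "\<dots> = (\<Sum>\<xi>\<in>S. \<Sum>\<zeta>\<in>S. if \<xi> = \<zeta> then h \<xi> * cnj (h \<xi>) * ?N else 0)"
  proof (intro sum.cong refl)
    fix \<xi> \<zeta> assume "\<xi> \<in> S" "\<zeta> \<in> S"
    then have "\<xi> - \<zeta> \<in> fvec d" using S by (intro diff_fvec) auto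
    from sum_add_char_dot[OF prime card5 this]
    show "h \<xi> * cnj (h \<zeta>) * (\<Sum>b\<in>fvec d. add_char (dot d b (\<xi> - \<zeta>)))
        = (if \<xi> = \<zeta> then h \<xi> * cnj (h \<xi>) * ?N else 0)" by simp
  qed
  also have "\<dots> = complex_of_real (real (CARD('f) ^ d) * (\<Sum>\<xi>\<in>S. (norm (h \<xi>))\<^sup>2))"
    using fS unfolding of_real_mult of_real_sum complex_norm_square sum_distrib_left
    by (simp add: mult_ac)
  finally show ?thesis by (simp only: of_real_eq_iff)
qed

text \<open>
  The trigonometric polynomial \<open>T\<close> built from the Fourier coefficients in \<open>S\<close> and \<open>0\<close> is constant on the
  pieces on which all phases \<open>\<xi> \<cdot> q\<close>, \<open>\<xi> \<in> S\<close>, are constant, so Bessel's inequality may be applied to the averages of \<open>f\<close> over pieces.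
\<close>

lemma spectrum_bound:
  fixes G :: "(nat \<Rightarrow> 'f) \<Rightarrow> real" and f :: "'w \<Rightarrow> real"
  assumes a: "a \<in> fvec d1" and S: "S \<subseteq> fvec d2 - {0}"
    and G: "\<And>b. 0 \<le> G b \<and> G b \<le> 1" and f0: "\<And>x. f x \<ge> 0" and fG: "\<And>x. L x = a \<Longrightarrow> f x = G (q x)"
    and M: "\<And>x V. subspace V \<Longrightarrow> dim {x. L x = 0} \<le> (card S + 1) * (dim V + card S) + 2 * card S \<Longrightarrow>
      (\<Sum>y\<in>V. f (x + y)) \<le> M * real (card V)"
  shows "(fmean d2 G)\<^sup>2 + (\<Sum>\<xi>\<in>S. (norm (hat d2 G \<xi>))\<^sup>2)
     \<le> M * coset_avg f a + real (CARD('f) ^ (d1 + d2)) * \<epsilon> * (3 * real (CARD('f) ^ d2) ^ 2)"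
proof -
  let ?A = "{x. L x = a}" and ?N = "real (CARD('f) ^ d2)"
  \<comment> \<open>Frequency 0 puts the squared mean on the left, where it later cancels the
    leading part of M times the coset average.\<close>
  let ?S = "insert 0 S"
  have S': "?S \<subseteq> fvec d2" using S by auto
  have fS: "finite S" using S finite_subset finite_fvec by blast
  have cS: "real (card ?S) \<le> ?N"
    using card_mono[OF finite_fvec S'] by (simp add: card_fvec del: of_nat_power)
  define T where "T b = (\<Sum>\<xi>\<in>?S. hat d2 G \<xi> * add_char (dot d2 \<xi> b))" for b
  \<comment> \<open>This is |G|^2 - |G - T|^2. Its mean is 2 \<sigma> - \<sigma>, since the
    correlation of G with T and the mean square of T both equal \<sigma>.\<close>
  define H where "H b = 2 * G b * Re (T b) - (norm (T b))\<^sup>2" for b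
  define \<sigma> where "\<sigma> = (\<Sum>\<xi>\<in>?S. (norm (hat d2 G \<xi>))\<^sup>2)"
  have \<sigma>: "\<sigma> = (fmean d2 G)\<^sup>2 + (\<Sum>\<xi>\<in>S. (norm (hat d2 G \<xi>))\<^sup>2)"
    unfolding \<sigma>_def using fS S by (subst sum.insert) (auto simp: hat_0[OF prime card5])
  have N0: "?N > 0" "?N \<ge> 1" using card5 by auto
  have "complex_of_real (\<Sum>b\<in>fvec d2. G b * Re (T b)) = of_real (Re (\<Sum>b\<in>fvec d2. of_real (G b) * T b))"
    by simp
  also have "(\<Sum>b\<in>fvec d2. of_real (G b) * T b)
      = (\<Sum>\<xi>\<in>?S. hat d2 G \<xi> * (\<Sum>b\<in>fvec d2. of_real (G b) * add_char (dot d2 \<xi> b)))"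
    unfolding T_def sum_distrib_left by (subst sum.swap) (simp only: mult.left_commute)
  also have "\<dots> = of_real (?N * \<sigma>)"
    unfolding fmean_hat \<sigma>_def of_real_mult of_real_sum complex_norm_square sum_distrib_left
    by (simp add: mult_ac)
  finally have GT: "(\<Sum>b\<in>fvec d2. G b * Re (T b)) = ?N * \<sigma>" by (simp only: of_real_eq_iff Re_complex_of_real)
  have TT: "(\<Sum>b\<in>fvec d2. (norm (T b))\<^sup>2) = ?N * \<sigma>"
    unfolding T_def \<sigma>_def by (rule sum_norm_trig_poly[OF S'])
  have "(\<Sum>b\<in>fvec d2. H b) = 2 * (\<Sum>b\<in>fvec d2. G b * Re (T b)) - (\<Sum>b\<in>fvec d2. (norm (T b))\<^sup>2)"
    by (simp add: H_def sum_subtractf sum_distrib_left mult.assoc)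
  then have "(\<Sum>b\<in>fvec d2. H b) = ?N * \<sigma>" unfolding GT TT by simp
  then have mH: "fmean d2 H = \<sigma>" using N0 by (simp add: fmean_def)
  have hat1: "norm (hat d2 G \<xi>) \<le> 1" for \<xi>
  proof -
    have "norm (hat d2 G \<xi>) \<le> fmean d2 G" using G by (intro norm_hat_le[OF prime card5]) auto
    also have "\<dots> \<le> fmean d2 (\<lambda>b :: nat \<Rightarrow> 'f. 1)" using G by (intro fmean_mono) auto
    finally show ?thesis by (simp add: fmean_const)
  qed
  have T1: "norm (T b) \<le> ?N" for b
  proof -
    have "norm (T b) \<le> (\<Sum>\<xi>\<in>?S. 1)"
      unfolding T_def by (rule sum_norm_le) (simp add: norm_mult hat1)
    also have "\<dots> = real (card ?S)" by simp
    finally show ?thesis using cS by (rule order_trans)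
  qed
  \<comment> \<open>A crude bound that costs |F|^(2 d2) in the error; the total exponent d1 + 3 d2
    is still within 3 (d1 + d2).\<close>
  have H1: "\<bar>H b\<bar> \<le> 3 * ?N\<^sup>2" for b
  proof -
    have "\<bar>G b * Re (T b)\<bar> \<le> 1 * ?N"
      unfolding abs_mult using G[of b] T1[of b] abs_Re_le_cmod[of "T b"] by (intro mult_mono) auto
    moreover have "(norm (T b))\<^sup>2 \<le> ?N\<^sup>2" using T1 by (intro power_mono) auto
    moreover have "?N \<le> ?N\<^sup>2" using N0 by (simp add: power2_eq_square)
    moreover have "0 \<le> (norm (T b))\<^sup>2" by simp
    ultimately show ?thesis unfolding H_def mult.assoc by linarith
  qed
  have "fmean d2 (\<lambda>b. \<bar>H b\<bar>) \<le> fmean d2 (\<lambda>b :: nat \<Rightarrow> 'f. 3 * ?N\<^sup>2)" using H1 by (intro fmean_mono)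
  then have mHa: "fmean d2 (\<lambda>b. \<bar>H b\<bar>) \<le> 3 * ?N\<^sup>2" by (simp only: fmean_const)
  have "\<bar>coset_avg (\<lambda>x. H (q x)) a - \<sigma>\<bar> \<le> real (CARD('f) ^ (d1 + d2)) * \<epsilon> * fmean d2 (\<lambda>b. \<bar>H b\<bar>)"
    using coset_equidistribution[OF a, of H] by (simp only: mH)
  also have "\<dots> \<le> real (CARD('f) ^ (d1 + d2)) * \<epsilon> * (3 * ?N\<^sup>2)"
    using mHa \<epsilon>_nonneg by (intro mult_left_mono) auto
  finally have near: "\<sigma> \<le> coset_avg (\<lambda>x. H (q x)) a + real (CARD('f) ^ (d1 + d2)) * \<epsilon> * (3 * ?N\<^sup>2)"
    by linarith
  have L0: "L 0 = 0" using L_scale[of 0 0] by (simp add: smul_def fun_eq_iff)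
  have U: "subspace {x. L x = 0}" by (rule subspaceI_add) (auto simp: L0 L_add)
  obtain P where P: "\<And>x. subspace (P x)" "\<And>x. P x \<subseteq> {x. L x = 0}"
    "\<And>x. dim {x. L x = 0} \<le> (card S + 1) * (dim (P x) + card S) + 2 * card S"
    "\<And>x y. y \<in> P x \<Longrightarrow> P (x + y) = P x"
    "\<And>\<xi> x y. \<xi> \<in> S \<Longrightarrow> y \<in> P x \<Longrightarrow> dot d2 \<xi> (q (x + y)) = dot d2 \<xi> (q x)"
    using quadratic_pieces[OF U fS, of "\<lambda>\<xi> x. dot d2 \<xi> (q x)"] dot_q_pdeg by metis
  have "(\<Sum>x\<in>?A. 2 * f x * Re (T (q x)) - (norm (T (q x)))\<^sup>2) \<le> M * (\<Sum>x\<in>?A. f x)"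
  proof (rule piece_bessel[of P])
    fix x y assume y: "y \<in> P x"
    show "T (q (x + y)) = T (q x)"
      unfolding T_def using P(5)[OF _ y] by (intro sum.cong) auto
    show "x + y \<in> ?A" if "x \<in> ?A" using that P(2)[of x] y by (auto simp: L_add)
  next
    show "(\<Sum>y\<in>P x. f (x + y)) \<le> M * real (card (P x))" for x by (rule M[OF P(1) P(3)])
  qed (use P f0 in auto)
  moreover have "(\<Sum>x\<in>?A. H (q x)) = (\<Sum>x\<in>?A. 2 * f x * Re (T (q x)) - (norm (T (q x)))\<^sup>2)"
    by (intro sum.cong) (auto simp: H_def fG)
  ultimately have "coset_avg (\<lambda>x. H (q x)) a \<le> M * coset_avg f a"
    unfolding coset_avg_def by (simp add: divide_right_mono)
  then show ?thesis using near \<sigma> by linarith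
qed

text \<open>The coset, spectrum and progression estimates lose |F| to the powers d1 + d2, d1 + 3 d2
  and 2 d1 + 3 d2, all at most 3 (d1 + d2).\<close>

lemma power3_D_bounds:
  assumes "real (CARD('f) ^ (3 * (d1 + d2))) * \<epsilon> \<le> \<delta>"
  shows "real (CARD('f) ^ (d1 + d2)) * \<epsilon> \<le> \<delta>"
    "real (CARD('f) ^ (d1 + d2)) * \<epsilon> * (3 * real (CARD('f) ^ d2) ^ 2) \<le> 3 * \<delta>"
    "real (CARD('f) ^ (2 * d1 + 3 * d2)) * \<epsilon> \<le> \<delta>"
proof -
  have mono: "real (CARD('f) ^ n) * \<epsilon> \<le> \<delta>" if "n \<le> 3 * (d1 + d2)" for n
  proof -
    have "CARD('f) ^ n \<le> CARD('f) ^ (3 * (d1 + d2))"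
      using that card5 by (intro power_increasing) auto
    then have "real (CARD('f) ^ n) * \<epsilon> \<le> real (CARD('f) ^ (3 * (d1 + d2))) * \<epsilon>"
      using \<epsilon>_nonneg by (intro mult_right_mono) (simp only: of_nat_le_iff)
    then show ?thesis using assms by linarith
  qed
  show "real (CARD('f) ^ (d1 + d2)) * \<epsilon> \<le> \<delta>" "real (CARD('f) ^ (2 * d1 + 3 * d2)) * \<epsilon> \<le> \<delta>"
    by (rule mono; simp)+
  have "CARD('f) ^ (d1 + d2) * (CARD('f) ^ d2) ^ 2 = CARD('f) ^ (d1 + d2 + d2 * 2)"
    by (simp flip: power_mult power_add)
  then have "real (CARD('f) ^ (d1 + d2)) * real (CARD('f) ^ d2) ^ 2 = real (CARD('f) ^ (d1 + d2 + d2 * 2))"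
    by (metis of_nat_mult of_nat_power)
  moreover have "real (CARD('f) ^ (d1 + d2 + d2 * 2)) * \<epsilon> \<le> \<delta>" by (rule mono) simp
  ultimately show "real (CARD('f) ^ (d1 + d2)) * \<epsilon> * (3 * real (CARD('f) ^ d2) ^ 2) \<le> 3 * \<delta>"
    by (simp only: mult.assoc mult.left_commute[of _ 3] mult.commute[of \<epsilon>]) (simp only: mult.assoc[symmetric])
qed

text \<open>Failure of alternative (i) bounds coset averages only from above. But the deviations u
  have mean 0, and u <= c implies |u| <= 2 c - u, whose mean is 2 c.\<close>

lemma fmean_coset_deviation:
  assumes "\<And>a. a \<in> fvec d1 \<Longrightarrow> coset_avg g a \<le> average W g + c" "c \<ge> 0"
  shows "fmean d1 (\<lambda>a. \<bar>coset_avg g a - average W g\<bar>) \<le> 2 * c"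
proof -
  have "fmean d1 (\<lambda>a. \<bar>coset_avg g a - average W g\<bar>)
      \<le> fmean d1 (\<lambda>a. 2 * c - (coset_avg g a - average W g))"
    using assms by (intro fmean_mono) (smt (verit))
  then show ?thesis by (simp add: fmean_diff fmean_const fmean_coset_avg)
qed

lemma energy_le_fmean:
  fixes G :: "(nat \<Rightarrow> 'f) \<Rightarrow> real"
  assumes G: "\<And>b. 0 \<le> G b \<and> G b \<le> 1"
  shows "energy d G \<le> fmean d G" and "(\<Sum>\<xi>\<in>fvec d. (norm (hat d G \<xi>))\<^sup>2) \<le> 1" and "fmean d G \<le> 1"
proof -
  have "fmean d G \<le> fmean d (\<lambda>b :: nat \<Rightarrow> 'f. 1)" using G by (intro fmean_mono) auto
  then show m1: "fmean d G \<le> 1" by (simp add: fmean_const)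
  have hat1: "norm (hat d G \<xi>) \<le> 1" for \<xi>
    using norm_hat_le[OF prime card5, of G d \<xi>] G m1 by force
  have "energy d G \<le> (\<Sum>\<xi>\<in>fvec d - {0}. (norm (hat d G \<xi>))\<^sup>2)"
    unfolding energy_def using hat1 by (intro sum_mono power_decreasing) auto
  also have "\<dots> \<le> (\<Sum>\<xi>\<in>fvec d. (norm (hat d G \<xi>))\<^sup>2)"
    by (intro sum_mono2) auto
  also have 2: "\<dots> \<le> fmean d G"
    unfolding hat_parseval[OF prime card5] using G by (intro fmean_mono) (simp add: power2_eq_square mult_left_le)
  finally show "energy d G \<le> fmean d G" .
  show "(\<Sum>\<xi>\<in>fvec d. (norm (hat d G \<xi>))\<^sup>2) \<le> 1" using 2 m1 by linarith
qed

lemma ex_le_average: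
  fixes c :: "'k \<Rightarrow> real"
  assumes "finite S" "S \<noteq> {}" "(\<Sum>s\<in>S. c s) \<le> C"
  shows "\<exists>s\<in>S. c s \<le> C / real (card S)"
proof (rule ccontr)
  assume "\<not> ?thesis"
  then have "(\<Sum>s\<in>S. C / real (card S)) < (\<Sum>s\<in>S. c s)"
    using assms by (intro sum_strict_mono) (auto simp: not_le)
  then show False using assms by simp
qed

text \<open>If no piece has a density increment, any K nonzero frequencies include one whose fourth
  power is at most \<kappa>^4 / (2^8 K^(4/3)); \<open>sum_fourth_powers_le\<close> then loses only a
  factor 4.\<close>

lemma energy_bound:
  fixes G :: "(nat \<Rightarrow> 'f) \<Rightarrow> real" and f :: "'w \<Rightarrow> real"
  assumes a: "a \<in> fvec d1" and \<kappa>: "0 < \<kappa>" "\<kappa> \<le> 1"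
    and G: "\<And>b. 0 \<le> G b \<and> G b \<le> 1" and f0: "\<And>x. f x \<ge> 0" and fG: "\<And>x. L x = a \<Longrightarrow> f x = G (q x)"
    and eps: "real (CARD('f) ^ (3 * (d1 + d2))) * \<epsilon> \<le> \<kappa>\<^sup>2 / 2 ^ 20"
    and c: "coset_avg f a \<le> 7 * \<kappa>" and \<alpha>: "\<alpha> - coset_avg f a \<le> 7 * \<kappa> / 2 ^ 10"
    and inc: "\<And>K x V. 0 < K \<Longrightarrow> real K \<le> (16 / \<kappa> ^ 4) ^ 3 \<Longrightarrow> subspace V \<Longrightarrow>
      dim {x. L x = 0} \<le> (K + 1) * (dim V + K) + 2 * K \<Longrightarrow>
      (\<Sum>y\<in>V. f (x + y)) \<le> (\<alpha> + \<kappa> * real K powr (1/3) / 2 ^ 10) * real (card V)"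
  shows "energy d2 G \<le> \<kappa> ^ 4 / 2 ^ 6"
proof -
  let ?c = "coset_avg f a" and ?X = "fmean d2 G" and ?h = "\<lambda>\<xi>. norm (hat d2 G \<xi>)"
  note eps' = power3_D_bounds[OF eps]
  have X: "0 \<le> ?X" "?X \<le> 1" using G energy_le_fmean(3)[where G = G, OF G] by (auto intro: fmean_nonneg)
  have c0: "?c \<ge> 0" by (simp add: coset_avg_def f0 sum_nonneg)
  have "coset_avg (\<lambda>x. G (q x)) a = ?c"
    unfolding coset_avg_def by (intro arg_cong2[where f = "(/)"] sum.cong) (auto simp: fG)
  then have "\<bar>?c - ?X\<bar> \<le> real (CARD('f) ^ (d1 + d2)) * \<epsilon> * fmean d2 (\<lambda>b. \<bar>G b\<bar>)"
    using coset_equidistribution[OF a, of G] by simp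
  also have "fmean d2 (\<lambda>b. \<bar>G b\<bar>) = ?X" using G by (intro fmean_cong) auto
  also have "real (CARD('f) ^ (d1 + d2)) * \<epsilon> * ?X \<le> \<kappa>\<^sup>2 / 2 ^ 20 * 1"
    using eps'(1) X by (intro mult_mono) auto
  finally have cX: "\<bar>?c - ?X\<bar> \<le> \<kappa>\<^sup>2 / 2 ^ 20" by simp
  have k2: "\<kappa>\<^sup>2 \<le> 1" using \<kappa> by (simp add: power_le_one)
  have "?c\<^sup>2 - ?X\<^sup>2 = (?c - ?X) * (?c + ?X)" by (simp add: power2_eq_square algebra_simps)
  also have "\<dots> \<le> (\<kappa>\<^sup>2 / 2 ^ 20) * 3"
  proof -
    have "\<kappa>\<^sup>2 / 2 ^ 20 \<le> 1" using k2 by simp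
    then have "?c + ?X \<le> 3" "0 \<le> ?c + ?X" using cX X c0 by linarith+
    moreover have "?c - ?X \<le> \<kappa>\<^sup>2 / 2 ^ 20" using cX by linarith
    ultimately show ?thesis by (intro mult_mono) simp_all
  qed
  finally have cX2: "?c\<^sup>2 - ?X\<^sup>2 \<le> 3 * \<kappa>\<^sup>2 / 2 ^ 20" by simp
  have "(\<Sum>\<xi>\<in>fvec d2 - {0}. ?h \<xi> ^ 4) \<le> 4 * (\<kappa> ^ 4 / 2 ^ 8)"
  proof (rule sum_fourth_powers_le)
    fix S' assume S': "S' \<subseteq> fvec d2 - {0 :: nat \<Rightarrow> 'f}" "S' \<noteq> {}"
    define K where "K = card S'"
    define t where "t = real K powr (1/3)"
    have fin: "finite S'" using S'(1) finite_subset finite_Diff finite_fvec by blast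
    then have K: "K > 0" using S' by (simp add: K_def card_gt_0_iff)
    have t3: "t ^ 3 = real K" using K by (simp add: t_def powr_powr flip: powr_numeral)
    have t1: "t \<ge> 1" using K by (simp add: t_def ge_one_powr_ge_zero)
    show "\<exists>\<xi>\<in>S'. ?h \<xi> ^ 4 \<le> \<kappa> ^ 4 / 2 ^ 8 / (real (card S') powr (1/3)) ^ 4"
    proof (cases "real K \<le> (16 / \<kappa> ^ 4) ^ 3")
      case True
      have "?X\<^sup>2 + (\<Sum>\<xi>\<in>S'. (?h \<xi>)\<^sup>2) \<le> (\<alpha> + \<kappa> * t / 2 ^ 10) * ?c +
          real (CARD('f) ^ (d1 + d2)) * \<epsilon> * (3 * real (CARD('f) ^ d2) ^ 2)"
        using inc[OF K True] unfolding K_def t_def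
        by (intro spectrum_bound[where G = G and f = f, OF a S'(1)] G f0 fG) auto
      \<comment> \<open>The 6 is 3 + 3: the error term of \<open>spectrum_bound\<close> and the
        replacement of the squared model mean by the squared coset average.\<close>
      then have "(\<Sum>\<xi>\<in>S'. (?h \<xi>)\<^sup>2) \<le> (\<alpha> + \<kappa> * t / 2 ^ 10) * ?c - ?c\<^sup>2 + 6 * \<kappa>\<^sup>2 / 2 ^ 20"
        using eps'(2) cX2 by (simp add: field_simps)
      also have "(\<alpha> + \<kappa> * t / 2 ^ 10) * ?c - ?c\<^sup>2 = (\<alpha> - ?c + \<kappa> * t / 2 ^ 10) * ?c"
        by (simp add: power2_eq_square algebra_simps)
      \<comment> \<open>Here 8 = 7 + 1, from the deviation of \<alpha> and the allowed increment,
        using t >= 1. The result 56 / 2^10 leaves room for the error below 64 / 2^10 = 1 /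
        2^4.\<close>
      also have "\<dots> \<le> (8 * \<kappa> * t / 2 ^ 10) * (7 * \<kappa>)"
      proof (rule order_trans[OF mult_right_mono[OF _ c0] mult_left_mono[OF c]])
        have "\<kappa> \<le> \<kappa> * t" using \<kappa> t1 by simp
        then show "\<alpha> - ?c + \<kappa> * t / 2 ^ 10 \<le> 8 * \<kappa> * t / 2 ^ 10" using \<alpha> by (simp add: field_simps)
        show "0 \<le> 8 * \<kappa> * t / 2 ^ 10" using \<kappa> t1 by simp
      qed
      also have "\<dots> + 6 * \<kappa>\<^sup>2 / 2 ^ 20 \<le> \<kappa>\<^sup>2 * t / 2 ^ 4"
      proof -
        have le: "\<kappa>\<^sup>2 \<le> \<kappa>\<^sup>2 * t" using \<kappa> t1 by simp
        have eq: "(8 * \<kappa> * t / 2 ^ 10) * (7 * \<kappa>) = 56 * (\<kappa>\<^sup>2 * t) / 2 ^ 10" by (simp add: power2_eq_square)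
        have "56 * z / 2 ^ 10 + 6 * y / 2 ^ 20 \<le> z / 2 ^ 4" if "y \<le> z" "0 \<le> y" for y z :: real
          using that by simp
        from this[OF le] show ?thesis unfolding eq by simp
      qed
      finally have "(\<Sum>\<xi>\<in>S'. (?h \<xi>)\<^sup>2) \<le> \<kappa>\<^sup>2 * t / 2 ^ 4" by simp
      from ex_le_average[OF fin S'(2) this] obtain \<xi> where \<xi>: "\<xi> \<in> S'" "(?h \<xi>)\<^sup>2 \<le> \<kappa>\<^sup>2 * t / 2 ^ 4 / t ^ 3"
        unfolding K_def[symmetric] t3 by blast
      have "\<kappa>\<^sup>2 * t / 2 ^ 4 / t ^ 3 = \<kappa>\<^sup>2 / 2 ^ 4 / t\<^sup>2"
        using t1 by (simp add: power2_eq_square power3_eq_cube)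
      with \<xi> have "((?h \<xi>)\<^sup>2)\<^sup>2 \<le> (\<kappa>\<^sup>2 / 2 ^ 4 / t\<^sup>2)\<^sup>2" by (intro power_mono) auto
      then have "?h \<xi> ^ 4 \<le> \<kappa> ^ 4 / 2 ^ 8 / t ^ 4"
        by (simp add: power_divide flip: power_mult)
      then show ?thesis using \<xi>(1) by (auto simp: t_def K_def)
    next
      \<comment> \<open>Now t >= 16 / \<kappa>^4, so Parseval alone suffices: the least fourth power
        is at most 1 / t^6, and 1 / t^2 <= \<kappa>^8 / 2^8.\<close>
      case False
      have "(\<Sum>\<xi>\<in>S'. (?h \<xi>)\<^sup>2) \<le> (\<Sum>\<xi>\<in>fvec d2. (?h \<xi>)\<^sup>2)"
        using S'(1) by (intro sum_mono2) auto
      then have "(\<Sum>\<xi>\<in>S'. (?h \<xi>)\<^sup>2) \<le> 1" using energy_le_fmean(2)[where G = G and d = d2, OF G] by linarith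
      from ex_le_average[OF fin S'(2) this] obtain \<xi> where \<xi>: "\<xi> \<in> S'" "(?h \<xi>)\<^sup>2 \<le> 1 / t ^ 3"
        unfolding K_def[symmetric] t3 by blast
      have "(16 / \<kappa> ^ 4) ^ 3 \<le> t ^ 3" using False t3 by simp
      then have "16 / \<kappa> ^ 4 \<le> t" by (rule power_mono_iff[THEN iffD1, rotated -1]) (use t1 \<kappa> in auto)
      then have "16 \<le> \<kappa> ^ 4 * t" using \<kappa> by (simp add: field_simps)
      then have t16: "1 / t \<le> \<kappa> ^ 4 / 16" using t1 by (simp add: field_simps)
      have "((?h \<xi>)\<^sup>2)\<^sup>2 \<le> (1 / t ^ 3)\<^sup>2" using \<xi> by (intro power_mono) auto
      then have "?h \<xi> ^ 4 \<le> (1 / t)\<^sup>2 / t ^ 4"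
        by (simp add: power_divide flip: power_mult power_add)
      also have "(1 / t)\<^sup>2 \<le> (\<kappa> ^ 4 / 16)\<^sup>2" using t16 t1 by (intro power_mono) auto
      also have "(\<kappa> ^ 4 / 16)\<^sup>2 \<le> \<kappa> ^ 4 / 2 ^ 8"
        using power_decreasing[of 4 8 \<kappa>] \<kappa> by (simp add: power_divide flip: power_mult)
      finally have "?h \<xi> ^ 4 \<le> \<kappa> ^ 4 / 2 ^ 8 / t ^ 4" using t1 by (simp add: divide_right_mono)
      then show ?thesis using \<xi>(1) by (auto simp: t_def K_def)
    qed
  qed (use \<kappa> in auto)
  then show ?thesis by (simp add: energy_def)
qed

end

section \<open>The density increment\<close>

lemma prod4_diff_le:
  fixes x0 x1 x2 x3 y0 y1 y2 y3 B :: real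
  assumes "0 \<le> x0" "x0 \<le> B" "0 \<le> x1" "x1 \<le> B" "0 \<le> x2" "x2 \<le> B" "0 \<le> x3" "x3 \<le> B"
    and "0 \<le> y0" "y0 \<le> B" "0 \<le> y1" "y1 \<le> B" "0 \<le> y2" "y2 \<le> B" "0 \<le> y3" "y3 \<le> B"
  shows "\<bar>x0 * x1 * x2 * x3 - y0 * y1 * y2 * y3\<bar>
    \<le> B ^ 3 * (\<bar>x0 - y0\<bar> + \<bar>x1 - y1\<bar> + \<bar>x2 - y2\<bar> + \<bar>x3 - y3\<bar>)"
proof -
  have B3: "\<bar>(u - v) * a * b * c\<bar> \<le> B ^ 3 * \<bar>u - v\<bar>"
    if "0 \<le> a" "a \<le> B" "0 \<le> b" "b \<le> B" "0 \<le> c" "c \<le> B" for u v a b c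
  proof -
    have "a * b * c \<le> B * B * B" using that by (intro mult_mono) auto
    then have "\<bar>u - v\<bar> * (a * b * c) \<le> \<bar>u - v\<bar> * B ^ 3"
      by (intro mult_left_mono) (auto simp: power3_eq_cube)
    then show ?thesis using that by (simp add: abs_mult mult_ac)
  qed
  have tri: "\<bar>s1 + s2 + s3 + s4\<bar> \<le> t1 + t2 + t3 + t4"
    if "\<bar>s1\<bar> \<le> t1" "\<bar>s2\<bar> \<le> t2" "\<bar>s3\<bar> \<le> t3" "\<bar>s4\<bar> \<le> t4" for s1 s2 s3 s4 t1 t2 t3 t4 :: real
    using that by linarith
  have eq: "x0 * x1 * x2 * x3 - y0 * y1 * y2 * y3 = (x0 - y0) * x1 * x2 * x3 + (x1 - y1) * y0 * x2 * x3
      + (x2 - y2) * y0 * y1 * x3 + (x3 - y3) * y0 * y1 * y2"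
    by (simp add: algebra_simps)
  show ?thesis
    unfolding eq distrib_left using assms by (intro tri B3)
qed

context prime_field_factor
begin

text \<open>\<open>cubic_relation_estimate\<close> is applied to each progression of cosets a, a +
  s, a + 2 s, a + 3 s. Each of the four points is uniform on average, so only mean energies
  survive.\<close>

lemma model_progression_count:
  fixes F0 F1 F2 F3 :: "(nat \<Rightarrow> 'f) \<Rightarrow> (nat \<Rightarrow> 'f) \<Rightarrow> real"
  defines "mid \<equiv> fmean d1 (\<lambda>a. fmean d1 (\<lambda>s. fmean d2 (F0 a) * fmean d2 (F1 (a + s))
      * fmean d2 (F2 (a + smul 2 s)) * fmean d2 (F3 (a + smul 3 s))))"
  shows "\<bar>fmean d1 (\<lambda>a. fmean d1 (\<lambda>s. (\<Sum>b0\<in>fvec d2. \<Sum>b1\<in>fvec d2. \<Sum>b2\<in>fvec d2. F0 a b0 * F1 (a + s) b1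
       * F2 (a + smul 2 s) b2 * F3 (a + smul 3 s) (b0 - smul 3 b1 + smul 3 b2)) / real (CARD('f) ^ d2) ^ 3)) - mid\<bar>
     \<le> (fmean d1 (\<lambda>a. energy d2 (F0 a)) + fmean d1 (\<lambda>a. energy d2 (F1 a)) + fmean d1 (\<lambda>a. energy d2 (F2 a))
       + fmean d1 (\<lambda>a. energy d2 (F3 a))) / 4"
    (is "\<bar>fmean d1 (\<lambda>a. fmean d1 (\<lambda>s. ?T a s)) - mid\<bar> \<le> _")
proof -
  let ?P = "\<lambda>a s. fmean d2 (F0 a) * fmean d2 (F1 (a + s))
      * fmean d2 (F2 (a + smul 2 s)) * fmean d2 (F3 (a + smul 3 s))"
  let ?E = "\<lambda>a s. (energy d2 (F0 a) + energy d2 (F1 (a + s)) + energy d2 (F2 (a + smul 2 s))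
      + energy d2 (F3 (a + smul 3 s))) / 4"
  have "\<bar>fmean d1 (\<lambda>a. fmean d1 (\<lambda>s. ?T a s)) - mid\<bar> = \<bar>fmean d1 (\<lambda>a. fmean d1 (\<lambda>s. ?T a s - ?P a s))\<bar>"
    by (simp only: mid_def fmean_diff)
  also have "\<dots> \<le> fmean d1 (\<lambda>a. \<bar>fmean d1 (\<lambda>s. ?T a s - ?P a s)\<bar>)" by (rule fmean_abs)
  also have "\<dots> \<le> fmean d1 (\<lambda>a. fmean d1 (\<lambda>s. \<bar>?T a s - ?P a s\<bar>))"
    by (rule fmean_mono) (rule fmean_abs)
  also have "\<dots> \<le> fmean d1 (\<lambda>a. fmean d1 (\<lambda>s. ?E a s))"
    by (rule fmean_mono, rule fmean_mono) (rule cubic_relation_estimate[OF prime card5])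
  also have "\<dots> = (fmean d1 (\<lambda>a. energy d2 (F0 a)) + fmean d1 (\<lambda>a. energy d2 (F1 a)) + fmean d1 (\<lambda>a. energy d2 (F2 a))
       + fmean d1 (\<lambda>a. energy d2 (F3 a))) / 4"
  proof -
    have "smul 1 s = s" for s :: "nat \<Rightarrow> 'f" by (simp add: smul_def)
    then have shifts: "fmean d1 (\<lambda>a. fmean d1 (\<lambda>s. energy d2 (F1 (a + s)))) = fmean d1 (\<lambda>a. energy d2 (F1 a))"
      using fmean_progression[of d1 "\<lambda>a. energy d2 (F1 a)" 1] by simp
    show ?thesis
      unfolding divide_inverse mult.commute[of _ "inverse 4"] fmean_cmult fmean_add fmean_const shifts
        fmean_progression[of d1 "\<lambda>a. energy d2 (F2 a)"] fmean_progression[of d1 "\<lambda>a. energy d2 (F3 a)"] ..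
  qed
  finally show ?thesis .
qed

text \<open>The argument in coordinates, with \<eta> = \<kappa>^4 and the two alternatives negated
  in \<open>coset_inc\<close> and \<open>inc\<close>. Of the defect \<kappa>^4, equidistribution
  takes at most 1 percent and varying coset densities at most 36, so 63 percent must come from the
  mean of the four energies.\<close>

lemma no_counterexample:
  fixes f :: "nat \<Rightarrow> 'w \<Rightarrow> real" and F :: "nat \<Rightarrow> (nat \<Rightarrow> 'f) \<Rightarrow> (nat \<Rightarrow> 'f) \<Rightarrow> real"
  assumes \<kappa>: "0 < \<kappa>" "\<kappa> \<le> 1"
    and F: "\<And>i a b. 0 \<le> F i a b \<and> F i a b \<le> 1" and f: "\<And>i x. i \<le> 3 \<Longrightarrow> f i x = F i (L x) (q x)"
    and eps: "real (CARD('f) ^ (3 * (d1 + d2))) * \<epsilon> \<le> \<kappa>\<^sup>2 / 2 ^ 20"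
    and big: "\<bar>four_ap_average scale (f 0) (f 1) (f 2) (f 3)
        - average W (f 0) * average W (f 1) * average W (f 2) * average W (f 3)\<bar> \<ge> \<kappa> ^ 4"
    and small: "\<And>i. i \<le> 3 \<Longrightarrow> average W (f i) \<le> 6 * \<kappa>"
    and coset_inc: "\<And>i a. i \<le> 3 \<Longrightarrow> a \<in> fvec d1 \<Longrightarrow> coset_avg (f i) a \<le> average W (f i) + \<kappa> ^ 8 / 2 ^ 13"
    and inc: "\<And>i K x V. i \<le> 3 \<Longrightarrow> 0 < K \<Longrightarrow> real K \<le> (16 / \<kappa> ^ 4) ^ 3 \<Longrightarrow> subspace V \<Longrightarrow>
      dim {x. L x = 0} \<le> (K + 1) * (dim V + K) + 2 * K \<Longrightarrow>
      (\<Sum>y\<in>V. f i (x + y)) \<le> (average W (f i) + \<kappa> * real K powr (1/3) / 2 ^ 10) * real (card V)"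
  shows False
proof -
  define \<alpha> where "\<alpha> i = average W (f i)" for i
  define X where "X i a = fmean d2 (F i a)" for i a
  define En where "En i = fmean d1 (\<lambda>a. energy d2 (F i a))" for i
  define \<tau> where "\<tau> = \<kappa>\<^sup>2 / 2 ^ 20"
  note eps' = power3_D_bounds[OF eps[folded \<tau>_def]]
  have kpow: "\<kappa> ^ m \<le> \<kappa> ^ n" if "n \<le> m" for m n using \<kappa> that by (intro power_decreasing) auto
  have kpos: "\<kappa> ^ n > 0" for n using \<kappa> by simp
  have \<tau>: "0 \<le> \<tau>" "\<tau> \<le> 1 / 2 ^ 20" using kpow[of 0 2] by (auto simp: \<tau>_def divide_right_mono)
  have f01: "0 \<le> f i x \<and> f i x \<le> 1" if "i \<le> 3" for i x using F f that by simp
  have \<alpha>0: "0 \<le> \<alpha> i" "\<alpha> i \<le> 6 * \<kappa>" if "i \<le> 3" for i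
    using small[OF that] f01[OF that] by (auto simp: \<alpha>_def average_def sum_nonneg)
  have X0: "0 \<le> X i a" "X i a \<le> 1" for i a
    using F energy_le_fmean(3)[of "F i a"] by (auto simp: X_def intro: fmean_nonneg)
  have c0: "0 \<le> coset_avg (f i) a" if "i \<le> 3" for i a
    using f01[OF that] by (simp add: coset_avg_def sum_nonneg)
  have cX: "\<bar>coset_avg (f i) a - X i a\<bar> \<le> \<tau> * X i a" if "i \<le> 3" "a \<in> fvec d1" for i a
  proof -
    have "coset_avg (f i) a = coset_avg (\<lambda>x. F i a (q x)) a"
      unfolding coset_avg_def by (intro arg_cong2[where f = "(/)"] sum.cong) (auto simp: f that)
    moreover have "fmean d2 (\<lambda>b. \<bar>F i a b\<bar>) = X i a" unfolding X_def using F by (intro fmean_cong) auto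
    ultimately have "\<bar>coset_avg (f i) a - X i a\<bar> \<le> real (CARD('f) ^ (d1 + d2)) * \<epsilon> * X i a"
      using coset_equidistribution[OF that(2), of "F i a"] by (simp add: X_def)
    also have "\<dots> \<le> \<tau> * X i a" using eps'(1) X0 by (intro mult_right_mono) auto
    finally show ?thesis .
  qed
  \<comment> \<open>The density bound 6 \<kappa> plus the excess allowed by \<open>coset_inc\<close>
    stays below 7 \<kappa>, also after passing to the model densities \<open>X\<close>.\<close>
  have c7: "coset_avg (f i) a \<le> 7 * \<kappa> \<and> X i a \<le> 7 * \<kappa>" if "i \<le> 3" "a \<in> fvec d1" for i a
  proof -
    have "coset_avg (f i) a \<le> 6 * \<kappa> + \<kappa> / 2 ^ 13"
      using coset_inc[OF that] \<alpha>0(2)[OF that(1)] kpow[of 1 8] by (simp add: \<alpha>_def)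
    moreover have "X i a \<le> coset_avg (f i) a + 1 / 2 ^ 20 * X i a"
      using cX[OF that] mult_right_mono[OF \<tau>(2) X0(1)[of i a]] by linarith
    ultimately show ?thesis using \<kappa> by simp
  qed
  have dev: "fmean d1 (\<lambda>a. \<bar>coset_avg (f i) a - \<alpha> i\<bar>) \<le> \<kappa> ^ 8 / 2 ^ 12" if "i \<le> 3" for i
    using fmean_coset_deviation[of "f i" "\<kappa> ^ 8 / 2 ^ 13"] coset_inc[OF that] kpos[of 8]
    by (simp add: \<alpha>_def)
  have devX: "fmean d1 (\<lambda>a. \<bar>X i a - \<alpha> i\<bar>) \<le> 8 * \<kappa> ^ 3 / 2 ^ 20 + \<kappa> ^ 8 / 2 ^ 12" if "i \<le> 3" for i
  proof -
    have "fmean d1 (\<lambda>a. \<bar>X i a - \<alpha> i\<bar>) \<le> fmean d1 (\<lambda>a. 7 * \<kappa> ^ 3 / 2 ^ 20 + \<bar>coset_avg (f i) a - \<alpha> i\<bar>)"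
    proof (rule fmean_mono)
      fix a :: "nat \<Rightarrow> 'f" assume a: "a \<in> fvec d1"
      have "\<tau> * X i a \<le> \<tau> * (7 * \<kappa>)" using c7[OF that a] \<tau> by (intro mult_left_mono) auto
      also have "\<dots> = 7 * \<kappa> ^ 3 / 2 ^ 20" by (simp add: \<tau>_def power2_eq_square power3_eq_cube)
      finally show "\<bar>X i a - \<alpha> i\<bar> \<le> 7 * \<kappa> ^ 3 / 2 ^ 20 + \<bar>coset_avg (f i) a - \<alpha> i\<bar>"
        using cX[OF that a] by linarith
    qed
    also have "\<dots> = 7 * \<kappa> ^ 3 / 2 ^ 20 + fmean d1 (\<lambda>a. \<bar>coset_avg (f i) a - \<alpha> i\<bar>)"
      by (simp only: fmean_add fmean_const)
    also have "\<dots> \<le> 8 * \<kappa> ^ 3 / 2 ^ 20 + \<kappa> ^ 8 / 2 ^ 12" 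
      by (intro add_mono dev[OF that] divide_right_mono mult_right_mono) (use \<kappa> in auto)
    finally show ?thesis .
  qed
  let ?P = "\<lambda>a s. X 0 a * X 1 (a + s) * X 2 (a + smul 2 s) * X 3 (a + smul 3 s)"
  define mid where "mid = fmean d1 (\<lambda>a. fmean d1 (\<lambda>s. ?P a s))"
  define pr where "pr = \<alpha> 0 * \<alpha> 1 * \<alpha> 2 * \<alpha> 3"
  have midP: "\<bar>mid - pr\<bar> \<le> 36 / 100 * \<kappa> ^ 4"
  proof -
    let ?d = "\<lambda>i a. \<bar>X i a - \<alpha> i\<bar>"
    have "\<bar>mid - pr\<bar> = \<bar>fmean d1 (\<lambda>a. fmean d1 (\<lambda>s. ?P a s - pr))\<bar>"
      by (simp only: mid_def fmean_diff fmean_const)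
    also have "\<dots> \<le> fmean d1 (\<lambda>a. \<bar>fmean d1 (\<lambda>s. ?P a s - pr)\<bar>)" by (rule fmean_abs)
    also have "\<dots> \<le> fmean d1 (\<lambda>a. fmean d1 (\<lambda>s. \<bar>?P a s - pr\<bar>))"
      by (rule fmean_mono) (rule fmean_abs)
    also have "\<dots> \<le> fmean d1 (\<lambda>a. fmean d1 (\<lambda>s. (7 * \<kappa>) ^ 3 *
        (?d 0 a + ?d 1 (a + s) + ?d 2 (a + smul 2 s) + ?d 3 (a + smul 3 s))))"
    proof (rule fmean_mono, rule fmean_mono)
      fix a s :: "nat \<Rightarrow> 'f" assume "a \<in> fvec d1" "s \<in> fvec d1"
      then show "\<bar>?P a s - pr\<bar> \<le> (7 * \<kappa>) ^ 3 * (?d 0 a + ?d 1 (a + s) + ?d 2 (a + smul 2 s) + ?d 3 (a + smul 3 s))"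
        unfolding pr_def using \<alpha>0[of 0] \<alpha>0[of 1] \<alpha>0[of 2] \<alpha>0[of 3] \<kappa>
        by (intro prod4_diff_le X0 c7[THEN conjunct2]) auto
    qed
    also have "\<dots> = (7 * \<kappa>) ^ 3 * (fmean d1 (?d 0) + fmean d1 (?d 1) + fmean d1 (?d 2) + fmean d1 (?d 3))"
    proof -
      have "smul 1 s = s" for s :: "nat \<Rightarrow> 'f" by (simp add: smul_def)
      then have shift1: "fmean d1 (\<lambda>a. fmean d1 (\<lambda>s. ?d 1 (a + s))) = fmean d1 (?d 1)"
        using fmean_progression[of d1 "?d 1" 1] by simp
      show ?thesis
        unfolding fmean_cmult fmean_add fmean_const shift1 fmean_progression[of d1 "?d 2"] fmean_progression[of d1 "?d 3"] ..
    qed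
    also have "\<dots> \<le> (7 * \<kappa>) ^ 3 * (4 * (8 * \<kappa> ^ 3 / 2 ^ 20 + \<kappa> ^ 8 / 2 ^ 12))"
      using devX[of 0] devX[of 1] devX[of 2] devX[of 3] \<kappa> by (intro mult_left_mono) auto
    \<comment> \<open>The second coefficient, about 0.335, is 7^3 * 4 * 2 / 2^13: three factors of
      at most 7 \<kappa>, four functions, and the doubling in
      \<open>fmean_coset_deviation\<close>.\<close>
    also have "\<dots> = 10976 / 2 ^ 20 * \<kappa> ^ 6 + 1372 / 2 ^ 12 * \<kappa> ^ 11"
      by (simp add: power_mult_distrib field_simps flip: power_add)
    also have "\<dots> \<le> 10976 / 2 ^ 20 * \<kappa> ^ 4 + 1372 / 2 ^ 12 * \<kappa> ^ 4"
      by (intro add_mono mult_left_mono kpow) auto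
    also have "\<dots> \<le> 36 / 100 * \<kappa> ^ 4" using kpos[of 4] by simp
    finally show ?thesis .
  qed
  define H where "H a s b0 b1 b2 = F 0 a b0 * F 1 (a + s) b1 * F 2 (a + smul 2 s) b2
      * F 3 (a + smul 3 s) (b0 - smul 3 b1 + smul 3 b2)" for a s b0 b1 b2
  define m where "m = fmean d1 (\<lambda>a. fmean d1 (\<lambda>s.
      (\<Sum>b0\<in>fvec d2. \<Sum>b1\<in>fvec d2. \<Sum>b2\<in>fvec d2. H a s b0 b1 b2) / real (CARD('f) ^ d2) ^ 3))"
  define \<Lambda> where "\<Lambda> = four_ap_average scale (f 0) (f 1) (f 2) (f 3)"
  have H0: "H a s b0 b1 b2 \<ge> 0" for a s b0 b1 b2 using F by (simp add: H_def)
  have m0: "m \<ge> 0" unfolding m_def using H0 by (intro fmean_nonneg divide_nonneg_nonneg sum_nonneg) auto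
  have "\<Lambda> = average (W \<times> W) (\<lambda>(x, h). H (L x) (L h) (q x) (q (x + h)) (q (x + scale 2 h)))"
    unfolding \<Lambda>_def four_ap_average_def H_def by (simp add: f L_add L_scale q_cubic[symmetric])
  then have "\<bar>\<Lambda> - m\<bar> \<le> real (CARD('f) ^ (2 * d1 + 3 * d2)) * \<epsilon> * m"
    unfolding m_def using progression_equidistribution[of H, OF H0] by (simp only:)
  also have "\<dots> \<le> 1 / 2 ^ 20 * m" using eps'(3) \<tau> m0 by (intro mult_right_mono) auto
  finally have \<Lambda>m: "\<bar>\<Lambda> - m\<bar> \<le> 1 / 2 ^ 20 * m" .
  have "0 \<le> pr" unfolding pr_def by (intro mult_nonneg_nonneg \<alpha>0) auto
  moreover have "pr \<le> 6 * \<kappa> * (6 * \<kappa>) * (6 * \<kappa>) * (6 * \<kappa>)"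
    unfolding pr_def by (intro mult_mono mult_nonneg_nonneg \<alpha>0) (use \<kappa> in auto)
  ultimately have pr: "0 \<le> pr" "pr \<le> 1296 * \<kappa> ^ 4" by (simp_all add: power4_eq_xxxx)
  have "\<bar>\<Lambda> - pr\<bar> \<ge> \<kappa> ^ 4" using big by (simp add: \<Lambda>_def pr_def \<alpha>_def)
  \<comment> \<open>A relative error of 2^(-20) costs less than 1 percent of \<kappa>^4, because
    \<open>pr\<close> is at most 1296 \<kappa>^4.\<close>
  then have "\<bar>m - pr\<bar> \<ge> 99 / 100 * \<kappa> ^ 4" using \<Lambda>m pr m0 kpos[of 4] by (simp add: abs_if split: if_splits)
  moreover have "\<bar>m - mid\<bar> \<le> (En 0 + En 1 + En 2 + En 3) / 4"
    unfolding m_def mid_def H_def En_def X_def by (rule model_progression_count)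
  ultimately have "(En 0 + En 1 + En 2 + En 3) / 4 \<ge> 63 / 100 * \<kappa> ^ 4" using midP by linarith
  moreover have "z \<le> 0" if "63 / 100 * z \<le> (e0 + e1 + e2 + e3) / 4"
    "e0 < z / 2" "e1 < z / 2" "e2 < z / 2" "e3 < z / 2" for z e0 e1 e2 e3 :: real
    using that by simp
  ultimately have "\<not> (En 0 < \<kappa> ^ 4 / 2 \<and> En 1 < \<kappa> ^ 4 / 2 \<and> En 2 < \<kappa> ^ 4 / 2 \<and> En 3 < \<kappa> ^ 4 / 2)"
    using kpos[of 4] by (meson not_le)
  then have "\<exists>i\<in>{0, 1, 2, 3}. En i \<ge> \<kappa> ^ 4 / 2" by (auto simp: not_less)
  then obtain i where "i \<in> {0, 1, 2, 3}" and i2: "En i \<ge> \<kappa> ^ 4 / 2" by blast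
  then have i: "i \<le> 3" by auto
  \<comment> \<open>The penalty selects one coset on which the energy is large and the density is
    nearly average at once. Its mean is at most \<kappa>^8 / 4 <= \<kappa>^4 / 4, half of the
    available energy.\<close>
  have "fmean d1 (\<lambda>a. energy d2 (F i a) - 2 ^ 10 * \<bar>coset_avg (f i) a - \<alpha> i\<bar>) \<ge> \<kappa> ^ 4 / 4"
    unfolding fmean_diff fmean_cmult En_def[symmetric] using i2 dev[OF i] kpow[of 4 8] by simp
  from fmean_ge_imp_ex[OF this] obtain a where a: "a \<in> fvec d1"
    "energy d2 (F i a) - 2 ^ 10 * \<bar>coset_avg (f i) a - \<alpha> i\<bar> \<ge> \<kappa> ^ 4 / 4" by blast
  have e7: "energy d2 (F i a) \<le> 7 * \<kappa>"
    using energy_le_fmean(1)[of "F i a" d2] F c7[OF i a(1)] by (auto simp: X_def)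
  have "energy d2 (F i a) \<le> \<kappa> ^ 4 / 2 ^ 6"
  proof (rule energy_bound[where f = "f i" and \<alpha> = "\<alpha> i", OF a(1) \<kappa> F _ _ eps])
    show "f i x \<ge> 0" for x using f01 i by blast
    show "L x = a \<Longrightarrow> f i x = F i a (q x)" for x using f i by blast
    show "coset_avg (f i) a \<le> 7 * \<kappa>" using c7 i a by blast
    \<comment> \<open>The penalty cannot exceed the energy, so the deviation is at most 2^(-10)
      times the energy, which \<open>e7\<close> bounds.\<close>
    show "\<alpha> i - coset_avg (f i) a \<le> 7 * \<kappa> / 2 ^ 10"
    proof -
      have "\<alpha> i - c \<le> y / 2 ^ 10" if "e - 2 ^ 10 * \<bar>c - \<alpha> i\<bar> \<ge> z / 4" "e \<le> y" "z > 0" for c e y z :: real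
        using that by (simp add: abs_if split: if_splits)
      from this[OF a(2) e7 kpos] show ?thesis .
    qed
    fix K x V assume "0 < K" "real K \<le> (16 / \<kappa> ^ 4) ^ 3" "subspace V"
      "dim {x. L x = 0} \<le> (K + 1) * (dim V + K) + 2 * K"
    from inc[OF i this]
    show "(\<Sum>y\<in>V. f i (x + y)) \<le> (\<alpha> i + \<kappa> * real K powr (1/3) / 2 ^ 10) * real (card V)"
      unfolding \<alpha>_def .
  qed
  moreover have "z \<le> 0" if "e - 2 ^ 10 * \<bar>u\<bar> \<ge> z / 4" "e \<le> z / 2 ^ 6" for e u z :: real
    using that by (simp add: abs_if split: if_splits)
  ultimately show False using a(2) kpos[of 4] by (meson not_le)
qed

end

section \<open>From circle-valued phases to coordinates\<close>

text \<open>The isomorphism n |-> n / |F| of F with the |F|-torsion of the circle; it carries scalar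
  multiplication to \<open>torsion_scale\<close>, so phases can be traded for field-valued
  maps.\<close>

definition circle_embed :: "'f::field \<Rightarrow> circle" where
  "circle_embed c = torsion_scale c (abs_circle (1 / real CARD('f)))"

context
  assumes prime: "prime CARD('f::{field,finite})"
begin

lemma circle_mult_abs: "circle_mult n (abs_circle x) = abs_circle (of_nat n * x)"
  by (rule circle_mult.abs_eq)

lemma circle_embed_of_nat: "circle_embed (of_nat n :: 'f) = abs_circle (real n / real CARD('f))"
proof -
  have p0: "real CARD('f) > 0" using prime prime_gt_0_nat by simp
  have "abs_circle (1 / real CARD('f)) \<in> torsion_circle TYPE('f)"
    using p0 by (simp add: torsion_circle_def circle_mult_abs zero_circle_def circle.abs_eq_iff)
  then show ?thesis
    by (simp add: circle_embed_def torsion_scale_of_nat[OF prime] circle_mult_abs)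
qed

lemma obtain_of_nat: obtains n where "(c :: 'f) = of_nat n"
  using of_nat_surj_prime_card[OF prime, of c] by metis

lemma circle_embed_add: "circle_embed (a + b :: 'f) = circle_embed a + circle_embed b"
proof -
  obtain m n where mn: "a = of_nat m" "b = of_nat n" using obtain_of_nat by metis
  have "circle_embed (of_nat (m + n) :: 'f) = abs_circle (real m / real CARD('f)) + abs_circle (real n / real CARD('f))"
    unfolding circle_embed_of_nat by (simp add: plus_circle.abs_eq add_divide_distrib)
  then show ?thesis by (simp add: mn circle_embed_of_nat)
qed

lemma circle_embed_0: "circle_embed (0 :: 'f) = 0"
  using circle_embed_add[of 0 0] by simp

lemma circle_embed_diff: "circle_embed (a - b :: 'f) = circle_embed a - circle_embed b"
  using circle_embed_add[of "a - b" b] by (simp add: algebra_simps)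

lemma circle_embed_sum: "circle_embed (\<Sum>i\<in>I. g i :: 'f) = (\<Sum>i\<in>I. circle_embed (g i))"
  by (induction I rule: infinite_finite_induct) (simp_all add: circle_embed_0 circle_embed_add)

lemma circle_embed_eq_0: "circle_embed (c :: 'f) = 0 \<longleftrightarrow> c = 0"
proof
  assume c: "circle_embed c = 0"
  obtain n where n: "c = of_nat n" using obtain_of_nat by metis
  have p0: "real CARD('f) > 0" using prime prime_gt_0_nat by simp
  from c have "real n / real CARD('f) \<in> \<int>"
    by (simp add: n circle_embed_of_nat zero_circle_def circle.abs_eq_iff)
  then obtain k :: int where "real n / real CARD('f) = of_int k" by (auto elim: Ints_cases)
  then have "real n = of_int k * real CARD('f)" using p0 by (simp add: field_simps)
  then have "int n = k * int CARD('f)" by (metis of_int_eq_iff of_int_mult of_int_of_nat_eq)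
  then have "CARD('f) dvd n" by (metis dvd_triv_right int_dvd_int_iff)
  then show "c = 0" by (simp add: n of_nat_eq_0_iff_char_dvd CHAR_eq_CARD[OF prime])
qed (simp add: circle_embed_0)

lemma circle_embed_eq_iff: "circle_embed (a :: 'f) = circle_embed b \<longleftrightarrow> a = b"
  using circle_embed_eq_0[of "a - b"] by (simp add: circle_embed_diff)

lemma circle_embed_surj:
  assumes "t \<in> torsion_circle TYPE('f)"
  shows "\<exists>c :: 'f. circle_embed c = t"
proof -
  let ?p = "CARD('f)"
  have p0: "real ?p > 0" "int ?p > 0" using prime prime_gt_0_nat by simp_all
  obtain x where x: "t = abs_circle x" using Quotient_abs_rep[OF Quotient_circle] by metis
  have "real ?p * x \<in> \<int>"
    using assms by (simp add: torsion_circle_def x circle_mult_abs zero_circle_def circle.abs_eq_iff)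
  then obtain k :: int where k: "real ?p * x = of_int k" by (auto elim: Ints_cases)
  define n where "n = nat (k mod int ?p)"
  have n: "real n = of_int (k mod int ?p)" using p0 by (simp add: n_def)
  have "of_int k = of_int (k div int ?p) * real ?p + real n"
    unfolding n by (metis div_mult_mod_eq of_int_add of_int_mult of_int_of_nat_eq)
  then have "x = of_int (k div int ?p) + real n / real ?p"
    using k p0 by (simp add: field_simps)
  then have "real n / real ?p - x = - of_int (k div int ?p)" by simp
  then have "real n / real ?p - x \<in> \<int>" by (metis Ints_minus Ints_of_int)
  then have "circle_embed (of_nat n :: 'f) = t" by (simp add: circle_embed_of_nat x circle.abs_eq_iff)
  then show ?thesis by blast
qed

lemma circle_embed_torsion: "circle_embed (c :: 'f) \<in> torsion_circle TYPE('f)"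
proof -
  obtain n where n: "c = of_nat n" using obtain_of_nat by metis
  have "real CARD('f) > 0" using prime prime_gt_0_nat by simp
  then show ?thesis
    by (simp add: n circle_embed_of_nat torsion_circle_def circle_mult_abs zero_circle_def circle.abs_eq_iff)
qed

lemma torsion_scale_circle_embed: "torsion_scale c (circle_embed (d :: 'f)) = circle_embed (c * d)"
proof -
  obtain m n where mn: "c = of_nat m" "d = of_nat n" using obtain_of_nat by metis
  have "torsion_scale c (circle_embed d) = circle_mult m (circle_embed d)"
    unfolding mn(1) by (rule torsion_scale_of_nat[OF prime circle_embed_torsion])
  also have "\<dots> = circle_embed (of_nat (m * n) :: 'f)"
    unfolding mn(2) circle_embed_of_nat by (simp add: circle_mult_abs)
  finally show ?thesis by (simp add: mn)
qed

end

context prime_field_space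
begin

text \<open>The bound \<open>card F powr (- r / 2)\<close> for character sums is the square root of the kernel density \<open>card F powr (- r)\<close>.\<close>

lemma hom_quadratic_factor_coordinates:
  assumes factor: "hom_quadratic_factor TYPE('f) d1 d2 \<psi> \<phi> \<B>"
    and rank: "ereal_of_enat (factor_rank scale d2 \<phi>) \<ge> ereal r"
  obtains L q where "prime_field_factor scale Basis d1 d2 L q (real CARD('f) powr (- r / 2))"
    and "\<And>x y. L x = L y \<Longrightarrow> q x = q y \<Longrightarrow> \<exists>A\<in>\<B>. x \<in> A \<and> y \<in> A"
proof -
  note emb = circle_embed_add[OF prime] circle_embed_diff[OF prime] circle_embed_sum[OF prime]
    circle_embed_0[OF prime] circle_embed_eq_0[OF prime] circle_embed_eq_iff[OF prime]
  define coord where "coord t = (SOME c :: 'f. circle_embed c = t)" for t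
  have coord: "circle_embed (coord t) = t" if "t \<in> torsion_circle TYPE('f)" for t
    unfolding coord_def using circle_embed_surj[OF prime that] by (rule someI_ex)
  have \<psi>: "linear_phase (\<psi> i)" "\<psi> i 0 = 0" "\<psi> i x \<in> torsion_circle TYPE('f)" if "i < d1" for i x
    using factor that by (auto simp: hom_quadratic_factor_def hom_linear_phase_def)
  have \<phi>: "quadratic_phase (\<phi> j)" "\<phi> j x \<in> torsion_circle TYPE('f)" if "j < d2" for j x
    using factor that unfolding hom_quadratic_factor_def hom_quadratic_phase_def by blast+
  have indep: "(\<forall>i<d1. b i = 0) \<and> (\<forall>j<d2. c j = 0)"
    if "\<And>x. phase_comb d1 b \<psi> x + phase_comb d2 c \<phi> x = 0" for b c :: "nat \<Rightarrow> 'f"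
    using factor that unfolding hom_quadratic_factor_def phases_independent_def by blast
  define L where "L x = (\<lambda>i. if i < d1 then coord (\<psi> i x) else 0)" for x
  define q where "q x = (\<lambda>j. if j < d2 then coord (\<phi> j x) else 0)" for x
  have L: "circle_embed (L x i) = \<psi> i x" if "i < d1" for x i using that by (simp add: L_def coord \<psi>)
  have q: "circle_embed (q x j) = \<phi> j x" if "j < d2" for x j using that by (simp add: q_def coord \<phi>)
  have comb\<psi>: "phase_comb d1 b \<psi> x = circle_embed (dot d1 b (L x))" for b x
    by (simp add: phase_comb_def dot_def emb L torsion_scale_circle_embed[OF prime, symmetric])
  have comb\<phi>: "phase_comb d2 c \<phi> x = circle_embed (dot d2 c (q x))" for c x
    by (simp add: phase_comb_def dot_def emb q torsion_scale_circle_embed[OF prime, symmetric])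
  have zero_comb: "phase_comb d (\<lambda>_. 0 :: 'f) \<chi> x = 0" if "\<And>i. i < d \<Longrightarrow> \<chi> i x \<in> torsion_circle TYPE('f)" for d \<chi> x
    using torsion_scale_of_nat[OF prime, of _ 0] that by (simp add: phase_comb_def)
  have pdeg: "pdeg 3 (\<lambda>x. q x j)" for j
  proof (cases "j < d2")
    case True
    have "circle_embed (q (x + h1 + h2 + h3) j - q (x + h1 + h2) j - q (x + h1 + h3) j - q (x + h2 + h3) j
        + q (x + h1) j + q (x + h2) j + q (x + h3) j - q x j) = 0" for x h1 h2 h3
      using \<phi>(1)[OF True] unfolding circle_embed_add[OF prime] circle_embed_diff[OF prime] q[OF True]
        quadratic_phase_def by blast
    then show ?thesis unfolding pdeg_3_iff circle_embed_eq_0[OF prime] by blast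
  next
    case False
    then show ?thesis by (simp add: q_def pdeg_zero del: pdeg.simps)
  qed
  note dot_pdeg = pdeg_dot[of 3 q, OF pdeg]
  have kernel: "real (card {h. \<forall>h'. polar (\<lambda>x. dot d2 \<xi> (q x)) h h' = 0})
      \<le> (real CARD('f) powr (- r / 2))\<^sup>2 * real (card (UNIV :: 'w set))"
    if \<xi>: "\<xi> \<in> fvec d2" "\<xi> \<noteq> 0" for \<xi>
  proof -
    let ?\<phi> = "phase_comb d2 \<xi> \<phi>" and ?K = "{h. \<forall>h'. polar (\<lambda>x. dot d2 \<xi> (q x)) h h' = 0}"
    obtain j where j: "j < d2" "\<xi> j \<noteq> 0" using fvec_eqI[OF \<xi>(1) zero_fvec] \<xi>(2) by auto
    \<comment> \<open>The factor rank only sees combinations that are not identically zero; by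
      independence every nonzero \<xi> gives such a combination.\<close>
    have "\<exists>x. ?\<phi> x \<noteq> 0"
    proof (rule ccontr)
      assume "\<not> ?thesis"
      then have "phase_comb d1 (\<lambda>_. 0 :: 'f) \<psi> x + ?\<phi> x = 0" for x
        using zero_comb[of d1 \<psi> x] \<psi> by simp
      then show False using indep j by blast
    qed
    then have "factor_rank scale d2 \<phi> \<le> enat (phase_rank scale ?\<phi>)"
      unfolding factor_rank_def using j by (intro INF_lower) blast
    then have "ereal_of_enat (factor_rank scale d2 \<phi>) \<le> ereal_of_enat (enat (phase_rank scale ?\<phi>))"
      by (simp only: ereal_of_enat_le_iff)
    with rank have "ereal r \<le> ereal_of_enat (enat (phase_rank scale ?\<phi>))" by (rule order_trans)
    then have r: "r \<le> real (phase_rank scale ?\<phi>)" by simp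
    have "hessian ?\<phi> h h' = circle_embed (polar (\<lambda>x. dot d2 \<xi> (q x)) h h')" for h h'
      by (simp add: hessian_def polar_def comb\<phi> emb)
    then have K: "hessian_kernel ?\<phi> = ?K" by (simp add: hessian_kernel_def emb)
    have sub: "subspace ?K"
      by (rule subspaceI_add) (auto simp: polar_add[OF dot_pdeg])
    \<comment> \<open>\<open>phase_rank\<close> subtracts natural numbers; this inequality allows
      reading it as a real difference.\<close>
    have dimK: "dim ?K \<le> dim (UNIV :: 'w set)" by (rule dim_subset) auto
    have "r \<le> real (dim (UNIV :: 'w set)) - real (dim ?K)"
      using r dimK by (simp add: phase_rank_def K)
    then have "real CARD('f) powr real (dim ?K) \<le> real CARD('f) powr (- r) * real CARD('f) powr real (dim (UNIV :: 'w set))"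
      unfolding powr_add[symmetric] using card5 by (intro powr_mono) auto
    moreover have "real (card ?K) = real CARD('f) powr real (dim ?K)"
      using card_subspace[OF sub] card5 by (simp add: powr_realpow)
    moreover have "real (card (UNIV :: 'w set)) = real CARD('f) powr real (dim (UNIV :: 'w set))"
      using card_subspace[OF subspace_UNIV] card5 by (simp add: powr_realpow)
    moreover have "(real CARD('f) powr (- r / 2))\<^sup>2 = real CARD('f) powr (- r)"
      by (simp add: power2_eq_square flip: powr_add)
    ultimately show ?thesis by (simp only:)
  qed
  have "prime_field_factor scale Basis d1 d2 L q (real CARD('f) powr (- r / 2))"
  proof
    show "L x \<in> fvec d1" "q x \<in> fvec d2" for x by (auto simp: L_def q_def fvec_def)
    show "L (x + y) = L x + L y" for x y
    proof
      fix i
      show "L (x + y) i = (L x + L y) i"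
      proof (cases "i < d1")
        case True
        have "\<psi> i (0 + x + y) - \<psi> i (0 + x) - \<psi> i (0 + y) + \<psi> i 0 = 0"
          using \<psi>(1)[OF True] unfolding linear_phase_def by blast
        then have "\<psi> i (x + y) = \<psi> i x + \<psi> i y" by (simp add: \<psi>(2)[OF True] algebra_simps)
        then have "circle_embed (L (x + y) i) = circle_embed (L x i + L y i)"
          by (simp only: L[OF True] emb(1))
        then show ?thesis unfolding circle_embed_eq_iff[OF prime] by simp
      qed (simp add: L_def)
    qed
    show "\<beta> = 0" if \<beta>: "\<beta> \<in> fvec d1" "\<And>x. dot d1 \<beta> (L x) = 0" for \<beta>
    proof -
      have "phase_comb d1 \<beta> \<psi> x + phase_comb d2 (\<lambda>_. 0 :: 'f) \<phi> x = 0" for x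
        using zero_comb[of d2 \<phi> x] \<phi> \<beta>(2) by (simp add: comb\<psi> emb)
      then have "\<forall>i<d1. \<beta> i = 0" using indep by blast
      then show ?thesis by (intro fvec_eqI[OF \<beta>(1) zero_fvec]) auto
    qed
  qed (use pdeg kernel in auto)
  moreover have "\<exists>A\<in>\<B>. x \<in> A \<and> y \<in> A" if "L x = L y" "q x = q y" for x y
  proof -
    let ?A = "{z. (\<forall>i<d1. \<psi> i z = \<psi> i x) \<and> (\<forall>j<d2. \<phi> j z = \<phi> j x)}"
    have "\<psi> i x = \<psi> i y" if "i < d1" for i using L[OF that] \<open>L x = L y\<close> by metis
    moreover have "\<phi> j x = \<phi> j y" if "j < d2" for j using q[OF that] \<open>q x = q y\<close> by metis
    ultimately have xy: "x \<in> ?A" "y \<in> ?A" by simp_all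
    have "\<B> = joint_level_sets d1 d2 \<psi> \<phi>" using factor by (simp add: hom_quadratic_factor_def)
    moreover have "\<exists>u v. ?A = {z. (\<forall>i<d1. \<psi> i z = u i) \<and> (\<forall>j<d2. \<phi> j z = v j)}"
      by (rule exI[of _ "\<lambda>i. \<psi> i x"], rule exI[of _ "\<lambda>j. \<phi> j x"], rule refl)
    moreover have "?A \<noteq> {}" using xy(1) by (rule ex_in_conv[THEN iffD1, OF exI])
    ultimately have "?A \<in> \<B>" unfolding joint_level_sets_def by (simp only: mem_Collect_eq not_False_eq_True simp_thms)
    with xy show ?thesis by (intro bexI[of _ ?A] conjI)
  qed
  ultimately show thesis using that by blast
qed

end

section \<open>Cosets and translates as affine subspaces, and the theorem\<close>

context prime_field_factor
begin

lemma subspace_kernel: "subspace {x. L x = 0}"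
  and dim_kernel: "dim W \<le> dim {x. L x = 0} + d1"
proof -
  have "{x\<in>W. \<forall>i\<in>{..<d1}. L x i = 0} = {x. L x = 0}"
    using fvec_eqI[OF L_fvec zero_fvec] by (auto simp: fun_eq_iff)
  then show "subspace {x. L x = 0}" "dim W \<le> dim {x. L x = 0} + d1"
    using dim_common_kernel[of "{..<d1}" W "\<lambda>i x. L x i"] by (simp_all add: L_add)
qed

lemma coset_avg_eq_average:
  assumes "a \<in> fvec d1"
  obtains W' where "affine_subspace_of_dim scale W' (dim {x. L x = 0})" "coset_avg g a = average W' g"
proof -
  obtain x0 where x0: "L x0 = a" using card_coset_pos[OF assms] unfolding card_gt_0_iff by blast
  have "{x. L x = a} = (+) x0 ` {x. L x = 0}"
  proof (intro equalityI subsetI)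
    fix x assume "x \<in> {x. L x = a}"
    moreover have "L (x0 + (x - x0)) = L x0 + L (x - x0)" by (rule L_add)
    ultimately have "L (x - x0) = 0" using x0 by simp
    then show "x \<in> (+) x0 ` {x. L x = 0}" by (intro image_eqI[of _ _ "x - x0"]) auto
  qed (auto simp: L_add x0)
  then have "affine_subspace_of_dim scale {x. L x = a} (dim {x. L x = 0})"
    unfolding affine_subspace_of_dim_def using subspace_kernel by blast
  then show thesis using that by (simp add: coset_avg_def average_def)
qed

lemma average_translate:
  fixes x :: 'w
  shows "average ((+) x ` V) g = (\<Sum>y\<in>V. g (x + y)) / real (card V)"
proof -
  have "inj_on ((+) x) V" by (simp add: inj_on_def)
  then show ?thesis by (simp add: average_def sum.reindex card_image)
qed

end

theorem theorem8p6:
  fixes scale :: "'f::{field,finite} \<Rightarrow> 'w::ab_group_add \<Rightarrow> 'w"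
    and Basis :: "'w set"
    and d1 d2 :: nat
    and \<psi> \<phi> :: "nat \<Rightarrow> 'w \<Rightarrow> circle"
    and \<B> :: "'w set set"
    and r \<eta> :: real
    and f :: "nat \<Rightarrow> 'w \<Rightarrow> real"
  assumes "prime CARD('f)" and "CARD('f) \<ge> 5"
    and "finite_dimensional_vector_space scale Basis"
    and "hom_quadratic_factor TYPE('f) d1 d2 \<psi> \<phi> \<B>"
    and "ereal_of_enat (factor_rank scale d2 \<phi>) \<ge> ereal r"
    and "\<And>i x. i \<in> {0..3} \<Longrightarrow> f i x \<in> {0..1}"
    and "\<And>i. i \<in> {0..3} \<Longrightarrow> factor_measurable \<B> (f i)"
    and "\<bar>four_ap_average scale (f 0) (f 1) (f 2) (f 3)
          - average UNIV (f 0) * average UNIV (f 1) * average UNIV (f 2) * average UNIV (f 3)\<bar>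
         \<ge> \<eta>"
    and "(MAX i\<in>{0..3}. average UNIV (f i)) \<le> 6 * \<eta> powr (1 / 4)"
    and "1 \<ge> \<eta>"
    and "\<eta> \<ge> 2 ^ 40 * real CARD('f) powr (6 * real d1 + 6 * real d2 - r)"
  shows "\<exists>i\<in>{0..3}.
      (\<exists>W' n. affine_subspace_of_dim scale W' n
         \<and> real n \<ge> real (vector_space.dim scale (UNIV :: 'w set)) - real d1
         \<and> average W' (f i) \<ge> average UNIV (f i) + (1 / 2 ^ 13) * \<eta>\<^sup>2)
    \<or> (\<exists>(K::nat) W' n. 0 < K \<and> real K \<le> (16 / \<eta>) ^ 3
         \<and> affine_subspace_of_dim scale W' n
         \<and> real n \<ge> 1 / (real K + 1) * real (vector_space.dim scale (UNIV :: 'w set))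
                    - 2 * (16 / \<eta>) ^ 3 - real d1
         \<and> average W' (f i)
             \<ge> average UNIV (f i) + (1 / 2 ^ 10) * real K powr (1 / 3) * \<eta> powr (1 / 4))"
proof (rule ccontr)
  assume neg: "\<not> ?thesis"
  interpret V: finite_dimensional_vector_space scale Basis by fact
  interpret P: prime_field_space scale Basis by unfold_locales fact+
  obtain L q where LQ: "prime_field_factor scale Basis d1 d2 L q (real CARD('f) powr (- r / 2))"
    and atom: "\<And>x y. L x = L y \<Longrightarrow> q x = q y \<Longrightarrow> \<exists>A\<in>\<B>. x \<in> A \<and> y \<in> A"
    using P.hom_quadratic_factor_coordinates[OF assms(4,5)] by blast
  interpret prime_field_factor scale Basis d1 d2 L q "real CARD('f) powr (- r / 2)" by (rule LQ)
  let ?p = "real CARD('f)"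
  have p0: "?p > 0" using assms(2) by simp
  have "?p powr (6 * real d1 + 6 * real d2 - r) > 0" using p0 by simp
  then have \<eta>0: "\<eta> > 0" using assms(11) by (smt (verit) mult_pos_pos zero_less_power)
  define \<kappa> where "\<kappa> = \<eta> powr (1 / 4)"
  have \<kappa>: "0 < \<kappa>" "\<kappa> \<le> 1" using \<eta>0 assms(10) by (auto simp: \<kappa>_def powr_le1)
  have \<kappa>4: "\<kappa> ^ 4 = \<eta>" using \<eta>0 by (simp add: \<kappa>_def powr_powr flip: powr_numeral)
  then have \<kappa>8: "\<kappa> ^ 8 = \<eta>\<^sup>2" by (metis mult_2_right numeral_Bit0 power2_eq_square power_add)
  \<comment> \<open>Squaring both sides gives the hypothesis on \<eta>: the exponent 3 (d1 + d2) - r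
    / 2 doubles, and 2^20 becomes 2^40.\<close>
  have eps: "real (CARD('f) ^ (3 * (d1 + d2))) * ?p powr (- r / 2) \<le> \<kappa>\<^sup>2 / 2 ^ 20"
  proof (rule power2_le_imp_le)
    have "real (CARD('f) ^ (3 * (d1 + d2))) * ?p powr (- r / 2) = ?p powr (3 * (real d1 + real d2) - r / 2)"
      using p0 by (simp add: powr_realpow[symmetric] powr_add[symmetric])
    then have "(real (CARD('f) ^ (3 * (d1 + d2))) * ?p powr (- r / 2))\<^sup>2 = ?p powr (6 * real d1 + 6 * real d2 - r)"
      by (simp add: power2_eq_square algebra_simps flip: powr_add)
    also have "\<dots> \<le> \<eta> / 2 ^ 40" using assms(11) by simp
    also have "\<dots> = (\<kappa>\<^sup>2 / 2 ^ 20)\<^sup>2" by (simp add: \<kappa>4[symmetric] power_divide flip: power_mult)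
    finally show "(real (CARD('f) ^ (3 * (d1 + d2))) * ?p powr (- r / 2))\<^sup>2 \<le> (\<kappa>\<^sup>2 / 2 ^ 20)\<^sup>2" .
  qed simp
  \<comment> \<open>Measurability makes each f i with i <= 3 a function of the pair (L x, q x). The
    default 0 at pairs that are not attained, and for other i, keeps all values in [0, 1].\<close>
  define F where "F i a b = (if i \<le> 3 \<and> (\<exists>x. L x = a \<and> q x = b) then f i (SOME x. L x = a \<and> q x = b) else 0)"
    for i a b
  have F01: "0 \<le> F i a b \<and> F i a b \<le> 1" for i a b
    using assms(6) by (auto simp: F_def)
  have fF: "f i x = F i (L x) (q x)" if "i \<le> 3" for i x
  proof -
    define y where "y = (SOME y. L y = L x \<and> q y = q x)"
    have y: "L y = L x \<and> q y = q x" unfolding y_def by (rule someI[of _ x]) simp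
    then obtain A where "A \<in> \<B>" "x \<in> A" "y \<in> A" using atom[of x y] by metis
    moreover have "factor_measurable \<B> (f i)" using that by (intro assms(7)) simp
    ultimately have "f i x = f i y" unfolding factor_measurable_def by blast
    then show ?thesis using that by (auto simp: F_def y_def)
  qed
  have small: "average UNIV (f i) \<le> 6 * \<kappa>" if "i \<le> 3" for i
  proof -
    have "average UNIV (f i) \<le> (MAX i\<in>{0..3}. average UNIV (f i))" using that by (intro Max_ge) auto
    from order_trans[OF this assms(9)] show ?thesis by (simp only: \<kappa>_def)
  qed
  have dimW: "real (V.dim W) - real d1 \<le> real (V.dim {x. L x = 0})" using dim_kernel by linarith
  have coset: "coset_avg (f i) a \<le> average UNIV (f i) + \<kappa> ^ 8 / 2 ^ 13" if i: "i \<le> 3" and a: "a \<in> fvec d1" for i a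
  proof (rule ccontr)
    assume c: "\<not> ?thesis"
    obtain W' where W': "affine_subspace_of_dim scale W' (V.dim {x. L x = 0})" "coset_avg (f i) a = average W' (f i)"
      using coset_avg_eq_average[OF a] by blast
    have "average W' (f i) \<ge> average UNIV (f i) + (1 / 2 ^ 13) * \<eta>\<^sup>2"
      using c W'(2) by (simp add: \<kappa>8)
    with W'(1) dimW have "\<exists>W' n. affine_subspace_of_dim scale W' n
         \<and> real n \<ge> real (V.dim W) - real d1
         \<and> average W' (f i) \<ge> average UNIV (f i) + (1 / 2 ^ 13) * \<eta>\<^sup>2"
      by (intro exI conjI)
    moreover have "i \<in> {0..3}" using i by simp
    ultimately show False using neg by blast
  qed
  have pieces: "(\<Sum>y\<in>V. f i (x + y)) \<le> (average UNIV (f i) + \<kappa> * real K powr (1/3) / 2 ^ 10) * real (card V)"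
    if "i \<le> 3" "0 < K" "real K \<le> (16 / \<kappa> ^ 4) ^ 3" "V.subspace V"
      "V.dim {x. L x = 0} \<le> (K + 1) * (V.dim V + K) + 2 * K" for i K x V
  proof (rule ccontr)
    assume c: "\<not> ?thesis"
    have cV: "card V > 0" using V.subspace_0[OF that(4)] by (auto simp: card_gt_0_iff)
    have aff: "affine_subspace_of_dim scale ((+) x ` V) (V.dim V)"
      unfolding affine_subspace_of_dim_def using that(4) by blast
    have avg: "average ((+) x ` V) (f i)
        \<ge> average UNIV (f i) + (1 / 2 ^ 10) * real K powr (1 / 3) * \<eta> powr (1 / 4)"
      using c cV unfolding average_translate by (simp add: \<kappa>_def field_simps)
    have K3: "real K \<le> (16 / \<eta>) ^ 3" using that(3) \<kappa>4 by simp
    have "16 / \<eta> \<ge> 16" using \<eta>0 assms(10) by (simp add: field_simps)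
    then have "(16 / \<eta>) ^ 3 \<ge> 16 ^ 3" by (intro power_mono) auto
    \<comment> \<open>After division by K + 1 the pieces lose K dimensions to the linear forms and 2
      K / (K + 1) <= 2 to Chevalley-Warning. Since (16/\<eta>)^3 >= 2, both fit into the term 2
      (16/\<eta>)^3.\<close>
    then have big: "real K + 2 \<le> 2 * (16 / \<eta>) ^ 3" using K3 by simp
    have "real (V.dim {x. L x = 0}) \<le> real ((K + 1) * (V.dim V + K) + 2 * K)"
      using that(5) by (simp only: of_nat_le_iff)
    then have "real (V.dim W) \<le> (real K + 1) * (real (V.dim V) + real K) + 2 * real K + real d1"
      using dimW by (simp add: algebra_simps)
    also have "\<dots> \<le> (real K + 1) * (real (V.dim V) + (real K + 2) + real d1)"
      by (simp add: algebra_simps)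
    also have "\<dots> \<le> (real K + 1) * (real (V.dim V) + 2 * (16 / \<eta>) ^ 3 + real d1)"
      using big by (intro mult_left_mono) auto
    finally have "real (V.dim W) / (real K + 1) \<le> real (V.dim V) + 2 * (16 / \<eta>) ^ 3 + real d1"
      by (simp add: divide_le_eq mult.commute)
    then have "real (V.dim V) \<ge> 1 / (real K + 1) * real (V.dim W) - 2 * (16 / \<eta>) ^ 3 - real d1"
      by simp
    with aff avg K3 that(2) have "\<exists>(K::nat) W' n. 0 < K \<and> real K \<le> (16 / \<eta>) ^ 3
         \<and> affine_subspace_of_dim scale W' n
         \<and> real n \<ge> 1 / (real K + 1) * real (V.dim W) - 2 * (16 / \<eta>) ^ 3 - real d1
         \<and> average W' (f i) \<ge> average UNIV (f i) + (1 / 2 ^ 10) * real K powr (1 / 3) * \<eta> powr (1 / 4)"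
      by (intro exI conjI)
    moreover have "i \<in> {0..3}" using that(1) by simp
    ultimately show False using neg by blast
  qed
  show False
    by (rule no_counterexample[OF \<kappa> F01 fF eps _ small coset pieces]) (use assms(8) \<kappa>4 in auto)
qed

end
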